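(* Let $\alpha\in(0,1)$ and $d\in\mathbb N$. For $N\in\mathbb N$ with $N\ge4$ put $M(N)=\lfloor N(\log N)(\log\log N)^{-(d-1)}\rfloor$. Then $$\frac{(\log N)^{(d-1)(\alpha+\frac12)}}{(N\log N)^\alpha}(\log\log N)^{(d-1)\alpha}\ \lesssim\ d_{N,M(N)}(\mathring U^{\alpha,d}_\infty,L_\infty)\ \lesssim\ \frac{(\log N)^{(d-1)(\alpha+1)}}{(N\log N)^\alpha}(\log\log N)^{(d-1)\alpha}.$$
   Context: Notation: $\mathbb I=[0,1]$, $L_\infty=L_\infty(\mathbb I^d)$; $\log$ is the logarithm to base $2$; $a_N\lesssim b_N$ means that there is a constant $C>0$, independent of $N$ (but possibly depending on $\alpha,d$), with $a_N\le C\,b_N$ for all $N$ in the stated range. Noncontinuous manifold width: for a subset $F$ of a normed space $X$, $d_{N,M}(F,X)=\inf_{(a_N,P_N)}\sup_{f\in F}\|f-P_N(a_N(f))\|_X$, where the infimum is over all pairs of (arbitrary, not necessarily continuous) mappings $a_N:F\to\mathbb R^N$ and $P_N:\mathbb R^N\to X$ such that $P_N$ maps $\mathbb R^N$ into some linear subspace of $X$ of dimension at most $M$. Hölder-Nikol'skii ball: for $u\subset\{1,\dots,d\}$ and $\boldsymbol h$ with positive components, let $\Delta_{\boldsymbol h,u}=\prod_{i\in u}\Delta_{h_i}$, where $\Delta_{h_i}$ is the first difference $g(x)\mapsto g(x+h_i)-g(x)$ acting in the variable $x_i$ (and $\Delta_{\boldsymbol h,\varnothing}=\mathrm{Id}$).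 For $f\in C(\mathbb I^d)$ put $|f|_{H^\alpha_\infty(u)}=\sup_{\boldsymbol h>0}\prod_{i\in u}h_i^{-\alpha}\sup\{|\Delta_{\boldsymbol h,u}f(\boldsymbol x)|:\boldsymbol x\in\mathbb I^d,\ x_i+h_i\in\mathbb I\ \forall i\in u\}$ (for $u=\varnothing$ this is $\|f\|_{C(\mathbb I^d)}$), the supremum being over $\boldsymbol h$ for which the domain is nonempty, and $\|f\|_{H^\alpha_\infty(\mathbb I^d)}=\max_{u\subset\{1,\dots,d\}}|f|_{H^\alpha_\infty(u)}$. $\mathring U^{\alpha,d}_\infty$ is the set of $f\in C(\mathbb I^d)$ vanishing on $\partial\mathbb I^d$ with $\|f\|_{H^\alpha_\infty(\mathbb I^d)}\le1$. *)

theory Defs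
  imports "HOL-Analysis.Analysis" "HOL-Probability.Essential_Supremum"
begin

section \<open>The normed space $L_\infty$ of the unit cube\<close>

abbreviation unit_cube :: "(real ^ 'd::finite) set" where
  "unit_cube \<equiv> cbox 0 1"

abbreviation cube_measure :: "(real ^ 'd::finite) measure" where
  "cube_measure \<equiv> lebesgue_on unit_cube"

lemma mem_unit_cube: "x \<in> unit_cube \<longleftrightarrow> (\<forall>i. x $ i \<in> {0..1})"
  by (simp add: mem_box_cart)

definition ess_bounded :: "(real ^ 'd::finite \<Rightarrow> real) \<Rightarrow> bool" where
  "ess_bounded f \<longleftrightarrow>
     f \<in> borel_measurable cube_measure \<and> (\<exists>c. AE x in cube_measure. \<bar>f x\<bar> \<le> c)"

definition linfty_rel :: "(real ^ 'd::finite \<Rightarrow> real) \<Rightarrow> (real ^ 'd \<Rightarrow> real) \<Rightarrow> bool" where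
  "linfty_rel f g \<longleftrightarrow> ess_bounded f \<and> ess_bounded g \<and> (AE x in cube_measure. f x = g x)"

lemma ess_bounded_const: "ess_bounded (\<lambda>_. c)"
  by (auto simp: ess_bounded_def intro!: exI[of _ "\<bar>c\<bar>"])

lemma ess_bounded_add:
  assumes "ess_bounded f" "ess_bounded g" shows "ess_bounded (\<lambda>x. f x + g x)"
proof -
  from assms obtain a b where f: "f \<in> borel_measurable cube_measure"
    and g: "g \<in> borel_measurable cube_measure"
    and a: "AE x in cube_measure. \<bar>f x\<bar> \<le> a" and b: "AE x in cube_measure. \<bar>g x\<bar> \<le> b"
    by (auto simp: ess_bounded_def)
  have "AE x in cube_measure. \<bar>f x + g x\<bar> \<le> a + b"
    using a b by eventually_elim linarith
  with f g show ?thesis by (auto simp: ess_bounded_def)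
qed

lemma ess_bounded_scale:
  assumes "ess_bounded f" shows "ess_bounded (\<lambda>x. c * f x)"
proof -
  from assms obtain a where f: "f \<in> borel_measurable cube_measure"
    and a: "AE x in cube_measure. \<bar>f x\<bar> \<le> a"
    by (auto simp: ess_bounded_def)
  have "AE x in cube_measure. \<bar>c * f x\<bar> \<le> \<bar>c\<bar> * a"
    using a by eventually_elim (simp add: abs_mult mult_left_mono)
  with f show ?thesis by (auto simp: ess_bounded_def)
qed

lemma ess_bounded_minus: "ess_bounded f \<Longrightarrow> ess_bounded (\<lambda>x. - f x)"
  using ess_bounded_scale[of f "-1"] by simp

lemma ess_bounded_diff: "ess_bounded f \<Longrightarrow> ess_bounded g \<Longrightarrow> ess_bounded (\<lambda>x. f x - g x)"
  using ess_bounded_add[OF _ ess_bounded_minus, of f g] by simp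

lemma ess_bounded_continuous_on:
  assumes "continuous_on unit_cube f" shows "ess_bounded f"
proof -
  have "compact (f ` unit_cube)"
    by (intro compact_continuous_image assms compact_cbox)
  then obtain c where c: "\<And>x. x \<in> unit_cube \<Longrightarrow> \<bar>f x\<bar> \<le> c"
    unfolding compact_eq_bounded_closed bounded_real by auto
  have "AE x in cube_measure. \<bar>f x\<bar> \<le> c"
    by (rule AE_I2) (use c in auto)
  moreover have "f \<in> borel_measurable cube_measure"
    using assms by (intro continuous_imp_measurable_on_sets_lebesgue) auto
  ultimately show ?thesis by (auto simp: ess_bounded_def)
qed

lemma part_equivp_linfty_rel: "part_equivp linfty_rel"
proof (rule part_equivpI)
  show "\<exists>f::real ^ 'd \<Rightarrow> real. linfty_rel f f"
    by (rule exI[of _ "\<lambda>_. 0"]) (simp add: linfty_rel_def ess_bounded_const)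
  show "symp (linfty_rel :: (real ^ 'd \<Rightarrow> real) \<Rightarrow> _)"
    by (auto simp: symp_def linfty_rel_def eq_commute)
  show "transp (linfty_rel :: (real ^ 'd \<Rightarrow> real) \<Rightarrow> _)"
    unfolding transp_def linfty_rel_def by (auto elim: eventually_elim2)
qed

quotient_type (overloaded) 'd linfty = "real ^ 'd::finite \<Rightarrow> real" / partial: linfty_rel
  by (rule part_equivp_linfty_rel)

definition esssup_norm :: "(real ^ 'd::finite \<Rightarrow> real) \<Rightarrow> real" where
  "esssup_norm f = real_of_ereal (esssup cube_measure (\<lambda>x. ereal \<bar>f x\<bar>))"

lemma emeasure_cube_measure: "emeasure (cube_measure :: (real ^ 'd::finite) measure) (space cube_measure) = 1"
proof -
  have "measure lborel (cbox (0::real ^ 'd) 1) = 1"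
    by (subst content_cbox_cart) (auto simp: interval_ne_empty_cart)
  then have "emeasure lborel (cbox (0::real ^ 'd) 1) = 1"
    by (simp add: emeasure_eq_ennreal_measure[OF less_imp_neq[OF emeasure_lborel_cbox_finite, unfolded infinity_ennreal_def]])
  then show ?thesis
    by (simp add: emeasure_restrict_space)
qed

lemma ereal_esssup_norm:
  fixes f :: "real ^ 'd::finite \<Rightarrow> real"
  assumes "ess_bounded f"
  shows "ereal (esssup_norm f) = esssup cube_measure (\<lambda>x. ereal \<bar>f x\<bar>)" "0 \<le> esssup_norm f"
proof -
  from assms obtain c where f[measurable]: "f \<in> borel_measurable cube_measure"
    and c: "AE x in cube_measure. \<bar>f x\<bar> \<le> c"
    by (auto simp: ess_bounded_def)
  have "esssup cube_measure (\<lambda>x. ereal \<bar>f x\<bar>) \<le> ereal c"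
    by (rule esssup_I) (use c in auto)
  moreover have "esssup cube_measure (\<lambda>x::real ^ 'd. ereal 0) \<le> esssup cube_measure (\<lambda>x. ereal \<bar>f x\<bar>)"
    by (rule esssup_mono) auto
  then have ge: "0 \<le> esssup cube_measure (\<lambda>x. ereal \<bar>f x\<bar>)"
    using esssup_const[of "cube_measure :: (real ^ 'd) measure" "ereal 0"] emeasure_cube_measure[where 'd = 'd]
    by (simp add: zero_ereal_def)
  ultimately show "ereal (esssup_norm f) = esssup cube_measure (\<lambda>x. ereal \<bar>f x\<bar>)"
    unfolding esssup_norm_def by (cases "esssup cube_measure (\<lambda>x. ereal \<bar>f x\<bar>)") auto
  show "0 \<le> esssup_norm f"
    unfolding esssup_norm_def using ge by (rule real_of_ereal_pos)
qed

lemma esssup_norm_le_iff: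
  assumes "ess_bounded f"
  shows "esssup_norm f \<le> c \<longleftrightarrow> (AE x in cube_measure. \<bar>f x\<bar> \<le> c)"
proof
  have [measurable]: "f \<in> borel_measurable cube_measure"
    using assms by (simp add: ess_bounded_def)
  assume "esssup_norm f \<le> c"
  moreover have "AE x in cube_measure. ereal \<bar>f x\<bar> \<le> esssup cube_measure (\<lambda>x. ereal \<bar>f x\<bar>)"
    by (rule esssup_AE)
  then have "AE x in cube_measure. \<bar>f x\<bar> \<le> esssup_norm f"
    by (simp flip: ereal_esssup_norm(1)[OF assms])
  ultimately show "AE x in cube_measure. \<bar>f x\<bar> \<le> c"
    by (auto elim: eventually_mono)
next
  have [measurable]: "f \<in> borel_measurable cube_measure"
    using assms by (simp add: ess_bounded_def)
  assume "AE x in cube_measure. \<bar>f x\<bar> \<le> c"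
  then have "esssup cube_measure (\<lambda>x. ereal \<bar>f x\<bar>) \<le> ereal c"
    by (intro esssup_I) auto
  then show "esssup_norm f \<le> c"
    by (simp flip: ereal_esssup_norm(1)[OF assms])
qed

lemma esssup_norm_AE:
  "ess_bounded f \<Longrightarrow> AE x in cube_measure. \<bar>f x\<bar> \<le> esssup_norm f"
  using esssup_norm_le_iff by blast

instantiation linfty :: (finite) real_normed_vector
begin

lift_definition zero_linfty :: "'a linfty" is "\<lambda>_. 0"
  by (simp add: linfty_rel_def ess_bounded_const)

lift_definition plus_linfty :: "'a linfty \<Rightarrow> 'a linfty \<Rightarrow> 'a linfty" is "\<lambda>f g x. f x + g x"
  unfolding linfty_rel_def by (auto intro: ess_bounded_add elim: eventually_elim2)

lift_definition minus_linfty :: "'a linfty \<Rightarrow> 'a linfty \<Rightarrow> 'a linfty" is "\<lambda>f g x. f x - g x"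
  unfolding linfty_rel_def by (auto intro: ess_bounded_diff elim: eventually_elim2)

lift_definition uminus_linfty :: "'a linfty \<Rightarrow> 'a linfty" is "\<lambda>f x. - f x"
  unfolding linfty_rel_def by (auto intro: ess_bounded_minus elim: eventually_mono)

lift_definition scaleR_linfty :: "real \<Rightarrow> 'a linfty \<Rightarrow> 'a linfty" is "\<lambda>c f x. c * f x"
  unfolding linfty_rel_def by (auto intro: ess_bounded_scale elim: eventually_mono)

lift_definition norm_linfty :: "'a linfty \<Rightarrow> real" is esssup_norm
proof -
  fix f g :: "real ^ 'a \<Rightarrow> real"
  assume *: "linfty_rel f g"
  then have [measurable]: "f \<in> borel_measurable cube_measure" "g \<in> borel_measurable cube_measure"
    by (auto simp: linfty_rel_def ess_bounded_def)
  have "esssup cube_measure (\<lambda>x. ereal \<bar>f x\<bar>) = esssup cube_measure (\<lambda>x. ereal \<bar>g x\<bar>)"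
    using * by (intro esssup_AE_cong) (auto simp: linfty_rel_def elim: eventually_mono)
  then show "esssup_norm f = esssup_norm g" by (simp add: esssup_norm_def)
qed

definition sgn_linfty :: "'a linfty \<Rightarrow> 'a linfty"
  where "sgn_linfty f = scaleR (inverse (norm f)) f"

definition dist_linfty :: "'a linfty \<Rightarrow> 'a linfty \<Rightarrow> real"
  where "dist_linfty f g = norm (f - g)"

definition uniformity_linfty :: "('a linfty \<times> 'a linfty) filter"
  where "uniformity_linfty = (INF e\<in>{0<..}. principal {(f, g). dist f g < e})"

definition open_linfty :: "'a linfty set \<Rightarrow> bool"
  where "open_linfty S \<longleftrightarrow> (\<forall>f\<in>S. \<forall>\<^sub>F (f', g) in uniformity. f' = f \<longrightarrow> g \<in> S)"

instance
proof
  fix a b :: real and f g h :: "'a linfty"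
  show "f + g + h = f + (g + h)"
    by transfer (auto simp: linfty_rel_def add.assoc intro!: ess_bounded_add)
  show "f + g = g + f"
    by transfer (auto simp: linfty_rel_def add.commute intro!: ess_bounded_add)
  show "0 + f = f"
    by transfer (auto simp: linfty_rel_def)
  show "- f + f = 0"
    by transfer (auto simp: linfty_rel_def ess_bounded_const)
  show "f - g = f + - g"
    by transfer (auto simp: linfty_rel_def intro!: ess_bounded_diff)
  show "a *\<^sub>R (f + g) = a *\<^sub>R f + a *\<^sub>R g"
    by transfer (auto simp: linfty_rel_def distrib_left intro!: ess_bounded_add ess_bounded_scale)
  show "(a + b) *\<^sub>R f = a *\<^sub>R f + b *\<^sub>R f"
    by transfer (auto simp: linfty_rel_def distrib_right intro!: ess_bounded_add ess_bounded_scale)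
  show "a *\<^sub>R b *\<^sub>R f = (a * b) *\<^sub>R f"
    by transfer (auto simp: linfty_rel_def mult.assoc intro!: ess_bounded_scale)
  show "1 *\<^sub>R f = f"
    by transfer (auto simp: linfty_rel_def)
  show "sgn f = scaleR (inverse (norm f)) f"
    by (fact sgn_linfty_def)
  show "dist f g = norm (f - g)"
    by (fact dist_linfty_def)
  show "(uniformity :: ('a linfty \<times> 'a linfty) filter) =
      (INF e\<in>{0<..}. principal {(f, g). dist f g < e})"
    by (fact uniformity_linfty_def)
  show "open S \<longleftrightarrow> (\<forall>f\<in>S. \<forall>\<^sub>F (f', g) in uniformity. f' = f \<longrightarrow> g \<in> S)" for S :: "'a linfty set"
    by (fact open_linfty_def)
  show "norm f = 0 \<longleftrightarrow> f = 0"
  proof (transfer, unfold linfty_rel_def, elim conjE, rule iffI)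
    fix f :: "real ^ 'a \<Rightarrow> real"
    assume f: "ess_bounded f" and "esssup_norm f = 0"
    then have "AE x in cube_measure. \<bar>f x\<bar> \<le> 0"
      using esssup_norm_AE[OF f] by simp
    with f show "ess_bounded f \<and> ess_bounded (\<lambda>_::real ^ 'a. 0) \<and> (AE x in cube_measure. f x = 0)"
      by (auto intro: ess_bounded_const)
  next
    fix f :: "real ^ 'a \<Rightarrow> real"
    assume f: "ess_bounded f"
      and "ess_bounded f \<and> ess_bounded (\<lambda>_::real ^ 'a. 0) \<and> (AE x in cube_measure. f x = 0)"
    then have "AE x in cube_measure. \<bar>f x\<bar> \<le> 0" by auto
    then have "esssup_norm f \<le> 0" using esssup_norm_le_iff[OF f] by blast
    with ereal_esssup_norm(2)[OF f] show "esssup_norm f = 0" by simp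
  qed
  show "norm (f + g) \<le> norm f + norm g"
  proof (transfer, unfold linfty_rel_def, elim conjE)
    fix f g :: "real ^ 'a \<Rightarrow> real"
    assume f: "ess_bounded f" and g: "ess_bounded g"
    have "AE x in cube_measure. \<bar>f x + g x\<bar> \<le> esssup_norm f + esssup_norm g"
      using esssup_norm_AE[OF f] esssup_norm_AE[OF g] by eventually_elim linarith
    then show "esssup_norm (\<lambda>x. f x + g x) \<le> esssup_norm f + esssup_norm g"
      using esssup_norm_le_iff[OF ess_bounded_add[OF f g]] by blast
  qed
  show "norm (a *\<^sub>R f) = \<bar>a\<bar> * norm f"
  proof (transfer, unfold linfty_rel_def, elim conjE)
    fix a :: real and f :: "real ^ 'a \<Rightarrow> real"
    assume f: "ess_bounded f"
    have le: "esssup_norm (\<lambda>x. c * g x) \<le> \<bar>c\<bar> * esssup_norm g"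
      if g: "ess_bounded g" for c and g :: "real ^ 'a \<Rightarrow> real"
    proof -
      have "AE x in cube_measure. \<bar>c * g x\<bar> \<le> \<bar>c\<bar> * esssup_norm g"
        using esssup_norm_AE[OF g] by eventually_elim (simp add: abs_mult mult_left_mono)
      then show ?thesis
        using esssup_norm_le_iff[OF ess_bounded_scale[OF g]] by blast
    qed
    show "esssup_norm (\<lambda>x. a * f x) = \<bar>a\<bar> * esssup_norm f"
    proof (cases "a = 0")
      case True
      then show ?thesis
        using le[OF f, of 0] ereal_esssup_norm(2)[OF ess_bounded_const[of 0], where 'd = 'a] by simp
    next
      case False
      then have "esssup_norm f \<le> \<bar>1 / a\<bar> * esssup_norm (\<lambda>x. a * f x)"
        using le[OF ess_bounded_scale[OF f, of a], of "1 / a"] by simp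
      then have "\<bar>a\<bar> * esssup_norm f \<le> esssup_norm (\<lambda>x. a * f x)"
        using False by (simp add: field_simps)
      with le[OF f, of a] show ?thesis by simp
    qed
  qed
qed

end

section \<open>Noncontinuous manifold widths\<close>

text \<open>
  \<open>\<real>\<^sup>N\<close> is the set \<open>{..<N} \<rightarrow>\<^sub>E UNIV\<close> of \<open>N\<close>-tuples. ``\<open>V\<close> has dimension at most \<open>M\<close>'' is
  phrased with a finite spanning set, since \<open>dim\<close> is 0 on infinite-dimensional subspaces.
\<close>

definition coding_pairs ::
  "nat \<Rightarrow> nat \<Rightarrow> 'a::real_vector set \<Rightarrow> (('a \<Rightarrow> (nat \<Rightarrow> real)) \<times> ((nat \<Rightarrow> real) \<Rightarrow> 'a)) set" where
  "coding_pairs N M F =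
     {(a, P). a \<in> F \<rightarrow> ({..<N} \<rightarrow>\<^sub>E UNIV) \<and>
        (\<exists>V. subspace V \<and> (\<exists>B. finite B \<and> card B \<le> M \<and> span B = V) \<and>
             P \<in> ({..<N} \<rightarrow>\<^sub>E UNIV) \<rightarrow> V)}"

definition manifold_width :: "nat \<Rightarrow> nat \<Rightarrow> 'a::real_normed_vector set \<Rightarrow> ennreal" where
  "manifold_width N M F =
     (INF (a, P) \<in> coding_pairs N M F. SUP f\<in>F. ennreal (norm (f - P (a f))))"

section \<open>Hoelder-Nikol'skii balls\<close>

definition difference :: "real \<Rightarrow> 'd \<Rightarrow> (real ^ 'd::finite \<Rightarrow> real) \<Rightarrow> real ^ 'd \<Rightarrow> real" where
  "difference t i g = (\<lambda>x. g (x + t *\<^sub>R axis i 1) - g x)"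

definition mixed_difference ::
  "real ^ 'd \<Rightarrow> 'd set \<Rightarrow> (real ^ 'd::finite \<Rightarrow> real) \<Rightarrow> real ^ 'd \<Rightarrow> real" where
  "mixed_difference h u f = Finite_Set.fold (\<lambda>i. difference (h $ i) i) f u"

text \<open>The coordinate differences commute, so the fold is the composition in any order.\<close>

lemma comp_fun_commute_difference: "comp_fun_commute (\<lambda>i. difference (h $ i) i)"
  by standard (simp add: difference_def fun_eq_iff algebra_simps)

lemma mixed_difference_empty [simp]: "mixed_difference h {} f = f"
  by (simp add: mixed_difference_def)

lemma mixed_difference_insert [simp]:
  "i \<notin> u \<Longrightarrow> mixed_difference h (insert i u) f = difference (h $ i) i (mixed_difference h u f)"
  unfolding mixed_difference_def
  by (rule comp_fun_commute_on.fold_insert[of UNIV])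
     (auto simp: comp_fun_commute_difference simp flip: comp_fun_commute_def')

definition difference_domain :: "real ^ 'd \<Rightarrow> 'd set \<Rightarrow> (real ^ 'd::finite) set" where
  "difference_domain h u = {x \<in> unit_cube. \<forall>i\<in>u. x $ i + h $ i \<in> {0..1}}"

definition holder_seminorm :: "real \<Rightarrow> 'd set \<Rightarrow> (real ^ 'd::finite \<Rightarrow> real) \<Rightarrow> ennreal" where
  "holder_seminorm \<alpha> u f =
     (SUP h\<in>{h. (\<forall>i. 0 < h $ i) \<and> difference_domain h u \<noteq> {}}.
        ennreal (\<Prod>i\<in>u. h $ i powr - \<alpha>) *
        (SUP x\<in>difference_domain h u. ennreal \<bar>mixed_difference h u f x\<bar>))"

definition holder_norm :: "real \<Rightarrow> (real ^ 'd::finite \<Rightarrow> real) \<Rightarrow> ennreal" where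
  "holder_norm \<alpha> f = Max (range (\<lambda>u. holder_seminorm \<alpha> u f))"

text \<open>The ball is taken as a subset of \<open>L\<^sub>\<infinity>\<close>; \<open>abs_linfty\<close> sends a function to its class.\<close>

definition holder_ball :: "real \<Rightarrow> 'd::finite linfty set" where
  "holder_ball \<alpha> = abs_linfty ` {f. continuous_on unit_cube f \<and>
     (\<forall>x\<in>frontier unit_cube. f x = 0) \<and> holder_norm \<alpha> f \<le> 1}"

end

theory Submission
  imports Defs "HOL-Real_Asymp.Real_Asymp"
begin

text \<open>
  Since the code map need not be continuous, one real parameter can encode all coefficients, and
  the width is the Kolmogorov width of dimension \<open>M\<close> as soon as \<open>N \<ge> 1\<close>.

  Upper bound: the piecewise constant sampling operators on the dyadic grids of mesh \<open>2\<^sup>-\<^sup>t\<close>, tensorised,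
  split \<open>f\<close> into blocks indexed by \<open>j\<close> with all \<open>j i \<ge> 1\<close> (the boundary condition kills the
  others). A block is a mixed difference of \<open>f\<close>, hence at most \<open>2 powr (- \<alpha> \<bar>j\<bar>)\<close>, and keeping
  \<open>\<bar>j\<bar> \<le> m\<close> costs dimension of order \<open>2\<^sup>m m\<^sup>d\<^sup>-\<^sup>1\<close> with an error of order \<open>m\<^sup>d\<^sup>-\<^sup>1 2 powr (- \<alpha> m)\<close>.

  Lower bound: signed sums over all products of wavelets of total level \<open>m\<close>, scaled by
  \<open>4 powr (- \<alpha> m)\<close>, lie in a multiple of the ball. The wavelet has two vanishing moments and is
  affine between its nodes, so these products are orthogonal on every shifted grid. A generic shift
  avoids the null sets on which an essential bound may fail, and for suitable signs the sum is far,
  in mean square over the grid, from any \<open>M\<close>-dimensional subspace.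
\<close>

section \<open>Manifold widths and Kolmogorov widths\<close>

text \<open>Put D = d - 1, L = log N, and let Y be M(N) / L^D up to rounding. The iterated logarithm
  enters only through M(N): the two rates are L^D Y^(-\<alpha>) and L^(D/2) Y^(-\<alpha>), and they
  come from levels m with 2^m, respectively 4^m, proportional to Y. The gap L^(D/2) has one source.
  About L^D level vectors share a total level; the upper bound adds the moduli of their blocks at
  every point, whereas the lower bound measures an orthogonal sum in mean square and gains only the
  square root of that number.

  The order of choices shapes the lower bound. Classes have no point values, the null set to avoid
  depends on the approximant and thus on the sign pattern, and the good pattern is found only after
  the grid is fixed. The shift is therefore taken good for all of the finitely many patterns at
  once.\<close>

lemma ex_inj_sequences_real: "\<exists>J :: (nat \<Rightarrow> real) \<Rightarrow> real. inj J"
proof -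
  obtain h :: "nat set \<Rightarrow> real" where h: "bij h"
    using nat_sets_eqpoll_reals by (auto simp: eqpoll_def)
  \<comment> \<open>A sequence of reals is a sequence of sets of naturals, hence a set of pairs,
    hence again one set of naturals.\<close>
  define S :: "(nat \<Rightarrow> real) \<Rightarrow> nat set"
    where "S = (\<lambda>c. {n. snd (prod_decode n) \<in> inv h (c (fst (prod_decode n)))})"
  have "inj S"
  proof (rule injI)
    fix c c' assume eq: "S c = S c'"
    have "k \<in> inv h (c i) \<longleftrightarrow> k \<in> inv h (c' i)" for i k
      using arg_cong[OF eq, of "\<lambda>T. prod_encode (i, k) \<in> T"] by (simp add: S_def)
    then have "inv h (c i) = inv h (c' i)" for i by auto
    then show "c = c'"
      using h by (metis bij_is_surj surj_f_inv_f ext)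
  qed
  then have "inj (h \<circ> S)"
    using h by (auto intro: inj_compose dest: bij_is_inj)
  then show ?thesis by blast
qed

text \<open>
  A single real number encodes a point of any finite-dimensional space, so without continuity
  \<open>N \<ge> 1\<close> code parameters put no constraint on the approximant beyond \<open>dim V \<le> M\<close>.
\<close>

lemma manifold_width_le:
  fixes F :: "'a::real_normed_vector set"
  assumes N: "N \<ge> 1" and B: "finite B" "card B \<le> M"
    and approx: "\<And>f. f \<in> F \<Longrightarrow> \<exists>v\<in>span B. norm (f - v) \<le> e"
  shows "manifold_width N M F \<le> ennreal e"
proof -
  obtain J :: "(nat \<Rightarrow> real) \<Rightarrow> real" where J: "inj J"
    using ex_inj_sequences_real by blast
  obtain b where b: "bij_betw b {..<card B} B"
    using bij_betw_from_nat_into_finite[OF B(1)] by blast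
  define lin where "lin = (\<lambda>c. \<Sum>i<card B. c i *\<^sub>R b i)"
  have lin_in: "lin c \<in> span B" for c
    unfolding lin_def using b by (intro span_sum span_scale span_base) (auto simp: bij_betw_def)
  have "\<exists>c. norm (f - lin c) \<le> e" if f: "f \<in> F" for f
  proof -
    obtain v where v: "v \<in> span B" "norm (f - v) \<le> e" using approx[OF f] by blast
    then obtain u where "v = (\<Sum>x\<in>B. u x *\<^sub>R x)"
      using span_finite[OF B(1)] by auto
    also have "\<dots> = lin (\<lambda>i. u (b i))"
      unfolding lin_def by (rule sum.reindex_bij_betw[OF b, symmetric])
    finally show ?thesis using v by auto
  qed
  then obtain c where c: "\<And>f. f \<in> F \<Longrightarrow> norm (f - lin (c f)) \<le> e" by metis
  define a where "a = (\<lambda>f. restrict (\<lambda>_. J (c f)) {..<N})"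
  \<comment> \<open>Only the entry at index 0 is read; it exists because
    \<open>N \<ge> 1\<close>.\<close>
  define P where "P = (\<lambda>y. lin (inv J (y (0::nat))))"
  have Pa: "P (a f) = lin (c f)" for f
    using N J by (simp add: P_def a_def)
  have "(a, P) \<in> coding_pairs N M F"
    unfolding coding_pairs_def using B lin_in
    by (intro CollectI case_prodI conjI exI[of _ "span B"] exI[of _ B]) (auto simp: a_def P_def)
  then have "manifold_width N M F \<le> (SUP f\<in>F. ennreal (norm (f - P (a f))))"
    unfolding manifold_width_def by (rule INF_lower2) simp
  also have "\<dots> \<le> ennreal e"
    using c by (intro SUP_least) (auto simp: Pa intro: ennreal_leI)
  finally show ?thesis .
qed

text \<open>The factorisation through N parameters is given up here: what survives of a coding pair
  is a map into the span of at most M vectors.\<close>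

lemma manifold_width_ge:
  fixes F :: "'a::real_normed_vector set"
  assumes "\<And>B P. finite B \<Longrightarrow> card B \<le> M \<Longrightarrow> (\<And>f. f \<in> F \<Longrightarrow> P f \<in> span B)
    \<Longrightarrow> \<exists>f\<in>F. e \<le> norm (f - P f)"
  shows "ennreal e \<le> manifold_width N M F"
  unfolding manifold_width_def
proof (rule INF_greatest, clarify)
  fix a P assume aP: "(a, P) \<in> coding_pairs N M F"
  then obtain B where B: "finite B" "card B \<le> M" and a: "a \<in> F \<rightarrow> ({..<N} \<rightarrow>\<^sub>E UNIV)"
    and P: "P \<in> ({..<N} \<rightarrow>\<^sub>E UNIV) \<rightarrow> span B"
    unfolding coding_pairs_def by auto
  have "P (a f) \<in> span B" if "f \<in> F" for f
    using a P that by (auto simp: Pi_iff)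
  then obtain f where "f \<in> F" "e \<le> norm (f - P (a f))"
    using assms[OF B, of "\<lambda>f. P (a f)"] by blast
  then show "ennreal e \<le> (SUP f\<in>F. ennreal (norm (f - P (a f))))"
    by (intro SUP_upper2[of f]) (auto intro: ennreal_leI)
qed

section \<open>Linear combinations of classes in $L_\infty$\<close>

lemma linfty_rel_refl: "linfty_rel f f \<longleftrightarrow> ess_bounded f"
  by (auto simp: linfty_rel_def)

lemma abs_linfty_add:
  "ess_bounded f \<Longrightarrow> ess_bounded g \<Longrightarrow> abs_linfty (\<lambda>x. f x + g x) = abs_linfty f + abs_linfty g"
  by (rule plus_linfty.abs_eq[symmetric]) (simp_all add: linfty_rel_refl)

lemma abs_linfty_diff:
  "ess_bounded f \<Longrightarrow> ess_bounded g \<Longrightarrow> abs_linfty (\<lambda>x. f x - g x) = abs_linfty f - abs_linfty g"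
  by (rule minus_linfty.abs_eq[symmetric]) (simp_all add: linfty_rel_refl)

lemma abs_linfty_scale:
  "ess_bounded f \<Longrightarrow> abs_linfty (\<lambda>x. c * f x) = c *\<^sub>R abs_linfty f"
  by (rule scaleR_linfty.abs_eq[symmetric]) (simp add: linfty_rel_refl)

lemma ess_bounded_sum:
  "(\<And>b. b \<in> B \<Longrightarrow> ess_bounded (g b)) \<Longrightarrow> ess_bounded (\<lambda>x. \<Sum>b\<in>B. c b * g b x)"
  by (induction B rule: infinite_finite_induct)
     (auto intro!: ess_bounded_const ess_bounded_add ess_bounded_scale)

lemma abs_linfty_sum:
  "(\<And>b. b \<in> B \<Longrightarrow> ess_bounded (g b)) \<Longrightarrow>
    abs_linfty (\<lambda>x. \<Sum>b\<in>B. c b * g b x) = (\<Sum>b\<in>B. c b *\<^sub>R abs_linfty (g b))"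
  by (induction B rule: infinite_finite_induct)
     (simp_all add: zero_linfty_def abs_linfty_add abs_linfty_scale ess_bounded_scale ess_bounded_sum)

lemma norm_abs_linfty_le:
  "ess_bounded f \<Longrightarrow> norm (abs_linfty f) \<le> e \<longleftrightarrow> (AE x in cube_measure. \<bar>f x\<bar> \<le> e)"
  by (simp add: norm_linfty.abs_eq linfty_rel_refl esssup_norm_le_iff)

lemma ess_bounded_rep_linfty: "ess_bounded (rep_linfty b)"
  using Quotient_rep_reflp[OF Quotient_linfty] by (simp add: linfty_rel_refl)

lemma abs_rep_linfty: "abs_linfty (rep_linfty b) = b"
  by (rule Quotient_abs_rep[OF Quotient_linfty])

text \<open>Passage from classes to functions: with representatives of the spanning vectors fixed
  once, every element of the span becomes a function that can be evaluated off a null set.\<close>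

lemma norm_diff_span_le:
  assumes "ess_bounded f" "norm (abs_linfty f - (\<Sum>b\<in>B. u b *\<^sub>R b)) \<le> e"
  shows "AE x in cube_measure. \<bar>f x - (\<Sum>b\<in>B. u b * rep_linfty b x)\<bar> \<le> e"
proof -
  have s: "ess_bounded (\<lambda>x. \<Sum>b\<in>B. u b * rep_linfty b x)"
    by (intro ess_bounded_sum ess_bounded_rep_linfty)
  have "abs_linfty (\<lambda>x. f x - (\<Sum>b\<in>B. u b * rep_linfty b x)) = abs_linfty f - (\<Sum>b\<in>B. u b *\<^sub>R b)"
    using assms(1) s by (simp add: abs_linfty_diff abs_linfty_sum ess_bounded_rep_linfty abs_rep_linfty)
  then show ?thesis
    using assms(2) norm_abs_linfty_le[OF ess_bounded_diff[OF assms(1) s]] by simp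
qed

section \<open>Mixed differences\<close>

text \<open>A mixed difference at \<open>x\<close> reads \<open>f\<close> only at the corners of a
  box with edges in the directions of \<open>u\<close>. This allows changing \<open>h\<close> off
  \<open>u\<close>, and replacing \<open>f\<close> by 0 when all corners lie on the boundary of the
  cube.\<close>

lemma mixed_difference_cong:
  fixes h h' x :: "real ^ 'd::finite"
  assumes "\<And>i. i \<in> u \<Longrightarrow> h $ i = h' $ i"
    and "\<And>y. (\<And>i. y $ i = x $ i \<or> i \<in> u \<and> y $ i = x $ i + h $ i) \<Longrightarrow> f y = g y"
  shows "mixed_difference h u f x = mixed_difference h' u g x"
proof -
  have "finite u" by simp
  then show ?thesis using assms
  proof (induction u arbitrary: x)
    case empty
    then show ?case by simp
  next
    case (insert i u)
    have "mixed_difference h u f (x + (h $ i) *\<^sub>R axis i 1)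
        = mixed_difference h' u g (x + (h $ i) *\<^sub>R axis i 1)"
    proof (rule insert.IH)
      show "h $ l = h' $ l" if "l \<in> u" for l using insert.prems(1) that by blast
      fix y assume y: "\<And>l. y $ l = (x + (h $ i) *\<^sub>R axis i 1) $ l
        \<or> l \<in> u \<and> y $ l = (x + (h $ i) *\<^sub>R axis i 1) $ l + h $ l"
      show "f y = g y"
      proof (rule insert.prems(2))
        fix l
        show "y $ l = x $ l \<or> l \<in> insert i u \<and> y $ l = x $ l + h $ l"
          using y[of l] insert.hyps by (cases "l = i") (auto simp: axis_def)
      qed
    qed
    moreover have "mixed_difference h u f x = mixed_difference h' u g x"
      using insert.prems by (intro insert.IH) blast+
    ultimately show ?case
      using insert.hyps insert.prems(1)[of i] by (simp add: difference_def)
  qed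
qed

lemma mixed_difference_zero: "mixed_difference h u (\<lambda>_. 0) = (\<lambda>_. 0)"
proof -
  have "finite u" by simp
  then show ?thesis by (induction u) (simp_all add: difference_def)
qed

lemma mixed_difference_eq_0:
  assumes "i \<in> u" "h $ i = 0"
  shows "mixed_difference h u f = (\<lambda>_. 0)"
  using assms mixed_difference_insert[of i "u - {i}" h f]
  by (simp add: insert_absorb difference_def)

lemma holder_norm_le_1_bound:
  fixes f :: "real ^ 'd::finite \<Rightarrow> real"
  assumes f: "holder_norm \<alpha> f \<le> 1" and h: "\<And>i. 0 < h $ i" and x: "x \<in> difference_domain h u"
  shows "\<bar>mixed_difference h u f x\<bar> \<le> (\<Prod>i\<in>u. h $ i powr \<alpha>)"
proof -
  have "holder_seminorm \<alpha> u f \<le> holder_norm \<alpha> f"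
    unfolding holder_norm_def by (rule Max_ge) auto
  then have le: "holder_seminorm \<alpha> u f \<le> 1" using f by simp
  have "ennreal ((\<Prod>i\<in>u. h $ i powr - \<alpha>) * \<bar>mixed_difference h u f x\<bar>)
      = ennreal (\<Prod>i\<in>u. h $ i powr - \<alpha>) * ennreal \<bar>mixed_difference h u f x\<bar>"
    by (intro ennreal_mult prod_nonneg) auto
  also have "\<dots> \<le> ennreal (\<Prod>i\<in>u. h $ i powr - \<alpha>) *
        (SUP x\<in>difference_domain h u. ennreal \<bar>mixed_difference h u f x\<bar>)"
    by (intro mult_left_mono SUP_upper x) auto
  also have "\<dots> \<le> holder_seminorm \<alpha> u f"
    unfolding holder_seminorm_def using h x by (intro SUP_upper) auto
  also note le
  finally have "(\<Prod>i\<in>u. h $ i powr - \<alpha>) * \<bar>mixed_difference h u f x\<bar> \<le> 1"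
    by simp
  moreover have "(\<Prod>i\<in>u. h $ i powr - \<alpha>) = inverse (\<Prod>i\<in>u. h $ i powr \<alpha>)"
    by (simp add: powr_minus prod_inversef[symmetric] o_def)
  moreover have "0 < (\<Prod>i\<in>u. h $ i powr \<alpha>)"
    using h by (intro prod_pos) (auto simp: less_imp_neq[symmetric])
  ultimately show ?thesis by (simp add: field_simps)
qed

section \<open>Dyadic blocks of a function\<close>

definition dyadic_floor :: "nat \<Rightarrow> real \<Rightarrow> real" where
  "dyadic_floor t y = of_int \<lfloor>2 ^ t * y\<rfloor> / 2 ^ t"

definition dyadic_step :: "('d \<Rightarrow> nat) \<Rightarrow> real ^ 'd \<Rightarrow> real ^ 'd::finite" where
  "dyadic_step j x = (\<chi> i. dyadic_floor (j i) (x $ i) - dyadic_floor (j i - 1) (x $ i))"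

definition dyadic_base :: "'d set \<Rightarrow> ('d \<Rightarrow> nat) \<Rightarrow> real ^ 'd \<Rightarrow> real ^ 'd::finite" where
  "dyadic_base u j x = (\<chi> i. dyadic_floor (if i \<in> u then j i - 1 else j i) (x $ i))"

text \<open>With S_t denoting sampling at \<open>dyadic_floor t\<close>, the left end of the dyadic
  interval of the point, this is the tensor product of S_(j i) - S_(j i - 1) over \<open>i\<close>
  in \<open>u\<close> and of S_(j i) over the other coordinates.\<close>

definition dyadic_block :: "'d set \<Rightarrow> (real ^ 'd \<Rightarrow> real) \<Rightarrow> ('d \<Rightarrow> nat) \<Rightarrow> real ^ 'd::finite \<Rightarrow> real" where
  "dyadic_block u f j x = mixed_difference (dyadic_step j x) u f (dyadic_base u j x)"

lemma dyadic_floor_le: "dyadic_floor t y \<le> y"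
  and dyadic_floor_nonneg: "0 \<le> y \<Longrightarrow> 0 \<le> dyadic_floor t y"
  and dyadic_floor_ge: "y - 1 / 2 ^ t \<le> dyadic_floor t y"
  and dyadic_floor_0: "0 \<le> y \<Longrightarrow> y < 1 \<Longrightarrow> dyadic_floor 0 y = 0"
  and dyadic_floor_1: "dyadic_floor t 1 = 1"
proof -
  have "of_int \<lfloor>2 ^ t * y\<rfloor> \<le> 2 ^ t * y" "2 ^ t * y - 1 \<le> of_int \<lfloor>2 ^ t * y\<rfloor>" by linarith+
  then show "dyadic_floor t y \<le> y" "y - 1 / 2 ^ t \<le> dyadic_floor t y"
    using divide_right_mono[of "2 ^ t * y - 1" "of_int \<lfloor>2 ^ t * y\<rfloor>" "2 ^ t"]
    by (simp_all add: dyadic_floor_def divide_le_eq diff_divide_distrib mult.commute)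
  show "0 \<le> y \<Longrightarrow> 0 \<le> dyadic_floor t y" by (simp add: dyadic_floor_def)
  show "0 \<le> y \<Longrightarrow> y < 1 \<Longrightarrow> dyadic_floor 0 y = 0" by (simp add: dyadic_floor_def floor_eq_iff)
  have "\<lfloor>2 ^ t :: real\<rfloor> = 2 ^ t" by (metis floor_of_int of_int_numeral of_int_power)
  then show "dyadic_floor t 1 = 1" by (simp add: dyadic_floor_def)
qed

text \<open>The coarse sample is a function of the fine cell index alone; this makes blocks constant
  on cells.\<close>

lemma dyadic_floor_pred:
  assumes "t \<ge> 1"
  shows "dyadic_floor (t - 1) y = of_int (\<lfloor>2 ^ t * y\<rfloor> div 2) / 2 ^ (t - 1)"
proof -
  obtain s where s: "t = Suc s" using assms by (cases t) auto
  have "\<lfloor>2 ^ s * y\<rfloor> = \<lfloor>(2 ^ t * y) / of_int 2\<rfloor>" by (simp add: s)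
  also have "\<dots> = \<lfloor>2 ^ t * y\<rfloor> div 2" by (subst floor_divide_real_eq_div) auto
  finally show ?thesis by (simp add: s dyadic_floor_def)
qed

text \<open>Refining a grid by one level moves the sample by nothing or by exactly one fine mesh,
  according to the parity of the fine index.\<close>

lemma dyadic_floor_step:
  assumes "t \<ge> 1"
  shows "dyadic_floor t y - dyadic_floor (t - 1) y \<in> {0, 1 / 2 ^ t}"
proof -
  obtain s where s: "t = Suc s" using assms by (cases t) auto
  define k where "k = \<lfloor>2 ^ t * y\<rfloor>"
  have "dyadic_floor t y - dyadic_floor (t - 1) y = of_int (k - 2 * (k div 2)) / 2 ^ t"
    unfolding dyadic_floor_pred[OF assms] by (simp add: dyadic_floor_def k_def s field_simps)
  moreover have "k - 2 * (k div 2) \<in> {0, 1}" by auto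
  ultimately show ?thesis by auto
qed

lemma dyadic_block_insert:
  assumes i: "i \<notin> u"
  shows "dyadic_block (insert i u) f j x = dyadic_block u f j x - dyadic_block u f (j(i := j i - 1)) x"
proof -
  have "dyadic_base (insert i u) j x + (dyadic_step j x $ i) *\<^sub>R axis i 1 = dyadic_base u j x"
    using i by (auto simp: vec_eq_iff dyadic_base_def dyadic_step_def axis_def)
  moreover have "dyadic_base (insert i u) j x = dyadic_base u (j(i := j i - 1)) x"
    using i by (auto simp: vec_eq_iff dyadic_base_def)
  moreover have "mixed_difference (dyadic_step j x) u f y
      = mixed_difference (dyadic_step (j(i := j i - 1)) x) u f y" for y
    using i by (intro mixed_difference_cong) (auto simp: dyadic_step_def)
  ultimately show ?thesis
    using i by (simp add: dyadic_block_def difference_def)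
qed

text \<open>Sampling at level 0 sends coordinate \<open>i\<close> to 0, or to 1 if
  \<open>x $ i = 1\<close>; hence every corner read by the block is a boundary point of the
  cube.\<close>

lemma dyadic_block_eq_0:
  assumes x: "x \<in> unit_cube" and f: "\<And>y. y \<in> frontier unit_cube \<Longrightarrow> f y = 0"
    and i: "i \<notin> u" "j i = 0"
  shows "dyadic_block u f j x = 0"
proof -
  have x01: "0 \<le> x $ l" "x $ l \<le> 1" for l using x by (auto simp: mem_unit_cube)
  have bnd: "0 \<le> dyadic_floor t (x $ l)" "dyadic_floor t (x $ l) \<le> 1" for t l
    using x01[of l] dyadic_floor_nonneg[of "x $ l" t] dyadic_floor_le[of t "x $ l"] by auto
  have "dyadic_block u f j x = mixed_difference (dyadic_step j x) u (\<lambda>_. 0) (dyadic_base u j x)"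
    unfolding dyadic_block_def
  proof (rule mixed_difference_cong)
    fix y assume y: "\<And>l. y $ l = dyadic_base u j x $ l
      \<or> l \<in> u \<and> y $ l = dyadic_base u j x $ l + dyadic_step j x $ l"
    have "\<forall>l. \<exists>t. y $ l = dyadic_floor t (x $ l)"
    proof
      fix l show "\<exists>t. y $ l = dyadic_floor t (x $ l)"
        using y[of l] by (auto simp: dyadic_base_def dyadic_step_def)
    qed
    then have "y \<in> unit_cube" unfolding mem_unit_cube using bnd by (metis atLeastAtMost_iff)
    moreover have "y $ i = 0 \<or> y $ i = 1"
      using y[of i] i x01[of i] dyadic_floor_0[of "x $ i"] dyadic_floor_1[of 0]
      by (cases "x $ i = 1") (auto simp: dyadic_base_def)
    then have "y \<notin> interior unit_cube"
      unfolding interior_cbox mem_box_cart by (auto intro!: exI[of _ i])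
    ultimately have "y \<in> frontier unit_cube" by (simp add: frontier_def closed_cbox)
    then show "f y = 0" by (rule f)
  qed auto
  then show ?thesis by (simp add: mixed_difference_zero)
qed

text \<open>Interpolates between the single finest level vector, for \<open>u = {}\<close>, and all
  level vectors in \<open>{1..R}\<close>, for \<open>u = UNIV\<close>; an induction on
  \<open>u\<close> frees one coordinate at a time.\<close>

definition level_box :: "nat \<Rightarrow> 'd set \<Rightarrow> ('d \<Rightarrow> nat) set" where
  "level_box R u = {j. \<forall>i. if i \<in> u then j i \<in> {1..R} else j i = R}"

lemma sum_level_box_insert:
  assumes i: "i \<notin> u"
  shows "(\<Sum>j\<in>level_box R (insert i u). F j) = (\<Sum>j\<in>level_box R u. \<Sum>t\<in>{1..R}. F (j(i := t)))"
  unfolding sum.cartesian_product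
  by (rule sum.reindex_bij_witness[where i = "\<lambda>(j, t). j(i := t)" and j = "\<lambda>j. (j(i := R), j i)"])
     (use i in \<open>auto simp: level_box_def split: if_splits\<close>)

text \<open>Telescoping in one coordinate after the other. The lower end of each telescope is a
  block of level 0 in a coordinate outside \<open>u\<close>, which the boundary condition
  annihilates.\<close>

lemma sum_dyadic_block:
  fixes f :: "real ^ 'd::finite \<Rightarrow> real"
  assumes x: "x \<in> unit_cube" and f: "\<And>y. y \<in> frontier unit_cube \<Longrightarrow> f y = 0"
  shows "(\<Sum>j\<in>level_box R u. dyadic_block u f j x) = f (\<chi> i. dyadic_floor R (x $ i))"
proof -
  have "finite u" by simp
  then show ?thesis
  proof (induction u)
    case empty
    have "level_box R {} = {\<lambda>_::'d. R}" by (auto simp: level_box_def)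
    then show ?case by (simp add: dyadic_block_def dyadic_base_def)
  next
    case (insert i u)
    have "(\<Sum>t\<in>{1..R}. dyadic_block (insert i u) f (j(i := t)) x) = dyadic_block u f j x"
      if j: "j \<in> level_box R u" for j
    proof -
      define B where "B t = dyadic_block u f (j(i := t)) x" for t
      have "(\<Sum>t\<in>{1..R}. dyadic_block (insert i u) f (j(i := t)) x) = (\<Sum>t\<in>{Suc 0..R}. B t - B (t - 1))"
        using insert.hyps by (simp add: dyadic_block_insert B_def)
      also have "\<dots> = B R - B 0"
        using sum_telescope''[of 0 R B] by simp
      also have "B 0 = 0"
        unfolding B_def using insert.hyps by (intro dyadic_block_eq_0[OF x f, where i = i]) auto
      also have "B R = dyadic_block u f j x"
        unfolding B_def using j insert.hyps by (auto simp: level_box_def fun_upd_idem)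
      finally show ?thesis by (simp only: diff_zero)
    qed
    then show ?case
      using insert by (simp add: sum_level_box_insert)
  qed
qed

text \<open>Either some step is 0 and the block vanishes, or all steps are
  \<open>1 / 2 ^ j i\<close> and the Hoelder condition for the full set of coordinates applies with
  exactly these increments.\<close>

lemma dyadic_block_bound:
  fixes f :: "real ^ 'd::finite \<Rightarrow> real"
  assumes f: "holder_norm \<alpha> f \<le> 1" and x: "x \<in> unit_cube" and j: "\<And>i. j i \<ge> 1"
  shows "\<bar>dyadic_block UNIV f j x\<bar> \<le> (2 powr - \<alpha>) ^ (\<Sum>i\<in>UNIV. j i)"
proof (cases "\<exists>i. dyadic_step j x $ i = 0")
  case True
  then show ?thesis by (auto simp: dyadic_block_def mixed_difference_eq_0)
next
  case False
  then have h: "dyadic_step j x $ i = 1 / 2 ^ j i" for i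
    using dyadic_floor_step[OF j[of i], of "x $ i"] by (auto simp: dyadic_step_def)
  have x01: "0 \<le> x $ l" "x $ l \<le> 1" for l using x by (auto simp: mem_unit_cube)
  have bnd: "0 \<le> dyadic_floor t (x $ l)" "dyadic_floor t (x $ l) \<le> 1" for t l
    using x01[of l] dyadic_floor_nonneg[of "x $ l" t] dyadic_floor_le[of t "x $ l"] by auto
  have "dyadic_base UNIV j x \<in> difference_domain (dyadic_step j x) UNIV"
    using bnd by (auto simp: difference_domain_def mem_unit_cube dyadic_base_def dyadic_step_def)
  then have "\<bar>dyadic_block UNIV f j x\<bar> \<le> (\<Prod>i\<in>UNIV. (dyadic_step j x $ i) powr \<alpha>)"
    unfolding dyadic_block_def by (intro holder_norm_le_1_bound f) (auto simp: h)
  also have "\<dots> = (\<Prod>i\<in>UNIV. (2 powr - \<alpha>) ^ j i)"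
    by (intro prod.cong refl)
       (simp add: h powr_divide powr_minus power_one_over powr_powr powr_realpow[symmetric]
         inverse_eq_divide mult.commute)
  also have "\<dots> = (2 powr - \<alpha>) ^ (\<Sum>i\<in>UNIV. j i)" by (simp add: power_sum)
  finally show ?thesis .
qed

section \<open>Counting levels\<close>

text \<open>All coordinates but one lie in \<open>{0..s}\<close>, and together with the sum they
  determine the remaining one.\<close>

lemma card_levels_le:
  fixes s :: nat
  shows "finite {j :: 'd::finite \<Rightarrow> nat. (\<Sum>i\<in>UNIV. j i) = s}"
    and "card {j :: 'd::finite \<Rightarrow> nat. (\<Sum>i\<in>UNIV. j i) = s} \<le> (s + 1) ^ (CARD('d) - 1)"
proof -
  obtain i0 :: 'd where True by simp
  let ?S = "{j :: 'd \<Rightarrow> nat. (\<Sum>i\<in>UNIV. j i) = s}"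
  let ?T = "PiE (UNIV - {i0}) (\<lambda>_. {0..s})"
  have inj: "inj_on (\<lambda>j. restrict j (UNIV - {i0})) ?S"
  proof (rule inj_onI, rule ext)
    fix j j' :: "'d \<Rightarrow> nat" and i
    assume j: "j \<in> ?S" and j': "j' \<in> ?S" and eq: "restrict j (UNIV - {i0}) = restrict j' (UNIV - {i0})"
    have off: "j l = j' l" if "l \<noteq> i0" for l using fun_cong[OF eq, of l] that by simp
    have "(\<Sum>i\<in>UNIV. j i) = j i0 + (\<Sum>i\<in>UNIV - {i0}. j i)"
      "(\<Sum>i\<in>UNIV. j' i) = j' i0 + (\<Sum>i\<in>UNIV - {i0}. j' i)"
      by (auto intro!: sum.remove)
    moreover have "(\<Sum>i\<in>UNIV - {i0}. j i) = (\<Sum>i\<in>UNIV - {i0}. j' i)"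
      using off by (intro sum.cong) auto
    ultimately have "j i0 = j' i0" using j j' by auto
    then show "j i = j' i" using off by (cases "i = i0") auto
  qed
  have sub: "(\<lambda>j. restrict j (UNIV - {i0})) ` ?S \<subseteq> ?T"
  proof (intro image_subsetI)
    fix j assume j: "j \<in> ?S"
    have "j i \<le> s" for i
      using j member_le_sum[of i UNIV j] by simp
    then show "restrict j (UNIV - {i0}) \<in> ?T" by (auto simp: restrict_PiE_iff)
  qed
  have fin: "finite ?T" by (intro finite_PiE) auto
  show "finite ?S" using inj_on_finite[OF inj sub fin] .
  have "card ?S \<le> card ?T" using card_inj_on_le[OF inj sub fin] .
  also have "card ?T = (s + 1) ^ (CARD('d) - 1)" by (simp add: card_PiE card_Diff_singleton)
  finally show "card ?S \<le> (s + 1) ^ (CARD('d) - 1)" .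
qed

lemma sum_levels_le:
  fixes g :: "nat \<Rightarrow> real" and J :: "('d::finite \<Rightarrow> nat) set"
  assumes J: "finite J" "\<And>j. j \<in> J \<Longrightarrow> (\<Sum>i\<in>UNIV. j i) \<in> T" and T: "finite T"
    and g: "\<And>s. s \<in> T \<Longrightarrow> 0 \<le> g s"
  shows "(\<Sum>j\<in>J. g (\<Sum>i\<in>UNIV. j i)) \<le> (\<Sum>s\<in>T. real (s + 1) ^ (CARD('d) - 1) * g s)"
proof -
  have "(\<Sum>j\<in>J. g (\<Sum>i\<in>UNIV. j i)) = (\<Sum>s\<in>T. \<Sum>j | j \<in> J \<and> (\<Sum>i\<in>UNIV. j i) = s. g (\<Sum>i\<in>UNIV. j i))"
    using J T by (intro sum.group[symmetric]) auto
  also have "\<dots> \<le> (\<Sum>s\<in>T. real (s + 1) ^ (CARD('d) - 1) * g s)"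
  proof (rule sum_mono)
    fix s assume s: "s \<in> T"
    have "card {j \<in> J. (\<Sum>i\<in>UNIV. j i) = s} \<le> card {j :: 'd \<Rightarrow> nat. (\<Sum>i\<in>UNIV. j i) = s}"
      by (intro card_mono card_levels_le(1)) auto
    also note card_levels_le(2)
    finally have "real (card {j \<in> J. (\<Sum>i\<in>UNIV. j i) = s}) \<le> real ((s + 1) ^ (CARD('d) - 1))"
      by (rule of_nat_mono)
    then show "(\<Sum>j | j \<in> J \<and> (\<Sum>i\<in>UNIV. j i) = s. g (\<Sum>i\<in>UNIV. j i)) \<le> real (s + 1) ^ (CARD('d) - 1) * g s"
      using g[OF s] by (simp add: mult_right_mono)
  qed
  finally show ?thesis .
qed

section \<open>Geometric series with polynomial weights\<close>

lemma summable_poly_times_geometric: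
  fixes r :: real
  assumes r: "0 < r" "r < 1"
  shows "summable (\<lambda>t. real (t + 1) ^ D * r ^ t)"
proof -
  \<comment> \<open>One factor \<open>q ^ t\<close> absorbs the polynomial, the other one is the
    geometric majorant.\<close>
  define q where "q = sqrt r"
  have q: "0 < q" "q < 1" and rq: "r = q * q" using r by (auto simp: q_def)
  have "(\<lambda>t. real (t + 1) ^ D * q ^ t) \<longlonglongrightarrow> 0"
    using q by real_asymp
  then have "Bseq (\<lambda>t. real (t + 1) ^ D * q ^ t)"
    by (intro convergent_imp_Bseq) (auto simp: convergent_def)
  then obtain K where K: "\<And>t. norm (real (t + 1) ^ D * q ^ t) \<le> K"
    by (auto simp: Bseq_def)
  show ?thesis
  proof (rule summable_comparison_test)
    show "summable (\<lambda>t. K * q ^ t)"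
      using q by (intro summable_mult summable_geometric) simp
    have "norm (real (t + 1) ^ D * r ^ t) \<le> K * q ^ t" for t
    proof -
      have "norm (real (t + 1) ^ D * r ^ t) = norm (real (t + 1) ^ D * q ^ t) * q ^ t"
        using q by (simp add: rq power_mult_distrib abs_mult)
      also have "\<dots> \<le> K * q ^ t" using q by (intro mult_right_mono K) auto
      finally show ?thesis .
    qed
    then show "\<exists>N. \<forall>t\<ge>N. norm (real (t + 1) ^ D * r ^ t) \<le> K * q ^ t" by blast
  qed
qed

text \<open>After the shift by \<open>m\<close>, the inequality t + m + 1 \<le> (t + 1) (m + 1)
  separates the value at \<open>m\<close> from a convergent series. The bound does not depend on
  \<open>n\<close>.\<close>

lemma poly_times_geometric_tail:
  fixes r :: real
  assumes r: "0 < r" "r < 1"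
  shows "(\<Sum>s\<in>{m<..n}. real (s + 1) ^ D * r ^ s)
    \<le> (\<Sum>t. real (t + 1) ^ D * r ^ t) * (real (m + 1) ^ D * r ^ m)"
proof -
  have "(\<Sum>s\<in>{m<..n}. real (s + 1) ^ D * r ^ s) = (\<Sum>t\<in>{0<..n - m}. real (t + m + 1) ^ D * r ^ (t + m))"
    by (rule sum.reindex_bij_witness[where i = "\<lambda>t. t + m" and j = "\<lambda>s. s - m"]) auto
  also have "\<dots> \<le> (\<Sum>t\<in>{0<..n - m}. (real (t + 1) ^ D * r ^ t) * (real (m + 1) ^ D * r ^ m))"
  proof (rule sum_mono)
    fix t
    have "real (t + m + 1) \<le> real (t + 1) * real (m + 1)" by (simp add: algebra_simps)
    then have "real (t + m + 1) ^ D \<le> (real (t + 1) * real (m + 1)) ^ D" by (intro power_mono) auto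
    then have "real (t + m + 1) ^ D * r ^ (t + m) \<le> (real (t + 1) * real (m + 1)) ^ D * r ^ (t + m)"
      using r by (intro mult_right_mono) auto
    then show "real (t + m + 1) ^ D * r ^ (t + m)
        \<le> (real (t + 1) ^ D * r ^ t) * (real (m + 1) ^ D * r ^ m)"
      by (simp add: power_mult_distrib power_add mult_ac)
  qed
  also have "\<dots> = (\<Sum>t\<in>{0<..n - m}. real (t + 1) ^ D * r ^ t) * (real (m + 1) ^ D * r ^ m)"
    by (simp add: sum_distrib_right)
  also have "\<dots> \<le> (\<Sum>t. real (t + 1) ^ D * r ^ t) * (real (m + 1) ^ D * r ^ m)"
    using r by (intro mult_right_mono sum_le_suminf summable_poly_times_geometric) auto
  finally show ?thesis .
qed


section \<open>Hyperbolic cross approximation\<close>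

definition cross_levels :: "nat \<Rightarrow> ('d::finite \<Rightarrow> nat) set" where
  "cross_levels m = {j. (\<forall>i. 1 \<le> j i) \<and> (\<Sum>i\<in>UNIV. j i) \<le> m}"

definition dyadic_cell :: "('d \<Rightarrow> nat) \<times> ('d \<Rightarrow> nat) \<Rightarrow> (real ^ 'd::finite) set" where
  "dyadic_cell = (\<lambda>(j, k). {x. \<forall>i. \<lfloor>2 ^ j i * x $ i\<rfloor> = int (k i)})"

text \<open>The index \<open>k i = 2 ^ j i\<close>, which within the cube means
  \<open>x $ i = 1\<close>, is left out: the blocks vanish there.\<close>

definition cross_cells :: "nat \<Rightarrow> (('d::finite \<Rightarrow> nat) \<times> ('d \<Rightarrow> nat)) set" where
  "cross_cells m = (SIGMA j : cross_levels m. {k. \<forall>i. k i < 2 ^ j i})"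

lemma finite_cross_levels: "finite (cross_levels m :: ('d::finite \<Rightarrow> nat) set)"
proof (rule finite_subset)
  show "cross_levels m \<subseteq> (\<Union>s\<in>{..m}. {j :: 'd \<Rightarrow> nat. (\<Sum>i\<in>UNIV. j i) = s})"
    by (auto simp: cross_levels_def)
qed (auto intro: card_levels_le(1))

lemma card_cross_cells:
  "finite (cross_cells m :: (('d::finite \<Rightarrow> nat) \<times> ('d \<Rightarrow> nat)) set)"
  "real (card (cross_cells m :: (('d \<Rightarrow> nat) \<times> ('d \<Rightarrow> nat)) set)) \<le> real (m + 1) ^ (CARD('d) - 1) * 2 ^ (m + 1)"
proof -
  have eq: "{k. \<forall>i. k i < 2 ^ j i} = PiE UNIV (\<lambda>i. {..<2 ^ j i})" for j :: "'d \<Rightarrow> nat"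
    by (auto simp: PiE_def Pi_def)
  have fin: "finite {k. \<forall>i. k i < (2::nat) ^ j i}" for j :: "'d \<Rightarrow> nat"
    unfolding eq by (intro finite_PiE) auto
  then show "finite (cross_cells m :: (('d \<Rightarrow> nat) \<times> ('d \<Rightarrow> nat)) set)"
    unfolding cross_cells_def by (intro finite_SigmaI finite_cross_levels) auto
  have "card {k. \<forall>i. k i < (2::nat) ^ j i} = 2 ^ (\<Sum>i\<in>UNIV. j i)" for j :: "'d \<Rightarrow> nat"
    unfolding eq by (simp add: card_PiE power_sum)
  then have "real (card (cross_cells m :: (('d \<Rightarrow> nat) \<times> ('d \<Rightarrow> nat)) set))
      = (\<Sum>j\<in>(cross_levels m :: ('d \<Rightarrow> nat) set). 2 ^ (\<Sum>i\<in>UNIV. j i))"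
    unfolding cross_cells_def using fin finite_cross_levels by (subst card_SigmaI) auto
  also have "\<dots> \<le> (\<Sum>s\<in>{..m}. real (s + 1) ^ (CARD('d) - 1) * 2 ^ s)"
    by (rule sum_levels_le) (auto simp: finite_cross_levels, auto simp: cross_levels_def)
  also have "\<dots> \<le> (\<Sum>s\<in>{..m}. real (m + 1) ^ (CARD('d) - 1) * 2 ^ s)"
    by (intro sum_mono mult_right_mono power_mono) auto
  also have "(\<Sum>s\<in>{..m}. real (m + 1) ^ (CARD('d) - 1) * 2 ^ s) = real (m + 1) ^ (CARD('d) - 1) * (2 ^ (m + 1) - 1)"
  proof -
    have "(\<Sum>s\<in>{..m}. 2 ^ s) = (2 :: real) ^ (m + 1) - 1" by (induction m) auto
    then show ?thesis by (simp add: sum_distrib_left[symmetric])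
  qed
  also have "\<dots> \<le> real (m + 1) ^ (CARD('d) - 1) * 2 ^ (m + 1)"
    by (intro mult_left_mono) auto
  finally show "real (card (cross_cells m :: (('d \<Rightarrow> nat) \<times> ('d \<Rightarrow> nat)) set))
    \<le> real (m + 1) ^ (CARD('d) - 1) * 2 ^ (m + 1)" .
qed

text \<open>At a finite resolution \<open>R\<close> the telescoped identity is exact at the sampled
  point, and the blocks outside the cross are bounded independently of \<open>R\<close>. As
  \<open>R\<close> grows the sampled point tends to \<open>x\<close>, and continuity of
  \<open>f\<close> carries the bound over.\<close>

lemma dyadic_block_tail:
  fixes f :: "real ^ 'd::finite \<Rightarrow> real"
  assumes \<alpha>: "0 < \<alpha>"
    and f: "continuous_on unit_cube f" "\<And>y. y \<in> frontier unit_cube \<Longrightarrow> f y = 0" "holder_norm \<alpha> f \<le> 1"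
    and x: "x \<in> unit_cube"
  shows "\<bar>f x - (\<Sum>j\<in>cross_levels m. dyadic_block UNIV f j x)\<bar>
    \<le> (\<Sum>t. real (t + 1) ^ (CARD('d) - 1) * (2 powr - \<alpha>) ^ t)
      * (real (m + 1) ^ (CARD('d) - 1) * (2 powr - \<alpha>) ^ m)" (is "_ \<le> ?e")
proof (rule LIMSEQ_le_const2)
  let ?r = "2 powr - \<alpha>" let ?D = "CARD('d) - 1"
  have r: "0 < ?r" "?r < 1" using \<alpha> by (auto simp: powr_less_one)
  let ?y = "\<lambda>R. \<chi> i. dyadic_floor R (x $ i)"
  have x01: "0 \<le> x $ l" "x $ l \<le> 1" for l using x by (auto simp: mem_unit_cube)
  have y: "?y R \<in> unit_cube" for R
    unfolding mem_unit_cube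
    using x01 dyadic_floor_nonneg dyadic_floor_le order_trans by fastforce
  have "(\<lambda>R. dyadic_floor R (x $ i)) \<longlonglongrightarrow> x $ i" for i
  proof (rule real_tendsto_sandwich)
    show "(\<lambda>R. x $ i - 1 / 2 ^ R) \<longlonglongrightarrow> x $ i" by real_asymp
    show "(\<lambda>R. x $ i) \<longlonglongrightarrow> x $ i" by simp
  qed (auto simp: dyadic_floor_ge dyadic_floor_le)
  then have "?y \<longlonglongrightarrow> x" by (intro vec_tendstoI) simp
  then have "(\<lambda>R. f (?y R)) \<longlonglongrightarrow> f x"
    using f(1) x y by (intro continuous_on_tendsto_compose[OF f(1)]) auto
  then show "(\<lambda>R. \<bar>f (?y R) - (\<Sum>j\<in>cross_levels m. dyadic_block UNIV f j x)\<bar>)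
      \<longlonglongrightarrow> \<bar>f x - (\<Sum>j\<in>cross_levels m. dyadic_block UNIV f j x)\<bar>"
    by (intro tendsto_intros)
  have "\<bar>f (?y R) - (\<Sum>j\<in>cross_levels m. dyadic_block UNIV f j x)\<bar> \<le> ?e" if R: "R \<ge> m" for R
  proof -
    let ?L = "level_box R UNIV :: ('d \<Rightarrow> nat) set"
    have L: "?L = PiE UNIV (\<lambda>_. {1..R})" by (auto simp: level_box_def PiE_def Pi_def)
    have finL: "finite ?L" unfolding L by (intro finite_PiE) auto
    have sub: "cross_levels m \<subseteq> ?L"
    proof
      fix j :: "'d \<Rightarrow> nat" assume j: "j \<in> cross_levels m"
      have "j i \<le> (\<Sum>i\<in>UNIV. j i)" for i using member_le_sum[of i UNIV j] by simp
      moreover have "(\<Sum>i\<in>UNIV. j i) \<le> R" using j R by (auto simp: cross_levels_def)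
      ultimately have "j i \<le> R" for i using order_trans by blast
      then show "j \<in> ?L" using j by (auto simp: cross_levels_def level_box_def)
    qed
    have "f (?y R) = (\<Sum>j\<in>?L. dyadic_block UNIV f j x)"
      by (rule sum_dyadic_block[OF x f(2), symmetric])
    also have "\<dots> = (\<Sum>j\<in>?L - cross_levels m. dyadic_block UNIV f j x)
        + (\<Sum>j\<in>cross_levels m. dyadic_block UNIV f j x)"
      by (rule sum.subset_diff[OF sub finL])
    finally have "\<bar>f (?y R) - (\<Sum>j\<in>cross_levels m. dyadic_block UNIV f j x)\<bar>
        = \<bar>\<Sum>j\<in>?L - cross_levels m. dyadic_block UNIV f j x\<bar>" by simp
    also have "\<dots> \<le> (\<Sum>j\<in>?L - cross_levels m. ?r ^ (\<Sum>i\<in>UNIV. j i))"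
      by (rule order_trans[OF sum_abs], rule sum_mono, rule dyadic_block_bound[OF f(3) x])
         (auto simp: level_box_def)
    \<comment> \<open>Outside the cross the total level exceeds \<open>m\<close>, and in the box it
      is at most \<open>CARD('d) * R\<close>.\<close>
    also have "\<dots> \<le> (\<Sum>s\<in>{m<..CARD('d) * R}. real (s + 1) ^ ?D * ?r ^ s)"
    proof (rule sum_levels_le)
      fix j assume j: "j \<in> ?L - cross_levels m"
      then have "(\<Sum>i\<in>UNIV. j i) \<le> (\<Sum>i\<in>(UNIV :: 'd set). R)"
        by (intro sum_mono) (auto simp: level_box_def)
      then show "(\<Sum>i\<in>UNIV. j i) \<in> {m<..CARD('d) * R}"
        using j by (auto simp: level_box_def cross_levels_def)
    qed (use finL r in auto)
    also have "\<dots> \<le> ?e" by (rule poly_times_geometric_tail[OF r])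
    finally show ?thesis .
  qed
  then show "\<exists>R0. \<forall>R\<ge>R0. \<bar>f (?y R) - (\<Sum>j\<in>cross_levels m. dyadic_block UNIV f j x)\<bar> \<le> ?e" by blast
qed

section \<open>Blocks as step functions on dyadic cells\<close>

lemma ess_bounded_indicator_dyadic_cell: "ess_bounded (indicator (dyadic_cell jk))"
proof -
  obtain j k where jk: "jk = (j, k)" by (cases jk)
  have [measurable]: "(\<lambda>x :: real ^ 'a. x $ i) \<in> borel_measurable borel" for i
    by (intro borel_measurable_continuous_onI continuous_intros)
  have "dyadic_cell jk = {x \<in> space borel. \<forall>i. \<lfloor>2 ^ j i * x $ i\<rfloor> = int (k i)}"
    by (simp add: jk dyadic_cell_def)
  also have "\<dots> \<in> sets borel" by measurable
  finally have "(\<lambda>x. indicator (dyadic_cell jk) x :: real) \<in> borel_measurable borel"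
    by (rule borel_measurable_indicator)
  then have "indicat_real (dyadic_cell jk) \<in> borel_measurable cube_measure"
    by (intro measurable_restrict_space1 measurable_completion) simp
  moreover have "AE x in cube_measure. \<bar>indicator (dyadic_cell jk) x :: real\<bar> \<le> 1"
    by (intro always_eventually) (auto simp: indicator_def)
  ultimately show ?thesis unfolding ess_bounded_def by blast
qed

text \<open>A block depends on \<open>x\<close> only through the indices of its cell, so it may be
  evaluated at the lower corner of the cell.\<close>

lemma dyadic_block_eq_sum_cells:
  fixes f :: "real ^ 'd::finite \<Rightarrow> real"
  assumes x: "x \<in> unit_cube" and j: "\<And>i. 1 \<le> j i"
  shows "dyadic_block UNIV f j x =
    (\<Sum>k | \<forall>i. k i < 2 ^ j i. dyadic_block UNIV f j (\<chi> i. real (k i) / 2 ^ j i) * indicator (dyadic_cell (j, k)) x)"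
proof -
  let ?K = "{k :: 'd \<Rightarrow> nat. \<forall>i. k i < 2 ^ j i}"
  have "?K = PiE UNIV (\<lambda>i. {..<2 ^ j i})" by (auto simp: PiE_def Pi_def)
  then have finK: "finite ?K" by (simp add: finite_PiE)
  have x01: "0 \<le> x $ l" "x $ l \<le> 1" for l using x by (auto simp: mem_unit_cube)
  define \<kappa> where "\<kappa> = (\<lambda>i. nat \<lfloor>2 ^ j i * x $ i\<rfloor>)"
  have \<kappa>: "int (\<kappa> i) = \<lfloor>2 ^ j i * x $ i\<rfloor>" for i using x01[of i] by (simp add: \<kappa>_def)
  have cell: "x \<in> dyadic_cell (j, k) \<longleftrightarrow> k = \<kappa>" for k
    by (auto simp: dyadic_cell_def fun_eq_iff \<kappa>[symmetric])
  show ?thesis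
  proof (cases "\<kappa> \<in> ?K")
    case True
    have fl: "\<lfloor>2 ^ j i * (real (\<kappa> i) / 2 ^ j i)\<rfloor> = \<lfloor>2 ^ j i * x $ i\<rfloor>" for i
      by (simp add: \<kappa>[symmetric])
    have "dyadic_floor t (real (\<kappa> i) / 2 ^ j i) = dyadic_floor t (x $ i)" if "t \<in> {j i, j i - 1}" for i t
    proof -
      have "dyadic_floor (j i) (real (\<kappa> i) / 2 ^ j i) = dyadic_floor (j i) (x $ i)"
        by (simp only: dyadic_floor_def fl)
      moreover have "dyadic_floor (j i - 1) (real (\<kappa> i) / 2 ^ j i) = dyadic_floor (j i - 1) (x $ i)"
        by (simp only: dyadic_floor_pred[OF j] fl)
      ultimately show ?thesis using that by blast
    qed
    then have eq: "dyadic_block UNIV f j (\<chi> i. real (\<kappa> i) / 2 ^ j i) = dyadic_block UNIV f j x"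
      by (simp add: dyadic_block_def dyadic_base_def dyadic_step_def)
    have "(\<Sum>k\<in>?K. dyadic_block UNIV f j (\<chi> i. real (k i) / 2 ^ j i) * indicator (dyadic_cell (j, k)) x)
        = (\<Sum>k\<in>?K. if k = \<kappa> then dyadic_block UNIV f j x else 0)"
      by (intro sum.cong refl) (auto simp: cell indicator_def eq)
    then show ?thesis using True finK by simp
  next
    \<comment> \<open>Some index has reached \<open>2 ^ j i\<close>, so \<open>x $ i = 1\<close>;
      both samples of this coordinate are then 1 and the step is 0.\<close>
    case False
    then obtain i where "\<kappa> i \<ge> 2 ^ j i" by (auto simp: not_less)
    then have "int (2 ^ j i) \<le> \<lfloor>2 ^ j i * x $ i\<rfloor>" unfolding \<kappa>[symmetric] by (simp only: of_nat_le_iff)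
    then have "2 ^ j i \<le> 2 ^ j i * x $ i" by (simp add: le_floor_iff)
    then have "1 \<le> x $ i" by simp
    then have "x $ i = 1" using x01(2)[of i] by linarith
    then have "dyadic_step j x $ i = 0" by (simp add: dyadic_step_def dyadic_floor_1)
    then have "dyadic_block UNIV f j x = 0" by (simp add: dyadic_block_def mixed_difference_eq_0)
    moreover have "indicator (dyadic_cell (j, k)) x = (0 :: real)" if "k \<in> ?K" for k
      using that False by (auto simp: indicator_def cell)
    ultimately show ?thesis by simp
  qed
qed

section \<open>Upper bounds for the width of the ball\<close>

lemma manifold_width_holder_ball_le_1:
  assumes "N \<ge> 1"
  shows "manifold_width N M (holder_ball \<alpha> :: 'd::finite linfty set) \<le> 1"
proof -
  have "manifold_width N M (holder_ball \<alpha> :: 'd linfty set) \<le> ennreal 1"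
  proof (rule manifold_width_le[OF assms])
    show "finite {}" "card {} \<le> M" by simp_all
    fix F assume "F \<in> (holder_ball \<alpha> :: 'd linfty set)"
    then obtain f :: "real ^ 'd \<Rightarrow> real" where f: "continuous_on unit_cube f" "holder_norm \<alpha> f \<le> 1"
      and F: "F = abs_linfty f"
      unfolding holder_ball_def by blast
    have "\<bar>f x\<bar> \<le> 1" if "x \<in> unit_cube" for x
      \<comment> \<open>The seminorm for the empty set of coordinates is the sup norm, so 0
        approximates within 1. This serves the N whose dimension is too small for any cross.\<close>
      using holder_norm_le_1_bound[OF f(2), of 1 x "{}"] that
      by (simp add: difference_domain_def)
    then have "norm F \<le> 1"
      unfolding F norm_abs_linfty_le[OF ess_bounded_continuous_on[OF f(1)]]
      by (intro AE_I2) simp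
    then show "\<exists>v\<in>span {}. norm (F - v) \<le> 1" by simp
  qed
  then show ?thesis by simp
qed

text \<open>The hypothesis has the form \<open>< real M + 1\<close> because \<open>M\<close> will be
  the integer part of a real bound for the number of cells.\<close>

lemma manifold_width_holder_ball_le:
  assumes \<alpha>: "0 < \<alpha>" and N: "N \<ge> 1"
    and M: "real (m + 1) ^ (CARD('d) - 1) * 2 ^ (m + 1) < real M + 1"
  shows "manifold_width N M (holder_ball \<alpha> :: 'd::finite linfty set)
    \<le> ennreal ((\<Sum>t. real (t + 1) ^ (CARD('d) - 1) * (2 powr - \<alpha>) ^ t)
      * (real (m + 1) ^ (CARD('d) - 1) * (2 powr - \<alpha>) ^ m))" (is "_ \<le> ennreal ?e")
proof (rule manifold_width_le[OF N])
  let ?ind = "\<lambda>jk :: ('d \<Rightarrow> nat) \<times> ('d \<Rightarrow> nat). indicat_real (dyadic_cell jk)"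
  let ?I = "cross_cells m :: (('d \<Rightarrow> nat) \<times> ('d \<Rightarrow> nat)) set"
  let ?B = "(\<lambda>jk. abs_linfty (?ind jk)) ` ?I"
  show "finite ?B" by (intro finite_imageI card_cross_cells(1))
  have "real (card ?I) < real M + 1"
    using card_cross_cells(2)[where 'd = 'd, of m] M by linarith
  then show "card ?B \<le> M"
    using card_image_le[OF card_cross_cells(1)[where 'd = 'd, of m], of "\<lambda>jk. abs_linfty (?ind jk)"] by linarith
  fix F assume "F \<in> (holder_ball \<alpha> :: 'd linfty set)"
  then obtain f :: "real ^ 'd \<Rightarrow> real" where f: "continuous_on unit_cube f"
    "\<And>y. y \<in> frontier unit_cube \<Longrightarrow> f y = 0" "holder_norm \<alpha> f \<le> 1"
    and F: "F = abs_linfty f"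
    unfolding holder_ball_def by blast
  define c where "c = (\<lambda>(j, k). dyadic_block UNIV f j (\<chi> i. real (k i) / 2 ^ j i))"
  define g where "g x = (\<Sum>jk\<in>?I. c jk * ?ind jk x)" for x
  have ebf: "ess_bounded f" by (rule ess_bounded_continuous_on[OF f(1)])
  have ebg: "ess_bounded g"
    unfolding g_def by (intro ess_bounded_sum ess_bounded_indicator_dyadic_cell)
  have "abs_linfty g = (\<Sum>jk\<in>?I. c jk *\<^sub>R abs_linfty (?ind jk))"
    unfolding g_def by (intro abs_linfty_sum ess_bounded_indicator_dyadic_cell)
  then have gB: "abs_linfty g \<in> span ?B"
    by (simp only:) (intro span_sum span_scale span_base imageI)
  have "\<bar>f x - g x\<bar> \<le> ?e" if x: "x \<in> unit_cube" for x
  proof -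
    have fin: "finite {k. \<forall>i. k i < (2::nat) ^ j i}" for j :: "'d \<Rightarrow> nat"
    proof -
      have "{k. \<forall>i. k i < (2::nat) ^ j i} = PiE UNIV (\<lambda>i. {..<2 ^ j i})" by (auto simp: PiE_def Pi_def)
      then show ?thesis by (simp add: finite_PiE)
    qed
    have "g x = (\<Sum>(j, k)\<in>(SIGMA j:cross_levels m. {k. \<forall>i. k i < 2 ^ j i}).
        dyadic_block UNIV f j (\<chi> i. real (k i) / 2 ^ j i) * ?ind (j, k) x)"
      unfolding g_def cross_cells_def by (intro sum.cong refl) (auto simp: c_def)
    also have "\<dots> = (\<Sum>j\<in>cross_levels m. \<Sum>k | \<forall>i. k i < 2 ^ j i.
        dyadic_block UNIV f j (\<chi> i. real (k i) / 2 ^ j i) * ?ind (j, k) x)"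
      by (rule sum.Sigma[symmetric]) (auto simp: finite_cross_levels fin)
    also have "\<dots> = (\<Sum>j\<in>cross_levels m. dyadic_block UNIV f j x)"
      by (intro sum.cong refl dyadic_block_eq_sum_cells[symmetric] x) (auto simp: cross_levels_def)
    finally show ?thesis using dyadic_block_tail[OF \<alpha> f x, of m] by simp
  qed
  then have "norm (abs_linfty (\<lambda>x. f x - g x)) \<le> ?e"
    unfolding norm_abs_linfty_le[OF ess_bounded_diff[OF ebf ebg]] by (intro AE_I2) simp
  then have "norm (F - abs_linfty g) \<le> ?e"
    by (simp add: F abs_linfty_diff ebf ebg)
  then show "\<exists>v\<in>span ?B. norm (F - v) \<le> ?e" using gB by blast
qed

section \<open>Orthogonal families on a finite set\<close>

lemma sum_square_diff_orthogonal:
  fixes \<phi> :: "'i \<Rightarrow> 'z \<Rightarrow> real"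
  assumes "finite I"
    and orth: "\<And>a b. a \<in> I \<Longrightarrow> b \<in> I \<Longrightarrow> (\<Sum>z\<in>Z. \<phi> a z * \<phi> b z) = (if a = b then \<nu> a else 0)"
  shows "(\<Sum>z\<in>Z. (y z - (\<Sum>a\<in>I. c a * \<phi> a z))\<^sup>2)
    = (\<Sum>z\<in>Z. (y z)\<^sup>2) - 2 * (\<Sum>a\<in>I. c a * (\<Sum>z\<in>Z. y z * \<phi> a z)) + (\<Sum>a\<in>I. (c a)\<^sup>2 * \<nu> a)"
proof -
  have "(\<Sum>z\<in>Z. (y z - (\<Sum>a\<in>I. c a * \<phi> a z))\<^sup>2)
      = (\<Sum>z\<in>Z. (y z)\<^sup>2) - 2 * (\<Sum>z\<in>Z. y z * (\<Sum>a\<in>I. c a * \<phi> a z)) + (\<Sum>z\<in>Z. (\<Sum>a\<in>I. c a * \<phi> a z)\<^sup>2)"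
    by (simp add: power2_diff sum.distrib sum_subtractf sum_distrib_left mult_ac)
  also have "(\<Sum>z\<in>Z. y z * (\<Sum>a\<in>I. c a * \<phi> a z)) = (\<Sum>a\<in>I. c a * (\<Sum>z\<in>Z. y z * \<phi> a z))"
    by (simp add: sum_distrib_left mult_ac) (rule sum.swap)
  also have "(\<Sum>z\<in>Z. (\<Sum>a\<in>I. c a * \<phi> a z)\<^sup>2) = (\<Sum>a\<in>I. (c a)\<^sup>2 * \<nu> a)"
  proof -
    have "(\<Sum>z\<in>Z. (\<Sum>a\<in>I. c a * \<phi> a z)\<^sup>2) = (\<Sum>z\<in>Z. \<Sum>a\<in>I. \<Sum>b\<in>I. c a * c b * (\<phi> a z * \<phi> b z))"
      by (simp add: power2_eq_square sum_product mult_ac)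
    also have "\<dots> = (\<Sum>a\<in>I. \<Sum>z\<in>Z. \<Sum>b\<in>I. c a * c b * (\<phi> a z * \<phi> b z))"
      by (rule sum.swap)
    also have "\<dots> = (\<Sum>a\<in>I. \<Sum>b\<in>I. \<Sum>z\<in>Z. c a * c b * (\<phi> a z * \<phi> b z))"
      by (intro sum.cong refl sum.swap)
    also have "\<dots> = (\<Sum>a\<in>I. \<Sum>b\<in>I. if b = a then (c a)\<^sup>2 * \<nu> a else 0)"
      by (intro sum.cong refl) (auto simp: sum_distrib_left[symmetric] orth power2_eq_square)
    also have "\<dots> = (\<Sum>a\<in>I. (c a)\<^sup>2 * \<nu> a)"
      using \<open>finite I\<close> by simp
    finally show ?thesis .
  qed
  finally show ?thesis .
qed

lemma Bessel_inequality_finite: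
  fixes \<phi> :: "'i \<Rightarrow> 'z \<Rightarrow> real"
  assumes I: "finite I"
    and orth: "\<And>a b. a \<in> I \<Longrightarrow> b \<in> I \<Longrightarrow> (\<Sum>z\<in>Z. \<phi> a z * \<phi> b z) = (if a = b then \<nu> a else 0)"
    and \<nu>: "\<And>a. a \<in> I \<Longrightarrow> \<nu> a \<le> K" and K: "0 < K"
  shows "(\<Sum>a\<in>I. (\<Sum>z\<in>Z. y z * \<phi> a z)\<^sup>2) \<le> K * (\<Sum>z\<in>Z. (y z)\<^sup>2)"
proof -
  define s where "s a = (\<Sum>z\<in>Z. y z * \<phi> a z)" for a
  \<comment> \<open>The coefficients are \<open>s a / K\<close> and not the Fourier coefficients
    \<open>s a / \<nu> a\<close>: the common bound \<open>K\<close> suffices, and no division by a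
    vanishing \<open>\<nu> a\<close> can occur.\<close>
  have "0 \<le> (\<Sum>z\<in>Z. (y z - (\<Sum>a\<in>I. (s a / K) * \<phi> a z))\<^sup>2)"
    by (intro sum_nonneg) auto
  also have "\<dots> = (\<Sum>z\<in>Z. (y z)\<^sup>2) - 2 * (\<Sum>a\<in>I. s a / K * s a) + (\<Sum>a\<in>I. (s a / K)\<^sup>2 * \<nu> a)"
    unfolding s_def by (rule sum_square_diff_orthogonal[OF I orth])
  also have "(\<Sum>a\<in>I. (s a / K)\<^sup>2 * \<nu> a) \<le> (\<Sum>a\<in>I. (s a / K)\<^sup>2 * K)"
    by (intro sum_mono mult_left_mono \<nu>) auto
  also have "(\<Sum>a\<in>I. (s a / K)\<^sup>2 * K) = (\<Sum>a\<in>I. (s a)\<^sup>2) / K"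
    using K by (simp add: sum_divide_distrib power2_eq_square)
  also have "(\<Sum>a\<in>I. s a / K * s a) = (\<Sum>a\<in>I. (s a)\<^sup>2) / K"
    by (simp add: sum_divide_distrib power2_eq_square)
  finally show ?thesis
    using K unfolding s_def[symmetric] by (simp add: field_simps)
qed

text \<open>Gram-Schmidt for the values on \<open>Z\<close>. Functions may become dependent when
  restricted to \<open>Z\<close>; a zero residual adds no vector, so \<open>r\<close> can be smaller
  than \<open>card B\<close>.\<close>

lemma ex_orthonormal_spanning:
  fixes g :: "'b \<Rightarrow> 'z \<Rightarrow> real"
  assumes Z: "finite Z" and B: "finite B"
  shows "\<exists>r\<le>card B. \<exists>q :: nat \<Rightarrow> 'z \<Rightarrow> real.
    (\<forall>k<r. \<forall>l<r. (\<Sum>z\<in>Z. q k z * q l z) = (if k = l then 1 else 0)) \<and>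
    (\<forall>b\<in>B. \<exists>c. \<forall>z\<in>Z. g b z = (\<Sum>l<r. c l * q l z))"
  using B
proof induction
  case empty
  then show ?case by auto
next
  case (insert b B)
  then obtain r q where r: "r \<le> card B"
    and q: "\<forall>k<r. \<forall>l<r. (\<Sum>z\<in>Z. q k z * q l z) = (if k = l then 1 else (0::real))"
    and g: "\<forall>b\<in>B. \<exists>c. \<forall>z\<in>Z. g b z = (\<Sum>l<r. c l * q l z)"
    by (elim exE conjE) (rule that)
  have orth: "\<And>k l. k < r \<Longrightarrow> l < r \<Longrightarrow> (\<Sum>z\<in>Z. q k z * q l z) = (if k = l then 1 else 0)"
    using q by blast
  have rep: "\<And>b. b \<in> B \<Longrightarrow> \<exists>c. \<forall>z\<in>Z. g b z = (\<Sum>l<r. c l * q l z)"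
    using g by blast
  define s where "s l = (\<Sum>z\<in>Z. g b z * q l z)" for l
  define p where "p z = g b z - (\<Sum>l<r. s l * q l z)" for z
  define n where "n = sqrt (\<Sum>z\<in>Z. (p z)\<^sup>2)"
  have pq: "(\<Sum>z\<in>Z. p z * q l z) = 0" if "l < r" for l
  proof -
    have "(\<Sum>z\<in>Z. p z * q l z) = s l - (\<Sum>z\<in>Z. \<Sum>k<r. s k * (q k z * q l z))"
      by (simp add: p_def s_def algebra_simps sum_subtractf sum_distrib_left)
    also have "(\<Sum>z\<in>Z. \<Sum>k<r. s k * (q k z * q l z)) = (\<Sum>k<r. \<Sum>z\<in>Z. s k * (q k z * q l z))"
      by (rule sum.swap)
    also have "\<dots> = (\<Sum>k<r. if k = l then s l else 0)"
      using that by (intro sum.cong refl) (auto simp: sum_distrib_left[symmetric] orth)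
    also have "\<dots> = s l" using that by simp
    finally show ?thesis by simp
  qed
  show ?case
  proof (cases "n = 0")
    case True
    then have "p z = 0" if "z \<in> Z" for z
      using Z that by (simp add: n_def sum_nonneg_eq_0_iff)
    then have "\<exists>c. \<forall>z\<in>Z. g b z = (\<Sum>l<r. c l * q l z)" by (auto simp: p_def)
    then show ?thesis using r orth rep insert.hyps
      by (intro exI[of _ r] conjI exI[of _ q]) auto
  next
    case False
    have n2: "(\<Sum>z\<in>Z. p z * p z) = n * n"
      by (simp add: n_def power2_eq_square sum_nonneg)
    define q' where "q' = q(r := \<lambda>z. p z / n)"
    have "(\<Sum>z\<in>Z. q' k z * q' l z) = (if k = l then 1 else 0)" if "k < Suc r" "l < Suc r" for k l
    proof -
      have pq': "(\<Sum>z\<in>Z. q l z * p z) = 0" if "l < r" for l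
        using pq[OF that] by (simp add: mult.commute)
      have "(\<Sum>z\<in>Z. p z / n * (p z / n)) = (\<Sum>z\<in>Z. p z * p z) / (n * n)"
        by (simp add: sum_divide_distrib)
      then have "(\<Sum>z\<in>Z. p z / n * (p z / n)) = 1" using False n2 by simp
      then show ?thesis
        using that orth pq pq'
        by (auto simp: q'_def less_Suc_eq sum_divide_distrib[symmetric])
    qed
    moreover have "\<exists>c. \<forall>z\<in>Z. g b' z = (\<Sum>l<Suc r. c l * q' l z)" if b': "b' \<in> insert b B" for b'
    proof (cases "b' = b")
      case True
      then show ?thesis using False
        by (intro exI[of _ "s(r := n)"]) (auto simp: q'_def p_def)
    next
      case F: False
      then obtain c where "\<forall>z\<in>Z. g b' z = (\<Sum>l<r. c l * q l z)" using rep b' by blast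
      then show ?thesis
        by (intro exI[of _ "c(r := 0)"]) (auto simp: q'_def)
    qed
    ultimately show ?thesis using r insert.hyps
      by (intro exI[of _ "Suc r"] conjI exI[of _ q']) auto
  qed
qed

text \<open>Coding a sign pattern by the set of its plus signs makes the patterns on a finite
  \<open>I\<close> the finite set \<open>Pow I\<close>, over which a maximum and a conjunction of
  almost-everywhere statements can be formed.\<close>

definition signs :: "'i set \<Rightarrow> 'i \<Rightarrow> real" where
  "signs A i = (if i \<in> A then 1 else - 1)"

lemma signs_power2: "(signs A i)\<^sup>2 = 1" and abs_signs: "\<bar>signs A i\<bar> = 1"
  by (simp_all add: signs_def)

text \<open>The average over all signs would give equality; a good choice is found greedily.\<close>

lemma ex_signs_sum_squares_le:
  fixes w :: "nat \<Rightarrow> 'i \<Rightarrow> real"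
  assumes "finite I"
  shows "\<exists>A\<subseteq>I. (\<Sum>l<r. (\<Sum>i\<in>I. signs A i * w l i)\<^sup>2) \<le> (\<Sum>l<r. \<Sum>i\<in>I. (w l i)\<^sup>2)"
  using assms
proof induction
  case empty
  then show ?case by simp
next
  case (insert i I)
  then obtain A where A: "A \<subseteq> I"
    and le: "(\<Sum>l<r. (\<Sum>i\<in>I. signs A i * w l i)\<^sup>2) \<le> (\<Sum>l<r. \<Sum>i\<in>I. (w l i)\<^sup>2)" by blast
  define s where "s l = (\<Sum>i\<in>I. signs A i * w l i)" for l
  define T where "T = (\<Sum>l<r. w l i * s l)"
  \<comment> \<open>The sign of the new element makes the cross term
    \<open>2 * (signs A' i * T)\<close> nonpositive.\<close>
  define A' where "A' = (if T \<le> 0 then insert i A else A)"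
  have same: "(\<Sum>k\<in>I. signs A' k * w l k) = s l" for l
    unfolding s_def using insert.hyps by (intro sum.cong) (auto simp: signs_def A'_def)
  have sgn: "signs A' i * T \<le> 0"
    using insert.hyps A by (auto simp: signs_def A'_def)
  have "(\<Sum>l<r. (\<Sum>k\<in>insert i I. signs A' k * w l k)\<^sup>2) = (\<Sum>l<r. (signs A' i * w l i + s l)\<^sup>2)"
    using insert.hyps by (simp add: same)
  also have "\<dots> = (\<Sum>l<r. (w l i)\<^sup>2) + 2 * (signs A' i * T) + (\<Sum>l<r. (s l)\<^sup>2)"
    by (simp add: T_def power2_sum power_mult_distrib signs_power2 sum.distrib sum_distrib_left mult_ac)
  also have "\<dots> \<le> (\<Sum>l<r. (w l i)\<^sup>2) + (\<Sum>l<r. \<Sum>i\<in>I. (w l i)\<^sup>2)"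
    using sgn le unfolding s_def by linarith
  also have "\<dots> = (\<Sum>l<r. \<Sum>k\<in>insert i I. (w l k)\<^sup>2)"
    using insert.hyps by (simp add: sum.distrib)
  finally show ?case using A by (intro exI[of _ A']) (auto simp: A'_def)
qed

text \<open>The squared norm of a signed orthogonal sum does not depend on the signs and is at least
  \<open>card I * L\<close>. For good signs the projection onto the span is no larger than for
  average signs, and Bessel bounds that average by \<open>K\<close> per dimension. The pattern
  depends on the span only, hence it works for all coefficients \<open>c\<close>.\<close>

lemma ex_signs_far_from_span:
  fixes \<phi> :: "'i \<Rightarrow> 'z \<Rightarrow> real" and g :: "'b \<Rightarrow> 'z \<Rightarrow> real"
  assumes I: "finite I" and Z: "finite Z" and B: "finite B" "card B \<le> M"
    and orth: "\<And>a b. a \<in> I \<Longrightarrow> b \<in> I \<Longrightarrow> (\<Sum>z\<in>Z. \<phi> a z * \<phi> b z) = (if a = b then \<nu> a else 0)"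
    and \<nu>: "\<And>a. a \<in> I \<Longrightarrow> \<nu> a \<le> K" "\<And>a. a \<in> I \<Longrightarrow> L \<le> \<nu> a" and K: "0 < K"
  shows "\<exists>A\<subseteq>I. \<forall>c. real (card I) * L - real M * K
    \<le> (\<Sum>z\<in>Z. ((\<Sum>a\<in>I. signs A a * \<phi> a z) - (\<Sum>b\<in>B. c b * g b z))\<^sup>2)"
proof -
  from ex_orthonormal_spanning[OF Z B(1), of g] obtain r q where r: "r \<le> card B"
    and q': "\<forall>k<r. \<forall>l<r. (\<Sum>z\<in>Z. q k z * q l z) = (if k = l then 1 else (0::real))"
    and rep: "\<forall>b\<in>B. \<exists>c. \<forall>z\<in>Z. g b z = (\<Sum>l<r. c l * q l z)"
    by (elim exE conjE) (rule that)
  have q: "\<And>k l. k < r \<Longrightarrow> l < r \<Longrightarrow> (\<Sum>z\<in>Z. q k z * q l z) = (if k = l then 1 else 0)"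
    using q' by blast
  from bchoice[OF rep] obtain e where e: "\<And>b z. b \<in> B \<Longrightarrow> z \<in> Z \<Longrightarrow> g b z = (\<Sum>l<r. e b l * q l z)"
    by blast
  define w where "w l a = (\<Sum>z\<in>Z. q l z * \<phi> a z)" for l a
  obtain A where A: "A \<subseteq> I" and le: "(\<Sum>l<r. (\<Sum>a\<in>I. signs A a * w l a)\<^sup>2) \<le> (\<Sum>l<r. \<Sum>a\<in>I. (w l a)\<^sup>2)"
    using ex_signs_sum_squares_le[OF I] by blast
  define F where "F z = (\<Sum>a\<in>I. signs A a * \<phi> a z)" for z
  have Fq: "(\<Sum>z\<in>Z. F z * q l z) = (\<Sum>a\<in>I. signs A a * w l a)" for l
  proof -
    have "(\<Sum>z\<in>Z. F z * q l z) = (\<Sum>z\<in>Z. \<Sum>a\<in>I. signs A a * (q l z * \<phi> a z))"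
      unfolding F_def sum_distrib_right by (simp only: mult_ac)
    also have "\<dots> = (\<Sum>a\<in>I. \<Sum>z\<in>Z. signs A a * (q l z * \<phi> a z))" by (rule sum.swap)
    finally show ?thesis by (simp add: w_def sum_distrib_left)
  qed
  have "(\<Sum>l<r. (\<Sum>z\<in>Z. F z * q l z)\<^sup>2) \<le> (\<Sum>l<r. \<Sum>a\<in>I. (w l a)\<^sup>2)"
    using le by (simp add: Fq)
  \<comment> \<open>Bessel takes each \<open>q l\<close> as the vector and the
    \<open>\<phi> a\<close> as the orthogonal family.\<close>
  also have "\<dots> \<le> (\<Sum>l<r. K * (\<Sum>z\<in>Z. (q l z)\<^sup>2))"
    unfolding w_def by (intro sum_mono Bessel_inequality_finite[OF I orth \<nu>(1) K])
  also have "\<dots> = real r * K" using q by (simp add: power2_eq_square)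
  also have "\<dots> \<le> real M * K" using r B K by (intro mult_right_mono) auto
  finally have proj: "(\<Sum>l<r. (\<Sum>z\<in>Z. F z * q l z)\<^sup>2) \<le> real M * K" .
  have "(\<Sum>z\<in>Z. (F z)\<^sup>2) = (\<Sum>a\<in>I. \<nu> a)"
    using sum_square_diff_orthogonal[OF I orth, where y = "\<lambda>_. 0" and c = "signs A"]
    by (simp add: F_def signs_power2)
  moreover have "real (card I) * L \<le> (\<Sum>a\<in>I. \<nu> a)"
    using \<nu>(2) sum_mono[of I "\<lambda>_. L" \<nu>] by simp
  ultimately have F: "real (card I) * L \<le> (\<Sum>z\<in>Z. (F z)\<^sup>2)" by simp
  have "real (card I) * L - real M * K \<le> (\<Sum>z\<in>Z. (F z - (\<Sum>b\<in>B. c b * g b z))\<^sup>2)" for c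
  proof -
    define d where "d l = (\<Sum>b\<in>B. c b * e b l)" for l
    define s where "s l = (\<Sum>z\<in>Z. F z * q l z)" for l
    have "(\<Sum>b\<in>B. c b * g b z) = (\<Sum>l<r. d l * q l z)" if "z \<in> Z" for z
    proof -
      have "(\<Sum>b\<in>B. c b * g b z) = (\<Sum>b\<in>B. \<Sum>l<r. c b * e b l * q l z)"
        using e that by (simp add: sum_distrib_left mult_ac)
      also have "\<dots> = (\<Sum>l<r. \<Sum>b\<in>B. c b * e b l * q l z)" by (rule sum.swap)
      finally show ?thesis by (simp add: d_def sum_distrib_right)
    qed
    then have "(\<Sum>z\<in>Z. (F z - (\<Sum>b\<in>B. c b * g b z))\<^sup>2) = (\<Sum>z\<in>Z. (F z - (\<Sum>l<r. d l * q l z))\<^sup>2)"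
      by (intro sum.cong) auto
    also have "\<dots> = (\<Sum>z\<in>Z. (F z)\<^sup>2) - 2 * (\<Sum>l<r. d l * s l) + (\<Sum>l<r. (d l)\<^sup>2 * 1)"
      unfolding s_def by (rule sum_square_diff_orthogonal) (use q in auto)
    \<comment> \<open>Completing the square: the best coefficients are the inner products
      \<open>s l\<close>, and any other choice only adds to the distance.\<close>
    also have "\<dots> = (\<Sum>z\<in>Z. (F z)\<^sup>2) - (\<Sum>l<r. (s l)\<^sup>2) + (\<Sum>l<r. (d l - s l)\<^sup>2)"
      by (simp add: power2_diff sum.distrib sum_subtractf sum_distrib_left mult_ac)
    finally show ?thesis
      using F proj sum_nonneg[of "{..<r}" "\<lambda>l. (d l - s l)\<^sup>2"] unfolding s_def by simp
  qed
  then show ?thesis using A unfolding F_def by blast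
qed

section \<open>A piecewise linear wavelet with two vanishing moments\<close>

definition hat :: "real \<Rightarrow> real" where
  "hat y = max 0 (1 - \<bar>y\<bar>)"

text \<open>A second difference of hats: the weights 1, -2, 1 at the equidistant centres 1/4, 1/2,
  3/4 make the mean and the first moment vanish. The nodes are multiples of 1/4.\<close>

definition wavelet :: "real \<Rightarrow> real" where
  "wavelet y = hat (4 * y - 1) - 2 * hat (4 * y - 2) + hat (4 * y - 3)"

lemma wavelet_support: "wavelet y \<noteq> 0 \<Longrightarrow> 0 < y \<and> y < 1"
  by (auto simp: wavelet_def hat_def max_def abs_if split: if_splits)

lemma abs_hat_diff_le: "\<bar>hat y - hat z\<bar> \<le> \<bar>y - z\<bar>"
  by (auto simp: hat_def)

lemma abs_wavelet_diff_le: "\<bar>wavelet y - wavelet z\<bar> \<le> 16 * \<bar>y - z\<bar>"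
proof -
  \<comment> \<open>Slope 4 for each hat, with total weight 1 + 2 + 1, gives the constant
    16.\<close>
  have "\<bar>hat (4 * y - c) - hat (4 * z - c)\<bar> \<le> 4 * \<bar>y - z\<bar>" for c
    using abs_hat_diff_le[of "4 * y - c" "4 * z - c"] by (simp add: abs_if split: if_splits)
  from this[of 1] this[of 2] this[of 3] show ?thesis
    unfolding wavelet_def by linarith
qed

lemma abs_wavelet_le: "\<bar>wavelet y\<bar> \<le> 2"
  by (auto simp: wavelet_def hat_def max_def abs_if)

lemma continuous_on_wavelet [continuous_intros]:
  "continuous_on S g \<Longrightarrow> continuous_on S (\<lambda>x. wavelet (g x))"
  unfolding wavelet_def hat_def by (intro continuous_intros)

text \<open>The four values at one relative position \<open>\<rho>\<close> sum to 0, and so do they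
  with weights 0, 1, 2, 3, whatever \<open>\<rho>\<close> is. These are the two vanishing moments in
  discrete form, valid on a grid with any shift.\<close>

lemma wavelet_quarters:
  assumes "0 \<le> \<rho>" "\<rho> \<le> 1"
  shows "wavelet (\<rho> / 4) = \<rho>" "wavelet ((1 + \<rho>) / 4) = 1 - 3 * \<rho>"
    "wavelet ((2 + \<rho>) / 4) = - 2 + 3 * \<rho>" "wavelet ((3 + \<rho>) / 4) = 1 - \<rho>"
  using assms by (auto simp: wavelet_def hat_def max_def abs_if add_divide_distrib)

lemma hat_affine: "\<exists>A B. \<forall>y. of_int c \<le> y \<and> y \<le> of_int c + 1 \<longrightarrow> hat y = A + B * y"
proof -
  consider "c = -1" | "c = 0" | "c \<ge> 1" | "c \<le> -2" by linarith
  then show ?thesis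
  proof cases
    case 1
    then show ?thesis by (intro exI[of _ 1]) (auto simp: hat_def)
  next
    case 2
    then show ?thesis by (intro exI[of _ 1] exI[of _ "-1"]) (auto simp: hat_def)
  next
    case 3
    then have "1 \<le> real_of_int c" by simp
    then show ?thesis by (intro exI[of _ 0]) (auto simp: hat_def)
  next
    case 4
    then have "real_of_int c \<le> -2" by simp
    then show ?thesis by (intro exI[of _ 0]) (auto simp: hat_def)
  qed
qed

lemma wavelet_affine:
  "\<exists>A B. \<forall>y. of_int c \<le> 4 * y \<and> 4 * y \<le> of_int c + 1 \<longrightarrow> wavelet y = A + B * y"
proof -
  obtain A1 B1 where 1: "\<And>y. of_int (c - 1) \<le> y \<and> y \<le> of_int (c - 1) + 1 \<Longrightarrow> hat y = A1 + B1 * y"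
    using hat_affine by metis
  obtain A2 B2 where 2: "\<And>y. of_int (c - 2) \<le> y \<and> y \<le> of_int (c - 2) + 1 \<Longrightarrow> hat y = A2 + B2 * y"
    using hat_affine by metis
  obtain A3 B3 where 3: "\<And>y. of_int (c - 3) \<le> y \<and> y \<le> of_int (c - 3) + 1 \<Longrightarrow> hat y = A3 + B3 * y"
    using hat_affine by metis
  have "wavelet y = (A1 - B1 - 2 * (A2 - 2 * B2) + A3 - 3 * B3) + (4 * B1 - 8 * B2 + 4 * B3) * y"
    if "of_int c \<le> 4 * y \<and> 4 * y \<le> of_int c + 1" for y
    using 1[of "4 * y - 1"] 2[of "4 * y - 2"] 3[of "4 * y - 3"] that
    by (simp add: wavelet_def algebra_simps)
  then show ?thesis by blast
qed

text \<open>Pairs are (level, position). Dilation by powers of 4 matches the nodes at quarters: the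
  nodes of one level are interval ends at every finer level, which dilation by 2 would not give for
  neighbouring levels.\<close>

definition atom :: "nat \<times> nat \<Rightarrow> real \<Rightarrow> real" where
  "atom a x = wavelet (4 ^ fst a * x - real (snd a))"

text \<open>The support of an atom holds four runs of \<open>q\<close> consecutive grid points, one
  run per quarter; points that are \<open>q\<close> apart have the same relative position in their
  quarters.\<close>

lemma sum_quarter_blocks:
  fixes H :: "nat \<Rightarrow> 'a::comm_monoid_add"
  assumes q: "q > 0" and k: "4 * q * (k + 1) \<le> n"
    and H: "\<And>i. H i \<noteq> 0 \<Longrightarrow> 4 * q * k \<le> i \<and> i < 4 * q * (k + 1)"
  shows "(\<Sum>i<n. H i) = (\<Sum>r<q. H (4 * q * k + r) + H (4 * q * k + q + r)
    + H (4 * q * k + 2 * q + r) + H (4 * q * k + 3 * q + r))"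
proof -
  have "(\<Sum>i<n. H i) = (\<Sum>i\<in>{4 * q * k..<4 * q * (k + 1)}. H i)"
  proof (rule sum.mono_neutral_right)
    show "\<forall>i\<in>{..<n} - {4 * q * k..<4 * q * (k + 1)}. H i = 0"
      using H by (metis DiffE atLeastLessThan_iff)
  qed (use k in auto)
  also have "\<dots> = (\<Sum>(r, c)\<in>{..<q} \<times> {..<4}. H (4 * q * k + c * q + r))"
  proof (rule sum.reindex_bij_witness[where
        i = "\<lambda>(r, c). 4 * q * k + c * q + r" and j = "\<lambda>i. ((i - 4 * q * k) mod q, (i - 4 * q * k) div q)"])
    fix i assume i: "i \<in> {4 * q * k..<4 * q * (k + 1)}"
    then have "i - 4 * q * k < 4 * q" by auto
    then have "(i - 4 * q * k) div q < 4" using q by (simp add: less_mult_imp_div_less)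
    then show "((i - 4 * q * k) mod q, (i - 4 * q * k) div q) \<in> {..<q} \<times> {..<4}" using q by auto
  next
    fix b :: "nat \<times> nat" assume b: "b \<in> {..<q} \<times> {..<4}"
    obtain r c where rc: "b = (r, c)" "r < q" "c < 4" using b by auto
    have "c * q \<le> 3 * q" using rc by (intro mult_right_mono) auto
    then have "c * q + r < 4 * q" using rc by linarith
    then show "(case b of (r, c) \<Rightarrow> 4 * q * k + c * q + r) \<in> {4 * q * k..<4 * q * (k + 1)}"
      using rc by (auto simp: algebra_simps)
    show "(((case b of (r, c) \<Rightarrow> 4 * q * k + c * q + r) - 4 * q * k) mod q,
        ((case b of (r, c) \<Rightarrow> 4 * q * k + c * q + r) - 4 * q * k) div q) = b"
      using rc by simp
  qed auto
  also have "\<dots> = (\<Sum>r<q. \<Sum>c<4. H (4 * q * k + c * q + r))"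
    by (rule sum.cartesian_product[symmetric])
  finally show ?thesis by (simp add: eval_nat_numeral add_ac)
qed

text \<open>The mesh resolves the nodes of all levels up to \<open>m\<close>, and the shift is
  strictly less than one mesh, so no grid point is a node of such an atom.\<close>

locale shifted_grid =
  fixes m :: nat and \<theta> :: real
  assumes \<theta>: "0 < \<theta>" "4 ^ (m + 1) * \<theta> < 1"
begin

definition gridpt :: "nat \<Rightarrow> real" where
  "gridpt n = real n / 4 ^ (m + 1) + \<theta>"

lemma sum_atom_times:
  fixes F :: "nat \<Rightarrow> real" and k :: nat
  assumes t: "t \<le> m" and k: "k < 4 ^ t" and q: "q = 4 ^ (m - t)"
    and \<rho>: "\<rho> = (\<lambda>r. (real r + 4 ^ (m + 1) * \<theta>) / real q)"
  shows "(\<Sum>n<4 ^ (m + 1). atom (t, k) (gridpt n) * F n) =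
    (\<Sum>r<q. \<rho> r * F (4 * q * k + r) + (1 - 3 * \<rho> r) * F (4 * q * k + q + r)
      + (- 2 + 3 * \<rho> r) * F (4 * q * k + 2 * q + r) + (1 - \<rho> r) * F (4 * q * k + 3 * q + r))"
    and "\<And>r. r < q \<Longrightarrow> 0 < \<rho> r \<and> \<rho> r < 1"
    and "\<And>n. 4 ^ t * gridpt n = (real n + 4 ^ (m + 1) * \<theta>) / (4 * real q)"
proof -
  have q0: "q > 0" using q by simp
  have P: "(4::real) ^ (m + 1) = 4 * real q * 4 ^ t"
    using t by (simp add: q flip: power_add)
  show pt: "4 ^ t * gridpt n = (real n + 4 ^ (m + 1) * \<theta>) / (4 * real q)" for n
    using q0 unfolding gridpt_def P by (simp add: field_simps)
  show \<rho>01: "0 < \<rho> r \<and> \<rho> r < 1" if "r < q" for r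
  proof -
    have "real r + 1 \<le> real q" using that by linarith
    then show ?thesis using \<theta> q0 by (simp add: \<rho> add_nonneg_pos del: power_Suc)
  qed
  have val: "atom (t, k) (gridpt (4 * q * k + c * q + r)) = wavelet ((real c + \<rho> r) / 4)" for c r
    using q0 by (simp add: atom_def pt \<rho> field_simps del: power_Suc)
  have supp: "4 * q * k \<le> n \<and> n < 4 * q * (k + 1)" if "atom (t, k) (gridpt n) * F n \<noteq> 0" for n
  proof -
    have "0 < 4 ^ t * gridpt n - real k \<and> 4 ^ t * gridpt n - real k < 1"
      using that by (intro wavelet_support) (auto simp: atom_def)
    then have "4 * real q * real k < real n + 4 ^ (m + 1) * \<theta>"
      "real n + 4 ^ (m + 1) * \<theta> < 4 * real q * (real k + 1)"
      unfolding pt using q0 by (auto simp: field_simps)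
    \<comment> \<open>Since the shift is a proper fraction of the mesh, the open support becomes the
      half-open range of indices.\<close>
    moreover have "0 < 4 ^ (m + 1) * \<theta>" using \<theta> by (intro mult_pos_pos) auto
    ultimately have "4 * real q * real k < real n + 1" "real n < 4 * real q * (real k + 1)"
      using \<theta> by linarith+
    then have "real (4 * q * k) < real n + 1" "real n < real (4 * q * (k + 1))"
      by (simp_all add: algebra_simps)
    then show ?thesis by linarith
  qed
  have "4 * q * (k + 1) \<le> 4 * q * 4 ^ t" using k by (intro mult_left_mono) auto
  also have "\<dots> = 4 ^ (m + 1)" using t by (simp add: q flip: power_add)
  finally have kle: "4 * q * (k + 1) \<le> 4 ^ (m + 1)" .
  have v0: "atom (t, k) (gridpt (4 * q * k + r)) = \<rho> r"
    and v1: "atom (t, k) (gridpt (4 * q * k + q + r)) = 1 - 3 * \<rho> r"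
    and v2: "atom (t, k) (gridpt (4 * q * k + 2 * q + r)) = - 2 + 3 * \<rho> r"
    and v3: "atom (t, k) (gridpt (4 * q * k + 3 * q + r)) = 1 - \<rho> r" if "r < q" for r
    using val[of 0 r] val[of 1 r] val[of 2 r] val[of 3 r] wavelet_quarters[of "\<rho> r"] \<rho>01[OF that]
    by simp_all
  show "(\<Sum>n<4 ^ (m + 1). atom (t, k) (gridpt n) * F n) =
    (\<Sum>r<q. \<rho> r * F (4 * q * k + r) + (1 - 3 * \<rho> r) * F (4 * q * k + q + r)
      + (- 2 + 3 * \<rho> r) * F (4 * q * k + 2 * q + r) + (1 - \<rho> r) * F (4 * q * k + 3 * q + r))"
    by (rule trans[OF sum_quarter_blocks[OF q0 kle supp]])
       (auto intro!: sum.cong simp: v0 v1 v2 v3)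
qed

text \<open>An atom of lower frequency is affine on the support of one of higher frequency.\<close>

lemma sum_atom_atom_eq_0:
  assumes t: "t \<le> m" and k: "k < 4 ^ t" and t': "t' < t"
  shows "(\<Sum>n<4 ^ (m + 1). atom (t, k) (gridpt n) * atom (t', k') (gridpt n)) = 0"
proof -
  define q where "q = (4::nat) ^ (m - t)"
  define \<rho> where "\<rho> = (\<lambda>r. (real r + 4 ^ (m + 1) * \<theta>) / real q)"
  note S = sum_atom_times[OF t k q_def \<rho>_def]
  have q0: "q > 0" by (simp add: q_def)
  obtain s where s: "t = Suc (t' + s)" using t' less_iff_Suc_add by auto
  \<comment> \<open>The number of the quarter of the coarse atom that contains the whole support of
    the fine one. It may fall outside 0, ..., 3, hence the integers.\<close>
  define c where "c = int (k div 4 ^ s) - 4 * int k'"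
  obtain A B where AB: "\<And>y. of_int c \<le> 4 * y \<and> 4 * y \<le> of_int c + 1 \<Longrightarrow> wavelet y = A + B * y"
    using wavelet_affine by metis
  have aff: "atom (t', k') x = A - B * real k' + B * 4 ^ t' * x"
    if x: "real k \<le> 4 ^ t * x" "4 ^ t * x \<le> real k + 1" for x
  proof -
    have "real (k div 4 ^ s * 4 ^ s) \<le> real k" by (rule of_nat_mono) (rule div_times_less_eq_dividend)
    then have lo: "real (k div 4 ^ s) * 4 ^ s \<le> real k" by simp
    have "k + 1 \<le> (k div 4 ^ s + 1) * 4 ^ s"
      using dividend_less_div_times[of "4 ^ s" k] by (simp add: algebra_simps)
    then have "real (k + 1) \<le> real ((k div 4 ^ s + 1) * 4 ^ s)" by (rule of_nat_mono)
    then have hi: "real k + 1 \<le> (real (k div 4 ^ s) + 1) * 4 ^ s" by (simp add: algebra_simps)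
    have "4 ^ t * x = (4 * 4 ^ t' * x) * 4 ^ s" by (simp add: s power_add)
    then have "real (k div 4 ^ s) * 4 ^ s \<le> (4 * 4 ^ t' * x) * 4 ^ s"
      "(4 * 4 ^ t' * x) * 4 ^ s \<le> (real (k div 4 ^ s) + 1) * 4 ^ s"
      using lo hi x by linarith+
    then have "real (k div 4 ^ s) \<le> 4 * 4 ^ t' * x" "4 * 4 ^ t' * x \<le> real (k div 4 ^ s) + 1"
      by simp_all
    then have "wavelet (4 ^ t' * x - real k') = A + B * (4 ^ t' * x - real k')"
      by (intro AB) (simp add: c_def)
    then show ?thesis by (simp add: atom_def algebra_simps)
  qed
  have val: "atom (t', k') (gridpt (4 * q * k + l * q + r))
      = A - B * real k' + B * 4 ^ t' * (real (4 * q * k + l * q + r) / 4 ^ (m + 1) + \<theta>)"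
    if "l < 4" "r < q" for l r
    unfolding gridpt_def[symmetric]
  proof (rule aff)
    have e: "4 ^ t * gridpt (4 * q * k + l * q + r) = real k + (real l + \<rho> r) / 4"
      unfolding S(3) \<rho>_def using q0 by (simp add: field_simps)
    have "real l \<le> 3" using that by simp
    then show "real k \<le> 4 ^ t * gridpt (4 * q * k + l * q + r)" "4 ^ t * gridpt (4 * q * k + l * q + r) \<le> real k + 1"
      unfolding e using S(2)[OF that(2)] by auto
  qed
  show ?thesis
    unfolding S(1)
  proof (rule sum.neutral, rule ballI)
    fix r assume "r \<in> {..<q}"
    then have r: "r < q" by simp
    \<comment> \<open>At four points \<open>q\<close> apart the affine function takes the values
      \<open>X + l * Y\<close> for \<open>l\<close> from 0 to 3, and the two discrete moments
      annihilate these.\<close>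
    define X where "X = A - B * real k' + B * 4 ^ t' * (real (4 * q * k + r) / 4 ^ (m + 1) + \<theta>)"
    define Y where "Y = B * 4 ^ t' * (real q / 4 ^ (m + 1))"
    have v: "atom (t', k') (gridpt (4 * q * k + l * q + r)) = X + real l * Y" if "l < 4" for l
      unfolding val[OF that r] X_def Y_def by (simp add: add_divide_distrib algebra_simps)
    show "\<rho> r * atom (t', k') (gridpt (4 * q * k + r)) +
      (1 - 3 * \<rho> r) * atom (t', k') (gridpt (4 * q * k + q + r)) +
      (- 2 + 3 * \<rho> r) * atom (t', k') (gridpt (4 * q * k + 2 * q + r)) +
      (1 - \<rho> r) * atom (t', k') (gridpt (4 * q * k + 3 * q + r)) = 0"
      using v[of 0] v[of 1] v[of 2] v[of 3] by (simp add: algebra_simps)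
  qed
qed

lemma sum_atom_orthogonal:
  assumes a: "fst a \<le> m" "snd a < 4 ^ fst a" and b: "fst b \<le> m" "snd b < 4 ^ fst b" and ab: "a \<noteq> b"
  shows "(\<Sum>n<4 ^ (m + 1). atom a (gridpt n) * atom b (gridpt n)) = 0"
proof -
  consider "fst a < fst b" | "fst b < fst a" | "fst a = fst b" "snd a \<noteq> snd b"
    using ab by (meson linorder_neqE_nat prod_eqI)
  then show ?thesis
  proof cases
    case 1
    then show ?thesis using sum_atom_atom_eq_0[OF b, of "fst a" "snd a"] by (simp add: mult.commute)
  next
    case 2
    then show ?thesis using sum_atom_atom_eq_0[OF a, of "fst b" "snd b"] by simp
  next
    case 3
    \<comment> \<open>Different atoms of one level have disjoint supports, so even the pointwise
      product vanishes.\<close>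
    have "atom a x * atom b x = 0" for x
    proof (rule ccontr)
      assume "atom a x * atom b x \<noteq> 0"
      then have "0 < 4 ^ fst a * x - real (snd a) \<and> 4 ^ fst a * x - real (snd a) < 1"
        "0 < 4 ^ fst b * x - real (snd b) \<and> 4 ^ fst b * x - real (snd b) < 1"
        using wavelet_support[of "4 ^ fst a * x - real (snd a)"]
          wavelet_support[of "4 ^ fst b * x - real (snd b)"] by (auto simp: atom_def)
      then show False using 3 by auto
    qed
    then show ?thesis by (simp only: sum.neutral_const)
  qed
qed

lemma sum_atom_square:
  assumes a: "fst a \<le> m" "snd a < 4 ^ fst a"
  shows "4 ^ (m - fst a) / 2 \<le> (\<Sum>n<4 ^ (m + 1). atom a (gridpt n) * atom a (gridpt n))" (is "_ \<le> ?s")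
    and "(\<Sum>n<4 ^ (m + 1). atom a (gridpt n) * atom a (gridpt n)) \<le> 16 * 4 ^ (m - fst a)"
proof -
  obtain t k where tk: "a = (t, k)" "t \<le> m" "k < 4 ^ t" using a by (cases a) auto
  define q where "q = (4::nat) ^ (m - t)"
  define \<rho> where "\<rho> = (\<lambda>r. (real r + 4 ^ (m + 1) * \<theta>) / real q)"
  note S = sum_atom_times[OF tk(2,3) q_def \<rho>_def]
  have q0: "q > 0" by (simp add: q_def)
  have val: "atom a (gridpt (4 * q * k + c * q + r)) = wavelet ((real c + \<rho> r) / 4)" for c r
    using q0 by (simp add: atom_def tk S(3) \<rho>_def field_simps del: power_Suc)
  define g where "g \<rho> = \<rho>\<^sup>2 + (1 - 3 * \<rho>)\<^sup>2 + (- 2 + 3 * \<rho>)\<^sup>2 + (1 - \<rho>)\<^sup>2" for \<rho> :: real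
  have eq: "?s = (\<Sum>r<q. g (\<rho> r))"
    unfolding tk(1) S(1)
  proof (intro sum.cong refl)
    fix r assume "r \<in> {..<q}"
    then have "0 < \<rho> r" "\<rho> r < 1" using S(2) by auto
    then show "\<rho> r * atom (t, k) (gridpt (4 * q * k + r)) +
      (1 - 3 * \<rho> r) * atom (t, k) (gridpt (4 * q * k + q + r)) +
      (- 2 + 3 * \<rho> r) * atom (t, k) (gridpt (4 * q * k + 2 * q + r)) +
      (1 - \<rho> r) * atom (t, k) (gridpt (4 * q * k + 3 * q + r)) = g (\<rho> r)"
      using val[of 0 r] val[of 1 r] val[of 2 r] val[of 3 r] wavelet_quarters[of "\<rho> r"]
      by (simp add: tk g_def power2_eq_square)
  qed
  \<comment> \<open>The outer quarters alone contribute at least 1/2, and each of the four squares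
    is at most 4; the exact value varies with the shift.\<close>
  have "1 / 2 \<le> g (\<rho> r) \<and> g (\<rho> r) \<le> 16" if "r < q" for r
  proof
    have r01: "0 < \<rho> r" "\<rho> r < 1" using S(2)[OF that] by auto
    have "0 \<le> (2 * \<rho> r - 1)\<^sup>2" by simp
    then have "1 / 2 \<le> (\<rho> r)\<^sup>2 + (1 - \<rho> r)\<^sup>2" by (simp add: power2_eq_square algebra_simps)
    moreover have "0 \<le> (1 - 3 * \<rho> r)\<^sup>2" "0 \<le> (- 2 + 3 * \<rho> r)\<^sup>2" by simp_all
    ultimately show "1 / 2 \<le> g (\<rho> r)" unfolding g_def by linarith
    have sq: "y\<^sup>2 \<le> 2\<^sup>2" if "\<bar>y\<bar> \<le> 2" for y :: real
      using power_mono[OF that, of 2] by simp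
    have "(\<rho> r)\<^sup>2 \<le> 2\<^sup>2" "(1 - 3 * \<rho> r)\<^sup>2 \<le> 2\<^sup>2" "(- 2 + 3 * \<rho> r)\<^sup>2 \<le> 2\<^sup>2" "(1 - \<rho> r)\<^sup>2 \<le> 2\<^sup>2"
      using r01 by (intro sq; linarith)+
    then show "g (\<rho> r) \<le> 16" unfolding g_def by simp
  qed
  then have "(\<Sum>r<q. 1 / 2) \<le> ?s" "?s \<le> (\<Sum>r<q. 16)"
    unfolding eq by (intro sum_mono; simp)+
  then show "4 ^ (m - fst a) / 2 \<le> ?s" "?s \<le> 16 * 4 ^ (m - fst a)"
    by (simp_all add: q_def tk)
qed

end

section \<open>Hoelder norms of atomic sums\<close>

lemma mixed_difference_prod:
  fixes x :: "real ^ 'd::finite"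
  shows "mixed_difference h u (\<lambda>x. \<Prod>i\<in>UNIV. g i (x $ i)) x
    = (\<Prod>i\<in>UNIV. if i \<in> u then g i (x $ i + h $ i) - g i (x $ i) else g i (x $ i))"
proof -
  have "finite u" by simp
  then show ?thesis
  proof (induction u arbitrary: x)
    case empty
    then show ?case by simp
  next
    case (insert l u)
    let ?D = "\<lambda>i. if i \<in> u then g i (x $ i + h $ i) - g i (x $ i) else g i (x $ i)"
    have split: "(\<Prod>i\<in>UNIV. F i) = F l * (\<Prod>i\<in>UNIV - {l}. F i)" for F :: "'d \<Rightarrow> real"
      by (rule prod.remove) auto
    have "mixed_difference h u (\<lambda>x. \<Prod>i\<in>UNIV. g i (x $ i)) (x + (h $ l) *\<^sub>R axis l 1)
        = g l (x $ l + h $ l) * (\<Prod>i\<in>UNIV - {l}. ?D i)"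
      unfolding insert.IH unfolding split using insert.hyps
      by (intro arg_cong2[where f = "(*)"] prod.cong refl) (auto simp: axis_def)
    moreover have "mixed_difference h u (\<lambda>x. \<Prod>i\<in>UNIV. g i (x $ i)) x = g l (x $ l) * (\<Prod>i\<in>UNIV - {l}. ?D i)"
      unfolding insert.IH unfolding split using insert.hyps by simp
    moreover have "(\<Prod>i\<in>UNIV. if i \<in> insert l u then g i (x $ i + h $ i) - g i (x $ i) else g i (x $ i))
        = (g l (x $ l + h $ l) - g l (x $ l)) * (\<Prod>i\<in>UNIV - {l}. ?D i)"
      unfolding split by (auto intro!: prod.cong)
    ultimately show ?case
      using insert.hyps by (simp add: difference_def left_diff_distrib)
  qed
qed

lemma mixed_difference_sum:
  "mixed_difference h u (\<lambda>x. \<Sum>a\<in>I. c a * F a x) x = (\<Sum>a\<in>I. c a * mixed_difference h u (F a) x)"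
proof -
  have "finite u" by simp
  then show ?thesis
    by (induction u arbitrary: x)
       (simp_all add: difference_def sum_subtractf[symmetric] right_diff_distrib)
qed

section \<open>Geometric sums over the scales of one variable\<close>

lemma sum_geometric_below_1:
  fixes r a :: real
  assumes r: "1 < r" and a: "0 < a"
  shows "(\<Sum>t | t < n \<and> r ^ t * a \<le> 1. r ^ t * a) \<le> r / (r - 1)"
proof (induction n)
  case 0
  then show ?case using r by simp
next
  case (Suc n)
  show ?case
  proof (cases "r ^ n * a \<le> 1")
    case False
    then have "{t. t < Suc n \<and> r ^ t * a \<le> 1} = {t. t < n \<and> r ^ t * a \<le> 1}"
      by (auto simp: less_Suc_eq)
    then show ?thesis using Suc by simp
  next
    case True
    have "(\<Sum>t | t < Suc n \<and> r ^ t * a \<le> 1. r ^ t * a) \<le> (\<Sum>t<Suc n. r ^ t * a)"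
      using r a by (intro sum_mono2) auto
    also have "\<dots> = (\<Sum>t<Suc n. r ^ t) * a" by (simp only: sum_distrib_right)
    also have "(\<Sum>t<Suc n. r ^ t) = (r ^ Suc n - 1) / (r - 1)"
      using r by (intro geometric_sum) auto
    also have "(r ^ Suc n - 1) / (r - 1) * a \<le> (r ^ Suc n / (r - 1)) * a"
      using r a by (intro mult_right_mono divide_right_mono) auto
    also have "\<dots> = r / (r - 1) * (r ^ n * a)" by simp
    also have "\<dots> \<le> r / (r - 1) * 1" using True r by (intro mult_left_mono) auto
    finally show ?thesis by simp
  qed
qed

lemma sum_geometric_above_1:
  fixes r a :: real
  assumes r: "1 < r" and a: "0 < a"
  shows "(\<Sum>t | t < n \<and> 1 \<le> r ^ t * a. 1 / (r ^ t * a)) \<le> r / (r - 1)"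
  using a
proof (induction n arbitrary: a)
  case 0
  then show ?case using r by simp
next
  case (Suc n)
  show ?case
  proof (cases "1 \<le> a")
    case True
    have "(\<Sum>t | t < Suc n \<and> 1 \<le> r ^ t * a. 1 / (r ^ t * a)) \<le> (\<Sum>t<Suc n. 1 / (r ^ t * a))"
      using r Suc.prems by (intro sum_mono2) auto
    also have "\<dots> \<le> (\<Sum>t<Suc n. (1 / r) ^ t)"
    proof (rule sum_mono)
      fix t
      have "r ^ t * 1 \<le> r ^ t * a" using True r by (intro mult_left_mono) auto
      then show "1 / (r ^ t * a) \<le> (1 / r) ^ t"
        using r Suc.prems by (simp add: power_one_over frac_le)
    qed
    also have "\<dots> \<le> (\<Sum>t. (1 / r) ^ t)"
      using r by (intro sum_le_suminf summable_geometric) auto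
    also have "\<dots> = r / (r - 1)" using r by (subst suminf_geometric) (auto simp: field_simps)
    finally show ?thesis .
  next
    case False
    have "(\<Sum>t | t < Suc n \<and> 1 \<le> r ^ t * a. 1 / (r ^ t * a))
        = (\<Sum>t | t < n \<and> 1 \<le> r ^ t * (r * a). 1 / (r ^ t * (r * a)))"
    proof (rule sum.reindex_bij_witness[where i = Suc and j = "\<lambda>t. t - 1"])
      fix t assume t: "t \<in> {t. t < Suc n \<and> 1 \<le> r ^ t * a}"
      then have "t \<noteq> 0" using False by (intro notI) simp
      then obtain s where s: "t = Suc s" by (cases t) auto
      show "Suc (t - 1) = t" "t - 1 \<in> {t. t < n \<and> 1 \<le> r ^ t * (r * a)}"
        "1 / (r ^ (t - 1) * (r * a)) = 1 / (r ^ t * a)"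
        using t by (auto simp: s mult_ac)
    qed (auto simp: mult_ac)
    also have "\<dots> \<le> r / (r - 1)" using r Suc.prems by (intro Suc.IH) simp
    finally show ?thesis .
  qed
qed

text \<open>The first summand is the geometric series of the scales longer than a given increment,
  with ratio \<open>4 powr (1 - \<alpha>)\<close>; the second that of the shorter ones, with ratio
  \<open>4 powr \<alpha>\<close>.\<close>

definition level_const :: "real \<Rightarrow> real" where
  "level_const \<alpha> = 4 powr (1 - \<alpha>) / (4 powr (1 - \<alpha>) - 1) + 4 powr \<alpha> / (4 powr \<alpha> - 1)"

lemma level_const_ge:
  assumes "0 < \<alpha>" "\<alpha> < 1"
  shows "4 powr \<alpha> / (4 powr \<alpha> - 1) \<le> level_const \<alpha>" "1 \<le> level_const \<alpha>"
proof -
  have 1: "1 < 4 powr (1 - \<alpha>)" "1 < 4 powr \<alpha>" using assms by auto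
  then show "4 powr \<alpha> / (4 powr \<alpha> - 1) \<le> level_const \<alpha>" by (simp add: level_const_def)
  moreover have "1 \<le> 4 powr \<alpha> / (4 powr \<alpha> - 1)" using 1 by (simp add: field_simps)
  ultimately show "1 \<le> level_const \<alpha>" by linarith
qed

text \<open>Relative to \<open>h powr \<alpha>\<close>, the summand is
  \<open>(4 ^ t * h) powr (1 - \<alpha>)\<close> while \<open>4 ^ t * h \<le> 1\<close>, and
  \<open>(4 ^ t * h) powr - \<alpha>\<close> afterwards. The sum is thus concentrated around
  \<open>4 ^ t * h = 1\<close>; convergence on the two sides needs \<alpha> < 1 and \<alpha> >
  0.\<close>

lemma sum_min_le:
  fixes h \<alpha> :: real
  assumes \<alpha>: "0 < \<alpha>" "\<alpha> < 1" and h: "0 < h"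
  shows "(\<Sum>t<n. 4 powr (- \<alpha> * real t) * min 1 (4 ^ t * h)) \<le> level_const \<alpha> * h powr \<alpha>"
proof -
  let ?r = "4 powr (1 - \<alpha>)" let ?a = "h powr (1 - \<alpha>)"
  let ?s = "4 powr \<alpha>" let ?b = "h powr \<alpha>"
  have r: "1 < ?r" "1 < ?s" using \<alpha> by auto
  have rt: "?r ^ t * ?a = (4 ^ t * h) powr (1 - \<alpha>)" and st: "?s ^ t * ?b = (4 ^ t * h) powr \<alpha>" for t
    using h by (simp_all add: powr_mult powr_power powr_realpow[symmetric] powr_powr mult.commute)
  have c4: "4 powr (- \<alpha> * real t) = ?b / (4 ^ t * h) powr \<alpha>" for t
    using h by (simp add: powr_mult powr_realpow[symmetric] powr_powr powr_minus field_simps)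
  have "(\<Sum>t<n. 4 powr (- \<alpha> * real t) * min 1 (4 ^ t * h))
      \<le> (\<Sum>t<n. ?b * (if ?r ^ t * ?a \<le> 1 then ?r ^ t * ?a else 0) + ?b * (if 1 \<le> ?s ^ t * ?b then 1 / (?s ^ t * ?b) else 0))"
  proof (rule sum_mono)
    fix t
    let ?y = "4 ^ t * h"
    have y: "0 < ?y" using h by simp
    show "4 powr (- \<alpha> * real t) * min 1 ?y
      \<le> ?b * (if ?r ^ t * ?a \<le> 1 then ?r ^ t * ?a else 0) + ?b * (if 1 \<le> ?s ^ t * ?b then 1 / (?s ^ t * ?b) else 0)"
    proof (cases "?y \<le> 1")
      case True
      have "?y powr (1 - \<alpha>) \<le> 1" using True y \<alpha> by (intro powr_le1) auto
      moreover have "?y / ?y powr \<alpha> = ?y powr (1 - \<alpha>)" using y by (simp add: powr_diff)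
      moreover have "min 1 ?y = ?y" using True by simp
      then have "4 powr (- \<alpha> * real t) * min 1 ?y = ?b * (?y / ?y powr \<alpha>)"
        by (simp only: c4 times_divide_eq_left times_divide_eq_right)
      ultimately show ?thesis unfolding rt st by (auto simp: powr_nonneg_iff)
    next
      case False
      then have "1 \<le> ?y powr \<alpha>" using \<alpha> by (intro ge_one_powr_ge_zero) auto
      then show ?thesis using False unfolding rt st c4 by (auto simp: min_def)
    qed
  qed
  also have "\<dots> = ?b * (\<Sum>t | t < n \<and> ?r ^ t * ?a \<le> 1. ?r ^ t * ?a)
      + ?b * (\<Sum>t | t < n \<and> 1 \<le> ?s ^ t * ?b. 1 / (?s ^ t * ?b))"
    by (simp add: sum.distrib sum_distrib_left[symmetric] sum.inter_filter[symmetric] lessThan_def Collect_conj_eq)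
  also have "\<dots> \<le> ?b * (?r / (?r - 1)) + ?b * (?s / (?s - 1))"
    using r h by (intro add_mono mult_left_mono sum_geometric_below_1 sum_geometric_above_1) auto
  also have "\<dots> = level_const \<alpha> * ?b" by (simp add: level_const_def algebra_simps)
  finally show ?thesis .
qed

lemma sum_geometric_le:
  fixes \<alpha> :: real
  assumes \<alpha>: "0 < \<alpha>" "\<alpha> < 1"
  shows "(\<Sum>t<n. 4 powr (- \<alpha> * real t)) \<le> level_const \<alpha>"
proof -
  have "4 powr (- \<alpha> * real t) = 1 / ((4 powr \<alpha>) ^ t * 1)" for t
    by (simp add: powr_power powr_minus_divide powr_realpow[symmetric] powr_powr mult.commute)
  then have "(\<Sum>t<n. 4 powr (- \<alpha> * real t)) = (\<Sum>t | t < n \<and> 1 \<le> (4 powr \<alpha>) ^ t * (1::real). 1 / ((4 powr \<alpha>) ^ t * 1))"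
    using \<alpha> by (intro sum.cong) (auto intro!: one_le_power ge_one_powr_ge_zero)
  also have "\<dots> \<le> 4 powr \<alpha> / (4 powr \<alpha> - 1)"
    using \<alpha> by (intro sum_geometric_above_1) auto
  also have "\<dots> \<le> level_const \<alpha>" by (rule level_const_ge(1)[OF \<alpha>])
  finally show ?thesis .
qed

section \<open>Atoms of one level at one or two points\<close>

lemma atom_support: "atom (t, k) x \<noteq> 0 \<Longrightarrow> int k = \<lfloor>4 ^ t * x\<rfloor>"
  using wavelet_support[of "4 ^ t * x - real k"] by (intro floor_unique[symmetric]) (auto simp: atom_def)

text \<open>Meant for the cells of \<open>x\<close> and \<open>x + h\<close>, the only ones whose
  atoms can contribute to a difference.\<close>

lemma sum_nat_two_supports:
  fixes F :: "nat \<Rightarrow> real"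
  assumes "\<And>k. F k \<noteq> 0 \<Longrightarrow> int k = p \<or> int k = p'" "\<And>k. F k \<le> c" "0 \<le> c" and "finite K"
  shows "(\<Sum>k\<in>K. F k) \<le> 2 * c"
proof -
  have "(\<Sum>k\<in>K. F k) = (\<Sum>k\<in>{k \<in> K. F k \<noteq> 0}. F k)"
    using assms by (intro sum.mono_neutral_right) auto
  also have "\<dots> \<le> real (card {k \<in> K. F k \<noteq> 0}) * c"
    using assms(2) sum_bounded_above[of "{k \<in> K. F k \<noteq> 0}" F c] by simp
  also have "card {k \<in> K. F k \<noteq> 0} \<le> card {nat p, nat p'}"
    using assms(1) by (intro card_mono) force+
  then have "real (card {k \<in> K. F k \<noteq> 0}) * c \<le> 2 * c"
    using assms(3) card_insert_le_m1[of 2 "{nat p'}" "nat p"]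
    by (intro mult_right_mono) (auto intro: order_trans)
  finally show ?thesis .
qed

lemma sum_abs_atom_le: "(\<Sum>k<4 ^ t. \<bar>atom (t, k) x\<bar>) \<le> 4"
proof -
  have "(\<Sum>k<4 ^ t. \<bar>atom (t, k) x\<bar>) \<le> 2 * 2"
    by (rule sum_nat_two_supports[where p = "\<lfloor>4 ^ t * x\<rfloor>" and p' = "\<lfloor>4 ^ t * x\<rfloor>"])
       (use atom_support in \<open>auto simp: atom_def abs_wavelet_le\<close>)
  then show ?thesis by simp
qed

lemma sum_abs_atom_diff_le:
  assumes h: "0 \<le> h"
  shows "(\<Sum>k<4 ^ t. \<bar>atom (t, k) (x + h) - atom (t, k) x\<bar>) \<le> 32 * min 1 (4 ^ t * h)"
proof -
  have "(\<Sum>k<4 ^ t. \<bar>atom (t, k) (x + h) - atom (t, k) x\<bar>) \<le> 2 * (16 * min 1 (4 ^ t * h))"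
  proof (rule sum_nat_two_supports[where p = "\<lfloor>4 ^ t * x\<rfloor>" and p' = "\<lfloor>4 ^ t * (x + h)\<rfloor>"])
    fix k
    show "int k = \<lfloor>4 ^ t * x\<rfloor> \<or> int k = \<lfloor>4 ^ t * (x + h)\<rfloor>"
      if "\<bar>atom (t, k) (x + h) - atom (t, k) x\<bar> \<noteq> 0"
      using that atom_support[of t k x] atom_support[of t k "x + h"] by (cases "atom (t, k) x = 0") auto
    have "\<bar>atom (t, k) (x + h) - atom (t, k) x\<bar> \<le> 16"
      using abs_wavelet_le[of "4 ^ t * (x + h) - real k"] abs_wavelet_le[of "4 ^ t * x - real k"]
      by (simp add: atom_def)
    moreover have "\<bar>atom (t, k) (x + h) - atom (t, k) x\<bar> \<le> 16 * (4 ^ t * h)"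
      using abs_wavelet_diff_le[of "4 ^ t * (x + h) - real k" "4 ^ t * x - real k"] h
      by (simp add: atom_def algebra_simps)
    ultimately show "\<bar>atom (t, k) (x + h) - atom (t, k) x\<bar> \<le> 16 * min 1 (4 ^ t * h)"
      by (simp add: min_def)
  qed (use h in auto)
  then show ?thesis by simp
qed

section \<open>Tensor atoms of fixed total level\<close>

definition atoms :: "nat \<Rightarrow> ('d::finite \<Rightarrow> nat \<times> nat) set" where
  "atoms m = {a. (\<forall>i. snd (a i) < 4 ^ fst (a i)) \<and> (\<Sum>i\<in>UNIV. fst (a i)) = m}"

definition tensor_atom :: "('d \<Rightarrow> nat \<times> nat) \<Rightarrow> real ^ 'd::finite \<Rightarrow> real" where
  "tensor_atom a x = (\<Prod>i\<in>UNIV. atom (a i) (x $ i))"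

lemma atoms_fst_le: "a \<in> atoms m \<Longrightarrow> fst (a i) \<le> m"
  using member_le_sum[of i UNIV "\<lambda>i. fst (a i)"] by (auto simp: atoms_def)

lemma atoms_subset: "atoms m \<subseteq> PiE UNIV (\<lambda>_. SIGMA t:{..<m + 1}. {..<4 ^ t})"
proof
  fix a :: "'a \<Rightarrow> nat \<times> nat" assume a: "a \<in> atoms m"
  have "a i \<in> (SIGMA t:{..<m + 1}. {..<4 ^ t})" for i
  proof -
    have "snd (a i) < 4 ^ fst (a i)" using a by (simp add: atoms_def)
    then show ?thesis using atoms_fst_le[OF a, of i] by (cases "a i") auto
  qed
  then show "a \<in> PiE UNIV (\<lambda>_. SIGMA t:{..<m + 1}. {..<4 ^ t})" by (simp add: PiE_def Pi_def)
qed

lemma finite_atoms: "finite (atoms m :: ('d::finite \<Rightarrow> nat \<times> nat) set)"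
  by (rule finite_subset[OF atoms_subset]) (auto intro!: finite_PiE)

text \<open>All levels but one are chosen freely up to \<open>m div CARD('d)\<close>, the last one
  fills the total up to \<open>m\<close>, and every level vector of total \<open>m\<close> has
  \<open>4 ^ m\<close> positions.\<close>

lemma card_atoms_ge:
  "4 ^ m * (m div CARD('d) + 1) ^ (CARD('d) - 1) \<le> card (atoms m :: ('d::finite \<Rightarrow> nat \<times> nat) set)"
proof -
  obtain i0 :: 'd where True by simp
  let ?T = "{t :: 'd \<Rightarrow> nat. (\<Sum>i\<in>UNIV. t i) = m}"
  let ?S = "PiE (UNIV - {i0}) (\<lambda>_. {..m div CARD('d)})"
  let ?f = "\<lambda>s i. if i = i0 then m - (\<Sum>i\<in>UNIV - {i0}. s i) else s i :: nat"
  have "inj_on ?f ?S"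
  proof (rule inj_onI, rule ext)
    fix s s' :: "'d \<Rightarrow> nat" and i
    assume s: "s \<in> ?S" and s': "s' \<in> ?S" and eq: "?f s = ?f s'"
    show "s i = s' i"
      using fun_cong[OF eq, of i] PiE_arb[OF s, of i] PiE_arb[OF s', of i] by (auto split: if_splits)
  qed
  moreover have "?f ` ?S \<subseteq> ?T"
  proof (intro image_subsetI CollectI)
    fix s assume s: "s \<in> ?S"
    have "(\<Sum>i\<in>UNIV - {i0}. s i) \<le> (\<Sum>i\<in>UNIV - {i0}. m div CARD('d))"
      using s by (intro sum_mono) auto
    also have "\<dots> \<le> CARD('d) * (m div CARD('d))"
      by (simp add: card_Diff_singleton)
    also have "\<dots> \<le> m" by simp
    finally have le: "(\<Sum>i\<in>UNIV - {i0}. s i) \<le> m" .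
    have "(\<Sum>i\<in>UNIV. ?f s i) = ?f s i0 + (\<Sum>i\<in>UNIV - {i0}. ?f s i)"
      by (rule sum.remove) auto
    also have "(\<Sum>i\<in>UNIV - {i0}. ?f s i) = (\<Sum>i\<in>UNIV - {i0}. s i)"
      by (intro sum.cong) auto
    finally show "(\<Sum>i\<in>UNIV. ?f s i) = m" using le by simp
  qed
  ultimately have "card ?S \<le> card ?T"
    by (intro card_inj_on_le[where f = ?f] card_levels_le(1))
  then have T: "(m div CARD('d) + 1) ^ (CARD('d) - 1) \<le> card ?T"
    by (simp add: card_PiE card_Diff_singleton)
  let ?R = "SIGMA t:?T. PiE UNIV (\<lambda>i. {..<(4::nat) ^ t i})"
  have "card ?R = (\<Sum>t\<in>?T. 4 ^ m)"
    by (subst card_SigmaI) (auto simp: card_levels_le(1) card_PiE power_sum[symmetric] intro!: finite_PiE)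
  then have R: "card ?R = card ?T * 4 ^ m" by simp
  have "inj_on (\<lambda>(t, k) i. (t i, k i)) ?R"
    by (auto simp: inj_on_def fun_eq_iff)
  moreover have "(\<lambda>(t, k) i. (t i, k i)) ` ?R \<subseteq> atoms m"
    by (auto simp: atoms_def PiE_def Pi_def)
  ultimately have "card ?R \<le> card (atoms m :: ('d \<Rightarrow> nat \<times> nat) set)"
    by (intro card_inj_on_le finite_atoms)
  moreover have "4 ^ m * (m div CARD('d) + 1) ^ (CARD('d) - 1) \<le> card ?R"
    unfolding R using T by simp
  ultimately show ?thesis by linarith
qed

text \<open>The factor is the normalisation for the unit ball: since the total level is
  \<open>m\<close>, the power of 4 splits into one weight per coordinate, and every coordinate costs
  at most \<open>32 * level_const \<alpha>\<close>.\<close>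

definition atomic_sum :: "real \<Rightarrow> nat \<Rightarrow> (('d \<Rightarrow> nat \<times> nat) \<Rightarrow> real) \<Rightarrow> real ^ 'd::finite \<Rightarrow> real" where
  "atomic_sum \<alpha> m c x =
    4 powr (- \<alpha> * real m) / (32 * level_const \<alpha>) ^ CARD('d) * (\<Sum>a\<in>atoms m. c a * tensor_atom a x)"

lemma mixed_difference_atomic_sum_le:
  fixes h x :: "real ^ 'd::finite"
  assumes \<alpha>: "0 < \<alpha>" "\<alpha> < 1" and c: "\<And>a. \<bar>c a\<bar> \<le> 1" and h: "\<And>i. 0 < h $ i"
  shows "\<bar>mixed_difference h u (atomic_sum \<alpha> m c) x\<bar> \<le> (\<Prod>i\<in>u. h $ i powr \<alpha>)"
proof -
  define K where "K = 32 * level_const \<alpha>"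
  have K: "32 \<le> K" using level_const_ge(2)[OF \<alpha>] by (simp add: K_def)
  define \<kappa> where "\<kappa> = 4 powr (- \<alpha> * real m) / K ^ CARD('d)"
  define D where "D i b = (if i \<in> u then atom b (x $ i + h $ i) - atom b (x $ i) else atom b (x $ i))" for i b
  define w where "w i b = 4 powr (- \<alpha> * real (fst b)) * \<bar>D i b\<bar>" for i b
  let ?box = "SIGMA t:{..<m + 1}. {..<(4::nat) ^ t}"
  have "atomic_sum \<alpha> m c = (\<lambda>x. \<Sum>a\<in>atoms m. (\<kappa> * c a) * tensor_atom a x)"
    by (rule ext) (simp only: atomic_sum_def \<kappa>_def K_def sum_distrib_left mult.assoc)
  moreover have "mixed_difference h u (tensor_atom a) x = (\<Prod>i\<in>UNIV. D i (a i))" for a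
    using mixed_difference_prod[of h u "\<lambda>i. atom (a i)" x] by (simp add: tensor_atom_def[abs_def] D_def)
  ultimately have "mixed_difference h u (atomic_sum \<alpha> m c) x = (\<Sum>a\<in>atoms m. \<kappa> * c a * (\<Prod>i\<in>UNIV. D i (a i)))"
    by (simp add: mixed_difference_sum)
  also have "\<bar>\<dots>\<bar> \<le> (\<Sum>a\<in>atoms m. \<bar>\<kappa> * c a * (\<Prod>i\<in>UNIV. D i (a i))\<bar>)" by (rule sum_abs)
  also have "\<dots> \<le> (\<Sum>a\<in>atoms m. (\<Prod>i\<in>UNIV. w i (a i)) / K ^ CARD('d))"
  proof (rule sum_mono)
    fix a :: "'d \<Rightarrow> nat \<times> nat" assume a: "a \<in> atoms m"
    have "4 powr (- \<alpha> * real m) = (\<Prod>i\<in>UNIV. 4 powr (- \<alpha> * real (fst (a i))))"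
    proof -
      have "real m = (\<Sum>i\<in>UNIV. real (fst (a i)))" using a by (auto simp: atoms_def)
      then have "- \<alpha> * real m = (\<Sum>i\<in>UNIV. - \<alpha> * real (fst (a i)))"
        by (simp only: sum_distrib_left)
      then show ?thesis by (simp add: powr_sum)
    qed
    then have "(\<Prod>i\<in>UNIV. w i (a i)) / K ^ CARD('d) = \<kappa> * (\<Prod>i\<in>UNIV. \<bar>D i (a i)\<bar>)"
      by (simp add: w_def prod.distrib \<kappa>_def)
    moreover have "\<bar>\<kappa> * c a * (\<Prod>i\<in>UNIV. D i (a i))\<bar> = \<bar>c a\<bar> * (\<kappa> * (\<Prod>i\<in>UNIV. \<bar>D i (a i)\<bar>))"
      using K by (simp add: abs_mult abs_prod \<kappa>_def)
    moreover have "\<bar>c a\<bar> * (\<kappa> * (\<Prod>i\<in>UNIV. \<bar>D i (a i)\<bar>)) \<le> 1 * (\<kappa> * (\<Prod>i\<in>UNIV. \<bar>D i (a i)\<bar>))"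
      using K by (intro mult_right_mono c mult_nonneg_nonneg prod_nonneg) (auto simp: \<kappa>_def)
    ultimately show "\<bar>\<kappa> * c a * (\<Prod>i\<in>UNIV. D i (a i))\<bar> \<le> (\<Prod>i\<in>UNIV. w i (a i)) / K ^ CARD('d)"
      by simp
  qed
  also have "\<dots> \<le> (\<Sum>a\<in>PiE UNIV (\<lambda>_. ?box). (\<Prod>i\<in>UNIV. w i (a i)) / K ^ CARD('d))"
    using K by (intro sum_mono2 atoms_subset finite_PiE divide_nonneg_nonneg prod_nonneg) (auto simp: w_def)
  also have "\<dots> = (\<Prod>i\<in>UNIV. \<Sum>b\<in>?box. w i b) / K ^ CARD('d)"
    by (subst prod_sum_PiE) (auto simp: sum_divide_distrib)
  also have "\<dots> \<le> (\<Prod>i\<in>UNIV. K * (if i \<in> u then h $ i powr \<alpha> else 1)) / K ^ CARD('d)"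
  proof (intro divide_right_mono prod_mono conjI)
    fix i :: 'd
    show "0 \<le> (\<Sum>b\<in>?box. w i b)" by (intro sum_nonneg) (auto simp: w_def)
    have "(\<Sum>b\<in>?box. w i b) = (\<Sum>t<m + 1. \<Sum>k<4 ^ t. w i (t, k))"
      by (subst sum.Sigma) auto
    also have "\<dots> = (\<Sum>t<m + 1. 4 powr (- \<alpha> * real t) * (\<Sum>k<4 ^ t. \<bar>D i (t, k)\<bar>))"
      by (simp add: w_def sum_distrib_left)
    also have "\<dots> \<le> K * (if i \<in> u then h $ i powr \<alpha> else 1)"
    proof (cases "i \<in> u")
      case True
      have "(\<Sum>t<m + 1. 4 powr (- \<alpha> * real t) * (\<Sum>k<4 ^ t. \<bar>D i (t, k)\<bar>))
          \<le> (\<Sum>t<m + 1. 4 powr (- \<alpha> * real t) * (32 * min 1 (4 ^ t * h $ i)))"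
        using True h[of i] sum_abs_atom_diff_le[of "h $ i" _ "x $ i"]
        by (intro sum_mono mult_left_mono) (auto simp: D_def less_imp_le)
      also have "\<dots> = 32 * (\<Sum>t<m + 1. 4 powr (- \<alpha> * real t) * min 1 (4 ^ t * h $ i))"
        by (simp add: sum_distrib_left mult_ac)
      also have "\<dots> \<le> 32 * (level_const \<alpha> * h $ i powr \<alpha>)"
        by (intro mult_left_mono sum_min_le \<alpha> h) auto
      finally show ?thesis using True by (simp add: K_def mult_ac)
    next
      case False
      have "(\<Sum>t<m + 1. 4 powr (- \<alpha> * real t) * (\<Sum>k<4 ^ t. \<bar>D i (t, k)\<bar>))
          \<le> (\<Sum>t<m + 1. 4 powr (- \<alpha> * real t) * 4)"
        using False sum_abs_atom_le by (intro sum_mono mult_left_mono) (auto simp: D_def)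
      also have "\<dots> = 4 * (\<Sum>t<m + 1. 4 powr (- \<alpha> * real t))"
        by (simp add: sum_distrib_left mult_ac)
      also have "\<dots> \<le> 4 * level_const \<alpha>"
        by (intro mult_left_mono sum_geometric_le \<alpha>) auto
      finally show ?thesis using False K by (simp add: K_def)
    qed
    finally show "(\<Sum>b\<in>?box. w i b) \<le> K * (if i \<in> u then h $ i powr \<alpha> else 1)" .
  qed (use K in auto)
  also have "\<dots> = (\<Prod>i\<in>UNIV. if i \<in> u then h $ i powr \<alpha> else 1)"
    using K by (simp add: prod.distrib)
  also have "\<dots> = (\<Prod>i\<in>u. h $ i powr \<alpha>)"
    by (simp add: prod.inter_restrict[symmetric])
  finally show ?thesis .
qed

lemma holder_norm_le_1I:
  fixes f :: "real ^ 'd::finite \<Rightarrow> real"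
  assumes "\<And>h u x. (\<And>i. 0 < h $ i) \<Longrightarrow> \<bar>mixed_difference h u f x\<bar> \<le> (\<Prod>i\<in>u. h $ i powr \<alpha>)"
  shows "holder_norm \<alpha> f \<le> 1"
proof -
  have "holder_seminorm \<alpha> u f \<le> 1" for u
    unfolding holder_seminorm_def
  proof (rule SUP_least)
    fix h :: "real ^ 'd" assume "h \<in> {h. (\<forall>i. 0 < h $ i) \<and> difference_domain h u \<noteq> {}}"
    then have h: "\<And>i. 0 < h $ i" by auto
    have "(SUP x\<in>difference_domain h u. ennreal \<bar>mixed_difference h u f x\<bar>) \<le> ennreal (\<Prod>i\<in>u. h $ i powr \<alpha>)"
      using assms h by (intro SUP_least ennreal_leI) auto
    then have "ennreal (\<Prod>i\<in>u. h $ i powr - \<alpha>) * (SUP x\<in>difference_domain h u. ennreal \<bar>mixed_difference h u f x\<bar>)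
        \<le> ennreal (\<Prod>i\<in>u. h $ i powr - \<alpha>) * ennreal (\<Prod>i\<in>u. h $ i powr \<alpha>)"
      by (intro mult_left_mono) auto
    also have "\<dots> = ennreal (\<Prod>i\<in>u. h $ i powr - \<alpha> * h $ i powr \<alpha>)"
      by (simp add: ennreal_mult[symmetric] prod_nonneg prod.distrib)
    also have "(\<Prod>i\<in>u. h $ i powr - \<alpha> * h $ i powr \<alpha>) = 1"
    proof (rule prod.neutral, rule ballI)
      fix i
      show "h $ i powr - \<alpha> * h $ i powr \<alpha> = 1" using h[of i] by (simp add: powr_add[symmetric])
    qed
    finally show "ennreal (\<Prod>i\<in>u. h $ i powr - \<alpha>) * (SUP x\<in>difference_domain h u. ennreal \<bar>mixed_difference h u f x\<bar>) \<le> 1"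
      by simp
  qed
  then show ?thesis unfolding holder_norm_def by (subst Max_le_iff) auto
qed

lemma continuous_on_atomic_sum: "continuous_on S (atomic_sum \<alpha> m c)"
  unfolding atomic_sum_def[abs_def] tensor_atom_def[abs_def] atom_def[abs_def]
  by (intro continuous_intros)

lemma atomic_sum_in_holder_ball:
  fixes c :: "('d::finite \<Rightarrow> nat \<times> nat) \<Rightarrow> real"
  assumes \<alpha>: "0 < \<alpha>" "\<alpha> < 1" and c: "\<And>a. \<bar>c a\<bar> \<le> 1"
  shows "abs_linfty (atomic_sum \<alpha> m c) \<in> (holder_ball \<alpha> :: 'd linfty set)"
  unfolding holder_ball_def
proof (intro imageI CollectI conjI ballI)
  show "continuous_on unit_cube (atomic_sum \<alpha> m c)" by (rule continuous_on_atomic_sum)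
  show "holder_norm \<alpha> (atomic_sum \<alpha> m c) \<le> 1"
    by (intro holder_norm_le_1I mixed_difference_atomic_sum_le \<alpha> c)
  fix x :: "real ^ 'd" assume "x \<in> frontier unit_cube"
  then have "x \<in> unit_cube" "x \<notin> interior unit_cube" by (auto simp: frontier_def closed_cbox)
  then obtain i where i: "x $ i = 0 \<or> x $ i = 1"
    unfolding interior_cbox mem_box_cart by (auto simp: not_less intro: order_antisym)
  \<comment> \<open>The open support of an atom lies strictly inside the unit interval, as its
    position is below \<open>4 ^ fst (a i)\<close>.\<close>
  have "atom (a i) (x $ i) = 0" if a: "a \<in> atoms m" for a
  proof (rule ccontr)
    assume "atom (a i) (x $ i) \<noteq> 0"
    then have "0 < 4 ^ fst (a i) * x $ i - real (snd (a i)) \<and> 4 ^ fst (a i) * x $ i - real (snd (a i)) < 1"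
      using wavelet_support unfolding atom_def by blast
    moreover have "real (snd (a i)) + 1 \<le> 4 ^ fst (a i)"
    proof -
      have "snd (a i) + 1 \<le> 4 ^ fst (a i)" using a by (auto simp: atoms_def Suc_le_eq)
      then have "real (snd (a i) + 1) \<le> real (4 ^ fst (a i))" by (rule of_nat_mono)
      then show ?thesis by simp
    qed
    ultimately show False using i by auto
  qed
  then have "tensor_atom a x = 0" if "a \<in> atoms m" for a
    using that by (auto simp: tensor_atom_def intro!: prod_zero)
  then show "atomic_sum \<alpha> m c x = 0" by (simp add: atomic_sum_def)
qed

section \<open>Sampling on a generic grid\<close>

text \<open>A bad shift carries some grid point into the exceptional null set. The bad shifts thus
  lie in finitely many translates of a null set and cannot fill the open box of admissible
  shifts.\<close>

lemma ex_generic_grid_shift: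
  fixes Q :: "'a \<Rightarrow> real ^ 'd::finite \<Rightarrow> bool"
  assumes T: "finite T" and Q: "\<And>A. A \<in> T \<Longrightarrow> AE x in cube_measure. Q A x"
  shows "\<exists>\<theta> :: real ^ 'd. (\<forall>i. shifted_grid m (\<theta> $ i)) \<and>
    (\<forall>z\<in>PiE UNIV (\<lambda>_. {..<4 ^ (m + 1)}). \<forall>A\<in>T. Q A (\<chi> i. shifted_grid.gridpt m (\<theta> $ i) (z i)))"
proof -
  let ?Z = "PiE (UNIV :: 'd set) (\<lambda>_. {..<(4::nat) ^ (m + 1)})"
  have "AE x in cube_measure. \<forall>A\<in>T. Q A x" using T Q by (intro AE_finite_allI)
  then have "AE x in lebesgue. x \<in> unit_cube \<longrightarrow> (\<forall>A\<in>T. Q A x)"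
    by (subst (asm) AE_restrict_space_iff) auto
  then obtain E where E: "{x. \<not> (x \<in> unit_cube \<longrightarrow> (\<forall>A\<in>T. Q A x))} \<subseteq> E" "E \<in> null_sets lebesgue"
    unfolding eventually_ae_filter by auto
  define v where "v z = (\<chi> i. - (real (z i) / 4 ^ (m + 1)) :: real ^ 'd)" for z :: "'d \<Rightarrow> nat"
  have "negligible E" using E(2) by (simp add: negligible_iff_null_sets)
  moreover have "finite ?Z" by (intro finite_PiE) auto
  ultimately have neg: "negligible (\<Union>z\<in>?Z. (+) (v z) ` E)"
    by (intro negligible_Union) (auto intro: negligible_translation)
  let ?U = "box 0 (\<chi> i. 1 / 4 ^ (m + 1)) :: (real ^ 'd) set"
  have "1 / (2 * 4 ^ (m + 1)) < 1 / (4 ^ (m + 1) :: real)" by (intro divide_strict_left_mono) auto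
  then have "(\<chi> i. 1 / (2 * 4 ^ (m + 1))) \<in> ?U" by (simp add: mem_box_cart)
  then have "?U \<noteq> {}" by blast
  then have "\<not> negligible ?U" by (intro open_not_negligible open_box)
  then obtain \<theta> where \<theta>: "\<theta> \<in> ?U" "\<theta> \<notin> (\<Union>z\<in>?Z. (+) (v z) ` E)"
    using negligible_subset[OF neg] by blast
  have \<theta>01: "0 < \<theta> $ i" "\<theta> $ i < 1 / 4 ^ (m + 1)" for i using \<theta>(1) by (auto simp: mem_box_cart)
  have grid: "shifted_grid m (\<theta> $ i)" for i
    using \<theta>01[of i] by unfold_locales (auto simp: field_simps)
  moreover have "\<forall>A\<in>T. Q A (\<chi> i. shifted_grid.gridpt m (\<theta> $ i) (z i))" if z: "z \<in> ?Z" for z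
  proof -
    let ?p = "\<chi> i. shifted_grid.gridpt m (\<theta> $ i) (z i)"
    have "?p \<in> unit_cube"
      unfolding mem_unit_cube
    proof
      fix i
      have "z i < 4 ^ (m + 1)" using z by auto
      then have "real (z i + 1) \<le> real (4 ^ (m + 1))" by (intro of_nat_mono) simp
      then have "real (z i) + 1 \<le> 4 ^ (m + 1)" by simp
      then have "(real (z i) + 1) / 4 ^ (m + 1) \<le> 1" by simp
      then show "?p $ i \<in> {0..1}"
        using \<theta>01[of i] unfolding shifted_grid.gridpt_def[OF grid] add_divide_distrib by simp
    qed
    moreover have "?p \<notin> E"
    proof
      assume "?p \<in> E"
      moreover have "\<theta> = v z + ?p"
        by (simp add: vec_eq_iff v_def shifted_grid.gridpt_def[OF grid])
      ultimately show False using \<theta>(2) z by blast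
    qed
    ultimately show ?thesis using E(1) by blast
  qed
  ultimately show ?thesis by blast
qed

text \<open>Relative to the common factor \<open>G\<close>, each atom contributes at least 2^(-d) to
  the squared norm, and each dimension removes at most 16^d. The hypothesis on \<open>M\<close>
  keeps half of the norm, and \<open>?e\<close> is the resulting root mean square over the
  grid.\<close>

lemma manifold_width_holder_ball_ge:
  fixes m :: nat
  defines "n \<equiv> card (atoms m :: ('d::finite \<Rightarrow> nat \<times> nat) set)"
  assumes \<alpha>: "0 < \<alpha>" "\<alpha> < 1" and M: "2 * 32 ^ CARD('d) * M \<le> n"
  shows "ennreal (4 powr (- \<alpha> * real m) / (32 * level_const \<alpha>) ^ CARD('d)
      * sqrt (real n / (2 * 8 ^ CARD('d) * 4 ^ m)))
    \<le> manifold_width N M (holder_ball \<alpha> :: 'd linfty set)" (is "ennreal ?e \<le> _")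
proof (rule manifold_width_ge)
  fix B :: "'d linfty set" and P :: "'d linfty \<Rightarrow> 'd linfty"
  assume B: "finite B" "card B \<le> M" and P: "\<And>f. f \<in> holder_ball \<alpha> \<Longrightarrow> P f \<in> span B"
  let ?D = "CARD('d)"
  let ?I = "atoms m :: ('d \<Rightarrow> nat \<times> nat) set"
  let ?Z = "PiE (UNIV :: 'd set) (\<lambda>_. {..<(4::nat) ^ (m + 1)})"
  define \<kappa> where "\<kappa> = 4 powr (- \<alpha> * real m) / (32 * level_const \<alpha>) ^ ?D"
  have \<kappa>: "0 < \<kappa>" using level_const_ge(2)[OF \<alpha>] by (simp add: \<kappa>_def)
  define F where "F A = atomic_sum \<alpha> m (signs A :: ('d \<Rightarrow> nat \<times> nat) \<Rightarrow> real)" for A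
  have ball: "abs_linfty (F A) \<in> (holder_ball \<alpha> :: 'd linfty set)" for A
    unfolding F_def by (intro atomic_sum_in_holder_ball \<alpha>) (simp add: abs_signs)
  show "\<exists>f\<in>holder_ball \<alpha>. ?e \<le> norm (f - P f)"
  proof (rule ccontr)
    assume "\<not> ?thesis"
    then have lt: "norm (abs_linfty (F A) - P (abs_linfty (F A))) < ?e" for A
      using ball by (meson not_less)
    \<comment> \<open>Finitely many strict bounds have a common bound \<open>e'\<close> below
      \<open>?e\<close>, so the strictness survives the passage to the grid.\<close>
    define e' where "e' = Max ((\<lambda>A. norm (abs_linfty (F A) - P (abs_linfty (F A)))) ` Pow ?I)"
    have fin: "finite (Pow ?I)" using finite_atoms by simp
    have e': "norm (abs_linfty (F A) - P (abs_linfty (F A))) \<le> e'" if "A \<in> Pow ?I" for A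
      unfolding e'_def using fin that by (intro Max_ge) auto
    have "e' < ?e" unfolding e'_def using fin lt by (subst Max_less_iff) auto
    moreover have "0 \<le> e'" using e'[of "{}"] norm_ge_zero order_trans by blast
    ultimately have sq: "e'\<^sup>2 < ?e\<^sup>2" by (intro power_strict_mono) auto
    have "\<exists>u. P (abs_linfty (F A)) = (\<Sum>b\<in>B. u b *\<^sub>R b)" for A
      using P[OF ball, of A] span_finite[OF B(1)] by auto
    then obtain u where u: "\<And>A. P (abs_linfty (F A)) = (\<Sum>b\<in>B. u A b *\<^sub>R b)" by metis
    have AE: "AE x in cube_measure. \<bar>F A x - (\<Sum>b\<in>B. u A b * rep_linfty b x)\<bar> \<le> e'"
      if "A \<in> Pow ?I" for A
      using e'[OF that] unfolding u
      by (rule norm_diff_span_le[rotated]) (simp add: F_def ess_bounded_continuous_on continuous_on_atomic_sum)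
    define pt where "pt \<theta> z = (\<chi> i. shifted_grid.gridpt m (\<theta> $ i) (z i))" for \<theta> :: "real ^ 'd" and z :: "'d \<Rightarrow> nat"
    \<comment> \<open>The shift must serve all patterns, since the decisive \<open>A\<close> is
      determined only by the values on the chosen grid.\<close>
    have "\<exists>\<theta> :: real ^ 'd. (\<forall>i. shifted_grid m (\<theta> $ i)) \<and>
      (\<forall>z\<in>?Z. \<forall>A\<in>Pow ?I. \<bar>F A (pt \<theta> z) - (\<Sum>b\<in>B. u A b * rep_linfty b (pt \<theta> z))\<bar> \<le> e')"
      unfolding pt_def by (rule ex_generic_grid_shift[OF fin]) (rule AE)
    then obtain \<theta> :: "real ^ 'd" where grid: "\<forall>i. shifted_grid m (\<theta> $ i)"
      and near: "\<forall>z\<in>?Z. \<forall>A\<in>Pow ?I. \<bar>F A (pt \<theta> z) - (\<Sum>b\<in>B. u A b * rep_linfty b (pt \<theta> z))\<bar> \<le> e'"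
      by (elim exE conjE) (rule that)
    define g where "g i b k = atom b (shifted_grid.gridpt m (\<theta> $ i) k)" for i b k
    have finZ: "finite ?Z" by (intro finite_PiE) auto
    have inner: "(\<Sum>z\<in>?Z. tensor_atom a (pt \<theta> z) * tensor_atom b (pt \<theta> z))
        = (\<Prod>i\<in>UNIV. \<Sum>k<4 ^ (m + 1). g i (a i) k * g i (b i) k)" for a b
      by (subst prod_sum_PiE) (auto simp: tensor_atom_def pt_def g_def prod.distrib intro!: sum.cong)
    define \<nu> where "\<nu> a = (\<Sum>z\<in>?Z. tensor_atom a (pt \<theta> z) * tensor_atom a (pt \<theta> z))" for a
    have orth: "(\<Sum>z\<in>?Z. tensor_atom a (pt \<theta> z) * tensor_atom b (pt \<theta> z)) = (if a = b then \<nu> a else 0)"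
      if ab: "a \<in> ?I" "b \<in> ?I" for a b
    proof (cases "a = b")
      case False
      then obtain i where i: "a i \<noteq> b i" by auto
      have "(\<Sum>k<4 ^ (m + 1). g i (a i) k * g i (b i) k) = 0"
        unfolding g_def using ab i atoms_fst_le
        by (intro shifted_grid.sum_atom_orthogonal[OF spec[OF grid]]) (auto simp: atoms_def)
      then show ?thesis using False unfolding inner by (auto intro!: prod_zero)
    qed (simp add: \<nu>_def)
    \<comment> \<open>The scale of the squared norms, the same for all atoms because their total
      level is \<open>m\<close>.\<close>
    define G where "G = (4::real) ^ (?D * m - m)"
    have G: "(\<Prod>i\<in>UNIV. 4 ^ (m - fst (a i))) = G" if "a \<in> ?I" for a
    proof -
      have "(\<Sum>i\<in>UNIV. m - fst (a i)) = (\<Sum>i\<in>(UNIV :: 'd set). m) - (\<Sum>i\<in>UNIV. fst (a i))"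
        using atoms_fst_le[OF that] by (intro sum_subtractf_nat) auto
      also have "\<dots> = ?D * m - m" using that by (simp add: atoms_def)
      finally show ?thesis by (simp add: G_def power_sum[symmetric])
    qed
    have G0: "0 < G" by (simp add: G_def)
    have \<nu>: "\<nu> a \<le> 16 ^ ?D * G \<and> G / 2 ^ ?D \<le> \<nu> a" if a: "a \<in> ?I" for a
    proof
      have b: "4 ^ (m - fst (a i)) / 2 \<le> (\<Sum>k<4 ^ (m + 1). g i (a i) k * g i (a i) k)"
        "(\<Sum>k<4 ^ (m + 1). g i (a i) k * g i (a i) k) \<le> 16 * 4 ^ (m - fst (a i))" for i
        unfolding g_def using a atoms_fst_le[OF a]
        by (intro shifted_grid.sum_atom_square[OF spec[OF grid]]; auto simp: atoms_def)+
      have "\<nu> a \<le> (\<Prod>i\<in>UNIV. 16 * 4 ^ (m - fst (a i)))"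
        unfolding \<nu>_def inner
        by (intro prod_mono conjI b sum_nonneg) auto
      then show "\<nu> a \<le> 16 ^ ?D * G" by (simp add: prod.distrib G[OF a])
      have "(\<Prod>i\<in>UNIV. 4 ^ (m - fst (a i)) / 2) \<le> \<nu> a"
        unfolding \<nu>_def inner
        by (intro prod_mono conjI b) auto
      then show "G / 2 ^ ?D \<le> \<nu> a" by (simp add: prod_dividef G[OF a])
    qed
    have "\<exists>A\<subseteq>?I. \<forall>c. real (card ?I) * (G / 2 ^ ?D) - real M * (16 ^ ?D * G)
        \<le> (\<Sum>z\<in>?Z. ((\<Sum>a\<in>?I. signs A a * tensor_atom a (pt \<theta> z)) - (\<Sum>b\<in>B. c b * rep_linfty b (pt \<theta> z)))\<^sup>2)"
    proof (rule ex_signs_far_from_span[OF finite_atoms finZ B orth])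
      show "\<nu> a \<le> 16 ^ ?D * G" "G / 2 ^ ?D \<le> \<nu> a" if "a \<in> ?I" for a using \<nu>[OF that] by auto
    qed (use G0 in auto)
    then obtain A where A: "A \<subseteq> ?I"
      and far: "\<And>c. real (card ?I) * (G / 2 ^ ?D) - real M * (16 ^ ?D * G)
        \<le> (\<Sum>z\<in>?Z. ((\<Sum>a\<in>?I. signs A a * tensor_atom a (pt \<theta> z)) - (\<Sum>b\<in>B. c b * rep_linfty b (pt \<theta> z)))\<^sup>2)"
      by blast
    have "\<kappa>\<^sup>2 * ((real n / 2 ^ ?D - real M * 16 ^ ?D) * G)
        \<le> \<kappa>\<^sup>2 * (\<Sum>z\<in>?Z. ((\<Sum>a\<in>?I. signs A a * tensor_atom a (pt \<theta> z)) - (\<Sum>b\<in>B. (u A b / \<kappa>) * rep_linfty b (pt \<theta> z)))\<^sup>2)"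
      using far[of "\<lambda>b. u A b / \<kappa>"] \<kappa> by (intro mult_left_mono) (simp_all add: n_def algebra_simps)
    also have "\<dots> = (\<Sum>z\<in>?Z. (F A (pt \<theta> z) - (\<Sum>b\<in>B. u A b * rep_linfty b (pt \<theta> z)))\<^sup>2)"
      unfolding sum_distrib_left
    proof (intro sum.cong refl)
      fix z
      have "(\<Sum>b\<in>B. u A b * rep_linfty b (pt \<theta> z)) = \<kappa> * (\<Sum>b\<in>B. (u A b / \<kappa>) * rep_linfty b (pt \<theta> z))"
        using \<kappa> by (simp add: sum_distrib_left)
      moreover have "F A (pt \<theta> z) = \<kappa> * (\<Sum>a\<in>?I. signs A a * tensor_atom a (pt \<theta> z))"
        by (simp add: F_def atomic_sum_def \<kappa>_def)
      ultimately show "\<kappa>\<^sup>2 * ((\<Sum>a\<in>?I. signs A a * tensor_atom a (pt \<theta> z)) - (\<Sum>b\<in>B. (u A b / \<kappa>) * rep_linfty b (pt \<theta> z)))\<^sup>2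
          = (F A (pt \<theta> z) - (\<Sum>b\<in>B. u A b * rep_linfty b (pt \<theta> z)))\<^sup>2"
        by (simp only: power_mult_distrib[symmetric] right_diff_distrib)
    qed
    also have "\<dots> \<le> (\<Sum>z\<in>?Z. e'\<^sup>2)"
    proof (rule sum_mono)
      fix z assume "z \<in> ?Z"
      then have "\<bar>F A (pt \<theta> z) - (\<Sum>b\<in>B. u A b * rep_linfty b (pt \<theta> z))\<bar> \<le> e'"
        using near A by blast
      then show "(F A (pt \<theta> z) - (\<Sum>b\<in>B. u A b * rep_linfty b (pt \<theta> z)))\<^sup>2 \<le> e'\<^sup>2"
        using power_mono[of "\<bar>F A (pt \<theta> z) - (\<Sum>b\<in>B. u A b * rep_linfty b (pt \<theta> z))\<bar>" e' 2] by simp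
    qed
    also have "\<dots> = real (card ?Z) * e'\<^sup>2" by simp
    \<comment> \<open>Expressed through \<open>G\<close>, the number of grid points cancels against
      the squared norms and leaves the factor \<open>4 ^ m\<close>.\<close>
    also have "real (card ?Z) = 4 ^ ?D * (4 ^ m * G)"
    proof -
      have "real (card ?Z) = 4 ^ ((m + 1) * ?D)" by (simp add: card_PiE power_mult power_add)
      also have "(m + 1) * ?D = ?D + (m + (?D * m - m))" by (simp add: algebra_simps)
      finally show ?thesis by (simp only: G_def power_add)
    qed
    finally have main: "\<kappa>\<^sup>2 * (real n / 2 ^ ?D - real M * 16 ^ ?D) * G \<le> 4 ^ ?D * 4 ^ m * e'\<^sup>2 * G"
      by (simp add: mult_ac)
    then have "\<kappa>\<^sup>2 * (real n / 2 ^ ?D - real M * 16 ^ ?D) \<le> 4 ^ ?D * 4 ^ m * e'\<^sup>2"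
      using G0 by (rule mult_right_le_imp_le)
    moreover have "real n / (2 * 2 ^ ?D) \<le> real n / 2 ^ ?D - real M * 16 ^ ?D"
    proof -
      have "real (2 * 32 ^ ?D * M) \<le> real n" using M by (rule of_nat_mono)
      then have "2 * (2 ^ ?D * 16 ^ ?D) * real M \<le> real n"
        by (simp add: power_mult_distrib[symmetric])
      then show ?thesis by (simp add: field_simps)
    qed
    then have "\<kappa>\<^sup>2 * (real n / (2 * 2 ^ ?D)) \<le> \<kappa>\<^sup>2 * (real n / 2 ^ ?D - real M * 16 ^ ?D)"
      by (intro mult_left_mono) auto
    ultimately have "\<kappa>\<^sup>2 * (real n / (2 * 2 ^ ?D)) \<le> 4 ^ ?D * 4 ^ m * e'\<^sup>2" by linarith
    then have "\<kappa>\<^sup>2 * (real n / (2 * (2 ^ ?D * 4 ^ ?D) * 4 ^ m)) \<le> e'\<^sup>2"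
      by (simp add: field_simps)
    moreover have "?e\<^sup>2 = \<kappa>\<^sup>2 * (real n / (2 * (2 ^ ?D * 4 ^ ?D) * 4 ^ m))"
      unfolding \<kappa>_def[symmetric] by (simp add: power_mult_distrib[symmetric])  (simp add: power_mult_distrib)
    ultimately show False using sq by linarith
  qed
qed

section \<open>Choice of the levels\<close>

text \<open>Both rates have this form, with \<beta> = 1 and \<beta> = 1/2; the bracket on the right
  is the quantity \<open>Y\<close> that fixes the level.\<close>

lemma rate_eq:
  fixes L l n \<alpha> \<beta> D :: real
  assumes "0 < L" "0 < l" "0 < n"
  shows "L powr (D * (\<alpha> + \<beta>)) / (n * L) powr \<alpha> * l powr (D * \<alpha>)
    = L powr (D * \<beta>) * (n * L * l powr (- D) / L powr D) powr - \<alpha>"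
proof -
  have "(n * L * l powr (- D) / L powr D) powr - \<alpha>
      = (n * L) powr - \<alpha> * l powr (D * \<alpha>) * L powr (D * \<alpha>)"
    using assms by (simp add: powr_mult powr_divide powr_powr powr_minus_divide)
  moreover have "L powr (D * (\<alpha> + \<beta>)) = L powr (D * \<alpha>) * L powr (D * \<beta>)"
    by (simp add: distrib_left powr_add)
  ultimately show ?thesis by (simp add: powr_minus_divide mult_ac)
qed

lemma power_le_fact_exp:
  fixes x :: real
  assumes "0 \<le> x"
  shows "x ^ k \<le> fact k * exp x"
proof -
  have "(\<Sum>n\<in>{k}. x ^ n /\<^sub>R fact n) \<le> (\<Sum>n. x ^ n /\<^sub>R fact n)"
    using assms by (intro sum_le_suminf summable_exp_generic) auto
  then have "x ^ k /\<^sub>R fact k \<le> exp x" by (simp add: exp_def)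
  then show ?thesis by (simp add: field_simps)
qed

text \<open>For \<open>L = log 2 N\<close> the last factor is the square root of N: powers of the
  logarithm cost at most half of the exponent.\<close>

lemma power_le_powr_half:
  fixes L :: real
  assumes "0 \<le> L"
  shows "L ^ k \<le> fact k * (2 / ln 2) ^ k * 2 powr (L / 2)"
proof -
  have l2: "0 < ln (2::real)" by simp
  have "L ^ k = (2 / ln 2) ^ k * (L * ln 2 / 2) ^ k"
    using l2 by (simp add: power_mult_distrib[symmetric])
  also have "\<dots> \<le> (2 / ln 2) ^ k * (fact k * exp (L * ln 2 / 2))"
    using assms l2 by (intro mult_left_mono power_le_fact_exp) auto
  also have "exp (L * ln 2 / 2) = 2 powr (L / 2)" by (simp add: powr_def)
  finally show ?thesis by (simp add: mult_ac)
qed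

lemma log_2_le_self:
  fixes x :: real
  assumes "0 < x"
  shows "log 2 x \<le> x"
proof -
  have l2: "2 / 3 \<le> ln (2::real)" "ln (2::real) < 1" by (rule ln2_ge_two_thirds, rule ln_2_less_1)
  have "ln (x / 2) \<le> x / 2 - 1" using assms by (intro ln_le_minus_one) auto
  then have "ln x \<le> x * (1 / 2)" using assms l2 by (simp add: ln_div)
  also have "\<dots> \<le> x * ln 2" using assms l2 by (intro mult_left_mono) auto
  finally show ?thesis using l2 by (simp add: log_def divide_le_eq)
qed

lemma log_scales:
  fixes N :: nat
  assumes N: "N \<ge> 4"
  defines "L \<equiv> log 2 N"
  defines "l \<equiv> log 2 L"
  shows "2 \<le> L" "1 \<le> l" "l \<le> L" "L \<le> N"
proof -
  have "log 2 4 \<le> L" unfolding L_def using N by (subst log_le_cancel_iff) auto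
  moreover have "log 2 4 = (2::real)" using log_pow_cancel[of "2::real" 2] by simp
  ultimately show L: "2 \<le> L" by simp
  then have "log 2 2 \<le> l" unfolding l_def by (subst log_le_cancel_iff) auto
  then show l: "1 \<le> l" by simp
  show "L \<le> N" unfolding L_def using N by (intro log_2_le_self) simp
  show "l \<le> L" unfolding l_def using L by (intro log_2_le_self) simp
qed

text \<open>Up to rounding, \<open>Y\<close> is the dimension divided by \<open>L ^ D\<close>. The
  bounds of \<open>Y\<close> in terms of \<open>2 powr L\<close> ensure that a level
  \<open>m\<close> with \<open>2 ^ m\<close> or \<open>4 ^ m\<close> proportional to
  \<open>Y\<close> is comparable to \<open>L\<close>.\<close>

lemma width_scales:
  fixes N D :: nat
  assumes N: "N \<ge> 4"
  defines "L \<equiv> log 2 N"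
  defines "l \<equiv> log 2 L"
  defines "Y \<equiv> real N * L * l powr (- real D) / L powr real D"
  shows "0 < Y"
    and "Y * L ^ D = real N * L * l powr (- real D)" "Y \<le> 2 powr (2 * L)"
    and "2 powr L \<le> Y * L ^ (2 * D)"
proof -
  note L = log_scales(1)[OF N, folded L_def] and l = log_scales(2)[OF N, folded L_def, folded l_def]
    and lL = log_scales(3)[OF N, folded L_def, folded l_def] and LN = log_scales(4)[OF N, folded L_def]
  have NL: "2 powr L = real N" using N by (simp add: L_def)
  have LD: "L powr real D = L ^ D" "l powr (- real D) = 1 / l ^ D"
    using L l by (simp_all add: powr_realpow powr_minus_divide)
  show Y: "0 < Y" using N L l by (simp add: Y_def)
  show YL: "Y * L ^ D = real N * L * l powr (- real D)"
    using L unfolding Y_def LD by simp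
  have "Y = (real N * L) * (1 / (l ^ D * L ^ D))" by (simp add: Y_def LD)
  also have "\<dots> \<le> (real N * L) * 1"
    using L l by (intro mult_left_mono) (auto simp: divide_le_eq_1 one_le_mult_iff intro!: mult_ge1_I one_le_power)
  also have "\<dots> \<le> real N * real N" using LN by (simp add: mult_left_mono)
  also have "\<dots> = 2 powr (2 * L)" by (simp add: NL[symmetric] powr_add[symmetric])
  finally show "Y \<le> 2 powr (2 * L)" .
  have "2 powr L * 1 \<le> real N * (L * (L ^ D / l ^ D))"
  proof -
    have "1 \<le> L ^ D / l ^ D" using lL l by (simp add: le_divide_eq power_mono)
    then have "1 * 1 \<le> L * (L ^ D / l ^ D)" using L by (intro mult_mono) auto
    then show ?thesis unfolding NL by (intro mult_left_mono) auto
  qed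
  also have "\<dots> = (Y * L ^ D) * L ^ D" unfolding YL LD by simp
  finally show "2 powr L \<le> Y * L ^ (2 * D)" by (simp add: power_mult power2_eq_square power_mult_distrib mult_2 power_add)
qed


section \<open>The two rates in terms of N\<close>

lemma manifold_width_upper_rate:
  fixes \<alpha> :: real and M :: "nat \<Rightarrow> nat"
  assumes \<alpha>: "0 < \<alpha>" "\<alpha> < 1"
    and M: "\<And>N. N \<ge> 4 \<Longrightarrow>
      M N = nat \<lfloor>real N * log 2 N * log 2 (log 2 N) powr (- real (CARD('d) - 1))\<rfloor>"
  shows "\<exists>C>0. \<forall>N\<ge>4. manifold_width N (M N) (holder_ball \<alpha> :: 'd::finite linfty set)
      \<le> ennreal (C * (log 2 N powr (real (CARD('d) - 1) * (\<alpha> + 1)) / (real N * log 2 N) powr \<alpha>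
        * log 2 (log 2 N) powr (real (CARD('d) - 1) * \<alpha>)))"
proof -
  define D where "D = CARD('d) - 1"
  define r where "r = 2 powr - \<alpha>"
  have r: "0 < r" "r < 1" using \<alpha> by (auto simp: r_def powr_less_one)
  define K where "K = (\<Sum>t. real (t + 1) ^ D * r ^ t)"
  have K: "0 \<le> K" unfolding K_def
    using r by (intro suminf_nonneg summable_poly_times_geometric) auto
  \<comment> \<open>With \<open>m + 1 \<le> 3 * L\<close> and \<open>2 ^ m \<le> Y / c\<close>, the
    number of cells is at most \<open>Y * L ^ D\<close>.\<close>
  define c :: real where "c = 2 * 3 ^ D"
  have c: "0 < c" by (simp add: c_def)
  \<comment> \<open>The first summand serves the hyperbolic cross, the second the case
    \<open>Y < c\<close>, in which the trivial bound 1 is already of the required order.\<close>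
  define C where "C = K * 3 ^ D * (2 * c) powr \<alpha> + c powr \<alpha>"
  have C: "0 < C" unfolding C_def using K c by (intro add_nonneg_pos) auto
  have "manifold_width N (M N) (holder_ball \<alpha> :: 'd linfty set)
      \<le> ennreal (C * (log 2 N powr (real D * (\<alpha> + 1)) / (real N * log 2 N) powr \<alpha>
        * log 2 (log 2 N) powr (real D * \<alpha>)))" if N: "N \<ge> 4" for N
  proof -
    define L where "L = log 2 N"
    define l where "l = log 2 L"
    define Y where "Y = real N * L * l powr (- real D) / L powr real D"
    note S = log_scales[OF N, folded L_def, folded l_def] width_scales[OF N, where D = D, folded L_def, folded l_def, folded Y_def]
    have rate: "L powr (real D * (\<alpha> + 1)) / (real N * L) powr \<alpha> * l powr (real D * \<alpha>) = L ^ D * Y powr - \<alpha>"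
      using S(1,2) N by (subst rate_eq) (auto simp: Y_def powr_realpow)
    have MN: "M N = nat \<lfloor>Y * L ^ D\<rfloor>" unfolding S(6) using M[OF N] by (simp add: D_def L_def l_def)
    have YL: "0 \<le> Y * L ^ D" using S by simp
    have N1: "N \<ge> 1" using N by simp
    have "manifold_width N (M N) (holder_ball \<alpha> :: 'd linfty set) \<le> ennreal (C * (L ^ D * Y powr - \<alpha>))"
    proof (cases "Y < c")
      case True
      have "1 \<le> L ^ D" using S(1) by (intro one_le_power) auto
      have "1 = c powr \<alpha> * c powr - \<alpha>" using c by (simp add: powr_add[symmetric])
      also have "\<dots> \<le> c powr \<alpha> * Y powr - \<alpha>"
        using True S(5) \<alpha> by (intro mult_left_mono powr_mono2') auto
      also have "\<dots> \<le> c powr \<alpha> * (L ^ D * Y powr - \<alpha>)"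
        using \<open>1 \<le> L ^ D\<close> by (intro mult_left_mono) (auto simp: mult_le_cancel_right1)
      also have "\<dots> \<le> C * (L ^ D * Y powr - \<alpha>)"
        unfolding C_def using K c S(1) by (intro mult_right_mono) auto
      finally have "1 \<le> C * (L ^ D * Y powr - \<alpha>)" .
      then have "1 \<le> ennreal (C * (L ^ D * Y powr - \<alpha>))" using ennreal_leI by fastforce
      with manifold_width_holder_ball_le_1[OF N1] show ?thesis by (rule order_trans)
    next
      case False
      \<comment> \<open>The largest level with \<open>2 ^ m \<le> Y / c\<close>; rounding down loses
        a factor 2 at most.\<close>
      define m where "m = nat \<lfloor>log 2 (Y / c)\<rfloor>"
      have "1 \<le> Y / c" using False c by simp
      then have l0: "0 \<le> log 2 (Y / c)" by simp
      then have mle: "real m \<le> log 2 (Y / c)" "log 2 (Y / c) < real m + 1"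
        unfolding m_def by linarith+
      have pY: "2 powr log 2 (Y / c) = Y / c" using S(5) c by simp
      have m1: "2 ^ m \<le> Y / c"
        using powr_mono[OF mle(1), of 2] unfolding pY by (simp add: powr_realpow)
      have m2: "Y / c \<le> 2 * 2 ^ m"
        using powr_mono[OF less_imp_le[OF mle(2)], of 2] unfolding pY by (simp add: powr_realpow powr_add)
      have "1 \<le> c" unfolding c_def using one_le_power[of "3::real" D] by linarith
      then have "Y / c \<le> Y" using S(5) by (simp add: divide_le_eq)
      then have "2 powr log 2 (Y / c) \<le> 2 powr (2 * L)" unfolding pY using S(7) by linarith
      then have "log 2 (Y / c) \<le> 2 * L" by simp
      then have m3: "real (m + 1) \<le> 3 * L" using mle(1) S(1) by simp
      have m3D: "real (m + 1) ^ D \<le> 3 ^ D * L ^ D"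
        using power_mono[OF m3, of D] by (simp add: power_mult_distrib)
      have "real (m + 1) ^ D * 2 ^ (m + 1) \<le> (3 ^ D * L ^ D) * (2 * (Y / c))"
        using m3D m1 S(1) by (intro mult_mono) auto
      also have "\<dots> = Y * L ^ D" by (simp add: c_def)
      also have "\<dots> < real (M N) + 1" unfolding MN using YL by linarith
      finally have dim: "real (m + 1) ^ (CARD('d) - 1) * 2 ^ (m + 1) < real (M N) + 1" by (simp add: D_def)
      have "r ^ m = (2 ^ m) powr - \<alpha>"
        by (simp add: r_def powr_realpow[symmetric] powr_powr mult.commute)
      also have "\<dots> \<le> (Y / (2 * c)) powr - \<alpha>"
        using m2 S(5) c \<alpha> by (intro powr_mono2') (auto simp: field_simps)
      also have "\<dots> = (2 * c) powr \<alpha> * Y powr - \<alpha>"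
        using S(5) c by (simp add: powr_divide powr_minus_divide)
      finally have "real (m + 1) ^ D * r ^ m \<le> (3 ^ D * L ^ D) * ((2 * c) powr \<alpha> * Y powr - \<alpha>)"
        using m3D r S(1) by (intro mult_mono) auto
      then have "K * (real (m + 1) ^ D * r ^ m) \<le> K * ((3 ^ D * L ^ D) * ((2 * c) powr \<alpha> * Y powr - \<alpha>))"
        using K by (rule mult_left_mono)
      also have "\<dots> = K * 3 ^ D * (2 * c) powr \<alpha> * (L ^ D * Y powr - \<alpha>)" by simp
      also have "\<dots> \<le> C * (L ^ D * Y powr - \<alpha>)"
        unfolding C_def using S(1) by (intro mult_right_mono) auto
      finally have "ennreal (K * (real (m + 1) ^ D * r ^ m)) \<le> ennreal (C * (L ^ D * Y powr - \<alpha>))"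
        by (rule ennreal_leI)
      moreover have "manifold_width N (M N) (holder_ball \<alpha> :: 'd linfty set)
          \<le> ennreal (K * (real (m + 1) ^ D * r ^ m))"
        using manifold_width_holder_ball_le[OF \<alpha>(1) N1 dim] by (simp add: K_def D_def r_def)
      ultimately show ?thesis by (rule order_trans[rotated])
    qed
    then show ?thesis unfolding rate[symmetric] by (simp add: L_def l_def)
  qed
  then show ?thesis using C unfolding D_def by blast
qed

lemma manifold_width_lower_rate:
  fixes \<alpha> :: real and M :: "nat \<Rightarrow> nat"
  assumes \<alpha>: "0 < \<alpha>" "\<alpha> < 1"
    and M: "\<And>N. N \<ge> 4 \<Longrightarrow>
      M N = nat \<lfloor>real N * log 2 N * log 2 (log 2 N) powr (- real (CARD('d) - 1))\<rfloor>"
  shows "\<exists>C>0. \<forall>N\<ge>4.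
      ennreal (log 2 N powr (real (CARD('d) - 1) * (\<alpha> + 1/2)) / (real N * log 2 N) powr \<alpha>
        * log 2 (log 2 N) powr (real (CARD('d) - 1) * \<alpha>))
      \<le> ennreal C * manifold_width N (M N) (holder_ball \<alpha> :: 'd::finite linfty set)"
proof -
  define D where "D = CARD('d) - 1"
  define d where "d = CARD('d)"
  have d: "0 < d" by (simp add: d_def)
  \<comment> \<open>The first summand yields \<open>2 powr (L / 2) \<le> R * Y\<close>, hence
    \<open>m \<ge> L / 4\<close>; the second one makes the atoms numerous enough for the dimension
    \<open>M N\<close>.\<close>
  define R where "R = fact (2 * D) * (2 / ln 2) ^ (2 * D) + 2 * 32 ^ d * (4 * real d) ^ D"
  have R: "fact (2 * D) * (2 / ln 2) ^ (2 * D) \<le> R" "2 * 32 ^ d * (4 * real d) ^ D \<le> R" "0 < R"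
    using d by (simp_all add: R_def add_nonneg_pos)
  \<comment> \<open>Collects the losses from \<open>4 ^ m \<le> 4 * R * Y\<close>, from the
    normalisation of atomic sums and from counting atoms.\<close>
  define k where "k = (4 * R) powr - \<alpha> / (32 * level_const \<alpha>) ^ d * sqrt (1 / ((4 * real d) ^ D * (2 * 8 ^ d)))"
  have k: "0 < k" using R(3) d level_const_ge(2)[OF \<alpha>] by (simp add: k_def)
  have "ennreal (log 2 N powr (real D * (\<alpha> + 1/2)) / (real N * log 2 N) powr \<alpha>
        * log 2 (log 2 N) powr (real D * \<alpha>))
      \<le> ennreal (1 / k) * manifold_width N (M N) (holder_ball \<alpha> :: 'd linfty set)" if N: "N \<ge> 4" for N
  proof -
    define L where "L = log 2 N"
    define l where "l = log 2 L"
    define Y where "Y = real N * L * l powr (- real D) / L powr real D"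
    note S = log_scales[OF N, folded L_def, folded l_def] width_scales[OF N, where D = D, folded L_def, folded l_def, folded Y_def]
    have rate: "L powr (real D * (\<alpha> + 1/2)) / (real N * L) powr \<alpha> * l powr (real D * \<alpha>)
        = L powr (real D / 2) * Y powr - \<alpha>"
      using S(1,2) N by (subst rate_eq) (auto simp: Y_def)
    have MN: "M N = nat \<lfloor>Y * L ^ D\<rfloor>" unfolding S(6) using M[OF N] by (simp add: D_def L_def l_def)
    have MY: "real (M N) \<le> Y * L ^ D" unfolding MN using S by simp
    \<comment> \<open>One factor is spent on the power of \<open>L\<close> between \<open>Y\<close>
      and N; the other remains as the lower bound for \<open>R * Y\<close>.\<close>
    have "2 powr (L / 2) * 2 powr (L / 2) = 2 powr L" by (simp add: powr_add[symmetric])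
    also have "\<dots> \<le> Y * L ^ (2 * D)" by (rule S(8))
    also have "\<dots> \<le> Y * (R * 2 powr (L / 2))"
    proof (rule mult_left_mono)
      have "L ^ (2 * D) \<le> fact (2 * D) * (2 / ln 2) ^ (2 * D) * 2 powr (L / 2)"
        using S(1) by (intro power_le_powr_half) simp
      also have "\<dots> \<le> R * 2 powr (L / 2)" by (intro mult_right_mono R) simp
      finally show "L ^ (2 * D) \<le> R * 2 powr (L / 2)" .
    qed (use S in simp)
    finally have "2 powr (L / 2) * 2 powr (L / 2) \<le> (R * Y) * 2 powr (L / 2)" by (simp add: mult_ac)
    then have RY: "2 powr (L / 2) \<le> R * Y" by (rule mult_right_le_imp_le) simp
    have RY0: "0 < R * Y" using R(3) S(5) by simp
    have "4 powr (L / 4) = 2 powr (L / 2)"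
    proof -
      have "4 powr (L / 4) = (2 powr 2) powr (L / 4)" by simp
      also have "\<dots> = 2 powr (L / 2)" unfolding powr_powr by simp
      finally show ?thesis .
    qed
    then have L4: "L / 4 \<le> log 4 (R * Y)" using RY RY0 by (subst le_log_iff) auto
    \<comment> \<open>Rounding up here, opposite to the upper bound: atoms must outnumber the
      dimension.\<close>
    define m where "m = nat \<lceil>log 4 (R * Y)\<rceil>"
    have m: "log 4 (R * Y) \<le> real m" "real m < log 4 (R * Y) + 1"
      using L4 S(1) unfolding m_def by linarith+
    have p: "4 powr log 4 (R * Y) = R * Y" using RY0 by simp
    have m1: "R * Y \<le> 4 ^ m"
      using powr_mono[OF m(1), of 4] unfolding p by (simp add: powr_realpow)
    have m2: "4 ^ m \<le> 4 * R * Y"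
      using powr_mono[OF less_imp_le[OF m(2)], of 4] p by (simp add: powr_realpow powr_add)
    define n where "n = card (atoms m :: ('d \<Rightarrow> nat \<times> nat) set)"
    have md: "L / (4 * real d) \<le> real (m div d + 1)"
    proof -
      have "m < (m div d + 1) * d" using dividend_less_div_times[OF d, of m] by simp
      then have "real m \<le> real ((m div d + 1) * d)" by (intro of_nat_mono) simp
      then have "L / 4 \<le> real (m div d + 1) * real d" using L4 m(1) by (simp only: of_nat_mult)
      then show ?thesis using d by (simp add: field_simps)
    qed
    have nge: "4 ^ m * (L ^ D / (4 * real d) ^ D) \<le> real n"
    proof -
      have "4 ^ m * (L / (4 * real d)) ^ D \<le> 4 ^ m * real (m div d + 1) ^ D"
        using S(1) by (intro mult_left_mono power_mono md) auto
      also have "\<dots> = real (4 ^ m * (m div d + 1) ^ D)" by simp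
      also have "\<dots> \<le> real n"
        unfolding n_def d_def D_def by (intro of_nat_mono card_atoms_ge)
      finally show ?thesis by (simp add: power_divide)
    qed
    have "2 * 32 ^ d * real (M N) \<le> 2 * 32 ^ d * (Y * L ^ D)"
      using MY by (intro mult_left_mono) auto
    also have "\<dots> = (2 * 32 ^ d * (4 * real d) ^ D) * Y * (L ^ D / (4 * real d) ^ D)"
      using d by simp
    also have "\<dots> \<le> R * Y * (L ^ D / (4 * real d) ^ D)"
      using S(1,5) by (intro mult_right_mono R) auto
    also have "\<dots> \<le> 4 ^ m * (L ^ D / (4 * real d) ^ D)"
      using S(1) by (intro mult_right_mono m1) auto
    also note nge
    finally have "real (2 * 32 ^ d * M N) \<le> real n" by simp
    then have n: "2 * 32 ^ CARD('d) * M N \<le> card (atoms m :: ('d \<Rightarrow> nat \<times> nat) set)"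
      unfolding n_def d_def by (simp only: of_nat_le_iff)
    define e where "e = 4 powr (- \<alpha> * real m) / (32 * level_const \<alpha>) ^ d * sqrt (real n / (2 * 8 ^ d * 4 ^ m))"
    have e: "ennreal e \<le> manifold_width N (M N) (holder_ball \<alpha> :: 'd linfty set)"
      using manifold_width_holder_ball_ge[OF \<alpha> n] by (simp add: e_def n_def d_def)
    have "k * (L powr (real D / 2) * Y powr - \<alpha>)
        = ((4 * R * Y) powr - \<alpha> / (32 * level_const \<alpha>) ^ d) * sqrt (L ^ D * (1 / ((4 * real d) ^ D * (2 * 8 ^ d))))"
    proof -
      have "sqrt (L ^ D) = L powr (real D / 2)"
        using S(1) by (simp add: powr_half_sqrt[symmetric] powr_realpow[symmetric] powr_powr)
      moreover have "(4 * R * Y) powr - \<alpha> = (4 * R) powr - \<alpha> * Y powr - \<alpha>"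
        using R(3) S(5) by (simp add: powr_mult)
      ultimately show ?thesis unfolding k_def real_sqrt_mult by simp
    qed
    also have "\<dots> \<le> e"
      unfolding e_def
    proof (intro mult_mono divide_right_mono)
      have "4 powr (- \<alpha> * real m) = (4 ^ m) powr - \<alpha>"
        by (simp add: powr_realpow[symmetric] powr_powr mult.commute)
      then show "(4 * R * Y) powr - \<alpha> \<le> 4 powr (- \<alpha> * real m)"
        using m2 \<alpha> by (auto intro!: powr_mono2')
      have "L ^ D * (1 / ((4 * real d) ^ D * (2 * 8 ^ d))) = 4 ^ m * (L ^ D / (4 * real d) ^ D) / (2 * 8 ^ d * 4 ^ m)"
        by simp
      also have "\<dots> \<le> real n / (2 * 8 ^ d * 4 ^ m)"
        using nge by (intro divide_right_mono) auto
      finally show "sqrt (L ^ D * (1 / ((4 * real d) ^ D * (2 * 8 ^ d)))) \<le> sqrt (real n / (2 * 8 ^ d * 4 ^ m))"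
        by simp
    qed (use S(1) level_const_ge(2)[OF \<alpha>] in auto)
    finally have "L powr (real D / 2) * Y powr - \<alpha> \<le> (1 / k) * e"
      using k by (simp add: field_simps)
    then have "ennreal (L powr (real D / 2) * Y powr - \<alpha>) \<le> ennreal ((1 / k) * e)" by (rule ennreal_leI)
    also have "\<dots> = ennreal (1 / k) * ennreal e"
      using k level_const_ge(2)[OF \<alpha>] by (intro ennreal_mult) (auto simp: e_def)
    also have "\<dots> \<le> ennreal (1 / k) * manifold_width N (M N) (holder_ball \<alpha> :: 'd linfty set)"
      by (intro mult_left_mono e) simp
    finally show ?thesis unfolding rate[symmetric] by (simp add: L_def l_def)
  qed
  then show ?thesis using k unfolding D_def by (intro exI[of _ "1 / k"]) auto
qed

theorem corollary3p5:
  fixes \<alpha> :: real and d :: nat and M :: "nat \<Rightarrow> nat"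
  assumes \<alpha>: "0 < \<alpha>" "\<alpha> < 1"
    and d: "d = CARD('d::finite)"
    and M: "\<And>N. N \<ge> 4 \<Longrightarrow>
      M N = nat \<lfloor>real N * log 2 N * log 2 (log 2 N) powr (- (real d - 1))\<rfloor>"
  shows "(\<exists>C>0. \<forall>N\<ge>4.
      ennreal (log 2 N powr ((real d - 1) * (\<alpha> + 1/2)) / (real N * log 2 N) powr \<alpha>
        * log 2 (log 2 N) powr ((real d - 1) * \<alpha>))
      \<le> ennreal C * manifold_width N (M N) (holder_ball \<alpha> :: 'd linfty set)) \<and>
    (\<exists>C>0. \<forall>N\<ge>4.
      manifold_width N (M N) (holder_ball \<alpha> :: 'd linfty set)
      \<le> ennreal (C * (log 2 N powr ((real d - 1) * (\<alpha> + 1)) / (real N * log 2 N) powr \<alpha>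
        * log 2 (log 2 N) powr ((real d - 1) * \<alpha>))))"
proof -
  \<comment> \<open>The truncated subtraction is harmless, as index types are nonempty.\<close>
  have D: "real d - 1 = real (CARD('d) - 1)" unfolding d by (simp add: of_nat_diff Suc_leI)
  note M' = M[unfolded D]
  show ?thesis
    unfolding D using manifold_width_lower_rate[where 'd = 'd, OF \<alpha> M'] manifold_width_upper_rate[where 'd = 'd, OF \<alpha> M'] by blast
qed

end
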